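(* Let $k\ge2$ and let $A\in\operatorname{GL}_2(\mathbb{Z})$ have a real eigenvalue $\lambda>1$. Then there exists a mutually cobounded $(L^\infty,\exp^\diamond)$-integrable measure equivalence coupling from the lamplighter group $(\mathbb{Z}/k\mathbb{Z})\wr\mathbb{Z}$ to $\operatorname{SOL}_A=\mathbb{Z}^2\rtimes_A\mathbb{Z}$.
   Context: $|\cdot|$ denotes word length with respect to a fixed finite generating set (the notions below do not depend on the choice). Measure equivalence (ME) coupling from $G$ to $H$: a standard Borel $\sigma$-finite measure space $(\Omega,\mu)$ with commuting, free, measure preserving actions of $G$ and $H$ (denoted $*$) admitting Borel fundamental domains $X_G$ and $X_H$ (up to null sets) with $\mu(X_H)=1$ and $\mu(X_G)<\infty$. It is mutually cobounded if, up to measure zero, $X_G$ is contained in finitely many $H$-translates of $X_H$ and $X_H$ is contained in finitely many $G$-translates of $X_G$. Its cocycles: $\alpha\colon G\times X_H\to H$ where $\alpha(g,x)$ is the unique element of $H$ with $\alpha(g,x)*(g*x)\in X_H$, and $\beta\colon H\times X_G\to G$ where $\beta(h,x)$ is the unique element of $G$ with $\beta(h,x)*(h*x)\in X_G$ (a.e.). The coupling is $(L^\infty,\exp^\diamond)$-integrable if for every $g\in G$ the function $x\mapsto|\alpha(g,x)|$ is essentially bounded on $X_H$, and for every $\varepsilon>0$ there exist $\delta>0$ and $C>0$ such that $\int_{X_G}\exp(\delta|\beta(h,x)|)\,d\mu(x)\le C\exp(\varepsilon|h|)$ for every $h\in H$. *)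

theory Defs
  imports
    "HOL-Analysis.Analysis"
    "HOL-Algebra.Group_Action"
    "HOL-Algebra.Generated_Groups"
    "HOL-Algebra.Elementary_Groups"
    "HOL-Algebra.Product_Groups"
begin

section \<open>The groups\<close>

text \<open>The semidirect product of \<open>N\<close> and \<open>H\<close> for an action \<open>\<phi>\<close> of \<open>H\<close> on \<open>N\<close> by automorphisms, with
  the convention \<open>(n, h) (n', h') = (n \<phi>\<^sub>h(n'), h h')\<close>.\<close>

definition semidirect_product ::
    "'n monoid \<Rightarrow> 'h monoid \<Rightarrow> ('h \<Rightarrow> 'n \<Rightarrow> 'n) \<Rightarrow> ('n \<times> 'h) monoid" where
  "semidirect_product N H \<phi> =
     \<lparr>carrier = carrier N \<times> carrier H,
      monoid.mult = (\<lambda>(n, h) (n', h'). (n \<otimes>\<^bsub>N\<^esub> \<phi> h n', h \<otimes>\<^bsub>H\<^esub> h')),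
      one = (\<one>\<^bsub>N\<^esub>, \<one>\<^bsub>H\<^esub>)\<rparr>"

definition lamplighter_group :: "nat \<Rightarrow> ((int \<Rightarrow> int) \<times> int) monoid" where
  "lamplighter_group k =
     semidirect_product (sum_group UNIV (\<lambda>i::int. integer_mod_group k)) integer_group
       (\<lambda>m f i. f (i - m))"

definition GL2_int :: "(int^2^2) monoid" where
  "GL2_int = \<lparr>carrier = {A. invertible A}, monoid.mult = (**), one = mat 1\<rparr>"

definition int_square_group :: "(int^2) monoid" where
  "int_square_group = \<lparr>carrier = UNIV, monoid.mult = (+), one = 0\<rparr>"

text \<open>The power of \<open>A\<close> is taken in the group \<open>GL2_int\<close>, so that negative exponents make sense
  (and since the power operation on vectors is componentwise).\<close>

definition SOL_group :: "int^2^2 \<Rightarrow> ((int^2) \<times> int) monoid" where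
  "SOL_group A =
     semidirect_product int_square_group integer_group (\<lambda>n v. (A [^]\<^bsub>GL2_int\<^esub> n) *v v)"


section \<open>Word length\<close>

definition finite_generating_set :: "'g monoid \<Rightarrow> 'g set \<Rightarrow> bool" where
  "finite_generating_set G S \<longleftrightarrow> finite S \<and> S \<subseteq> carrier G \<and> generate G S = carrier G"

definition word_length :: "'g monoid \<Rightarrow> 'g set \<Rightarrow> 'g \<Rightarrow> nat" where
  "word_length G S g =
     (LEAST n. \<exists>ws. length ws = n \<and> set ws \<subseteq> S \<union> m_inv G ` S \<and>
                    foldr (\<otimes>\<^bsub>G\<^esub>) ws \<one>\<^bsub>G\<^esub> = g)"


section \<open>Measure equivalence couplings\<close>

text \<open>Every Polish space embeds in the space of real sequences, so up to isomorphism every standard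
  Borel space has as its carrier a set of real sequences. Existence of a coupling can therefore be
  stated with the element type \<open>nat \<Rightarrow> real\<close>.\<close>

definition standard_borel :: "'w measure \<Rightarrow> bool" where
  "standard_borel M \<longleftrightarrow>
     (\<exists>T. topspace T = space M \<and> completely_metrizable_space T \<and> separable_space T \<and>
          sets M = sigma_sets (space M) {U. openin T U})"

text \<open>The library's \<open>group_action\<close> requires the map given by a group element to be extensional
  (\<open>undefined\<close> outside \<open>space M\<close>); this puts no restriction on the action itself.
  It also includes that \<open>G\<close> is a group.\<close>

locale free_mp_action = group_action G "space M" act
  for G :: "'g monoid" and M :: "'w measure" and act :: "'g \<Rightarrow> 'w \<Rightarrow> 'w" +
  assumes measurable_act: "g \<in> carrier G \<Longrightarrow> act g \<in> M \<rightarrow>\<^sub>M M"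
    and measure_preserving: "g \<in> carrier G \<Longrightarrow> distr M M (act g) = M"
    and free: "\<lbrakk>g \<in> carrier G; x \<in> space M; act g x = x\<rbrakk> \<Longrightarrow> g = \<one>\<^bsub>G\<^esub>"

definition fundamental_domain ::
    "'g monoid \<Rightarrow> 'w measure \<Rightarrow> ('g \<Rightarrow> 'w \<Rightarrow> 'w) \<Rightarrow> 'w set \<Rightarrow> bool" where
  "fundamental_domain G M act X \<longleftrightarrow>
     X \<in> sets M \<and> (AE x in M. \<exists>!g. g \<in> carrier G \<and> act g x \<in> X)"

locale me_coupling =
  G: free_mp_action G M actG + H: free_mp_action H M actH + sigma_finite_measure M
  for G :: "'g monoid" and H :: "'h monoid" and M :: "'w measure"
    and actG :: "'g \<Rightarrow> 'w \<Rightarrow> 'w" and actH :: "'h \<Rightarrow> 'w \<Rightarrow> 'w"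
    and XG XH :: "'w set" +
  assumes standard_borel: "standard_borel M"
    and commute: "\<lbrakk>g \<in> carrier G; h \<in> carrier H; x \<in> space M\<rbrakk>
                    \<Longrightarrow> actG g (actH h x) = actH h (actG g x)"
    and fundamental_domain_XG: "fundamental_domain G M actG XG"
    and fundamental_domain_XH: "fundamental_domain H M actH XH"
    and measure_XH: "emeasure M XH = 1"
    and measure_XG: "emeasure M XG < \<infinity>"

definition covered_by_finitely_many_translates ::
    "'g monoid \<Rightarrow> 'w measure \<Rightarrow> ('g \<Rightarrow> 'w \<Rightarrow> 'w) \<Rightarrow> 'w set \<Rightarrow> 'w set \<Rightarrow> bool" where
  "covered_by_finitely_many_translates G M act X Y \<longleftrightarrow>
     (\<exists>F. finite F \<and> F \<subseteq> carrier G \<and> (AE x in M. x \<in> Y \<longrightarrow> x \<in> (\<Union>g\<in>F. act g ` X)))"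

definition mutually_cobounded ::
    "'g monoid \<Rightarrow> 'h monoid \<Rightarrow> 'w measure \<Rightarrow> ('g \<Rightarrow> 'w \<Rightarrow> 'w) \<Rightarrow> ('h \<Rightarrow> 'w \<Rightarrow> 'w)
       \<Rightarrow> 'w set \<Rightarrow> 'w set \<Rightarrow> bool" where
  "mutually_cobounded G H M actG actH XG XH \<longleftrightarrow>
     covered_by_finitely_many_translates H M actH XH XG \<and>
     covered_by_finitely_many_translates G M actG XG XH"

text \<open>\<open>coupling_cocycle H actH XH actG\<close> is the cocycle \<open>\<alpha> : G \<times> XH \<rightarrow> H\<close> and
  \<open>coupling_cocycle G actG XG actH\<close> is the cocycle \<open>\<beta> : H \<times> XG \<rightarrow> G\<close>. In a coupling the
  described element exists and is unique for almost every \<open>x\<close>; elsewhere the value is arbitrary.\<close>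

definition coupling_cocycle ::
    "'h monoid \<Rightarrow> ('h \<Rightarrow> 'w \<Rightarrow> 'w) \<Rightarrow> 'w set \<Rightarrow> ('g \<Rightarrow> 'w \<Rightarrow> 'w) \<Rightarrow> 'g \<Rightarrow> 'w \<Rightarrow> 'h" where
  "coupling_cocycle H actH XH actG g x = (THE h. h \<in> carrier H \<and> actH h (actG g x) \<in> XH)"

text \<open>Integrability does not depend on the finite generating sets \<open>S\<close> and \<open>T\<close>. It is required for
  all of them, and that there are such sets is part of the definition, so that it is never vacuous.\<close>

definition Linf_exp_diamond_integrable ::
    "'g monoid \<Rightarrow> 'h monoid \<Rightarrow> 'w measure \<Rightarrow> ('g \<Rightarrow> 'w \<Rightarrow> 'w) \<Rightarrow> ('h \<Rightarrow> 'w \<Rightarrow> 'w)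
       \<Rightarrow> 'w set \<Rightarrow> 'w set \<Rightarrow> bool" where
  "Linf_exp_diamond_integrable G H M actG actH XG XH \<longleftrightarrow>
     (\<exists>S. finite_generating_set G S) \<and> (\<exists>T. finite_generating_set H T) \<and>
     (\<forall>S T. finite_generating_set G S \<longrightarrow> finite_generating_set H T \<longrightarrow>
        (\<forall>g\<in>carrier G. \<exists>C::nat. AE x in M. x \<in> XH \<longrightarrow>
           word_length H T (coupling_cocycle H actH XH actG g x) \<le> C) \<and>
        (\<forall>\<epsilon>>0. \<exists>\<delta>>0. \<exists>C>0. \<forall>h\<in>carrier H.
           (\<integral>\<^sup>+x\<in>XG. ennreal (exp (\<delta> * real (word_length G S
               (coupling_cocycle G actG XG actH h x)))) \<partial>M)
             \<le> ennreal (C * exp (\<epsilon> * real (word_length H T h)))))"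

end

theory Submission
  imports Defs "HOL-Probability.Infinite_Product_Measure"
begin

text \<open>The lamplighter group and SOL both act on horocyclic products: of two regular trees with \<open>k + 1\<close>
  edges at each vertex, and of two hyperbolic planes. A tree with a height function maps to the
  hyperbolic plane when its vertices are read as the intervals of the nested grids with base \<open>k\<close> on the
  real line, and a random position of the grids makes the picture invariant under translations. The
  coupling space consists of a point of the plane with its height, together with random grids in the
  two coordinate directions; relative to the point, the grids are two independent sequences of
  uniform digits, infinite in both directions. SOL acts by affine maps on the point, in
  coordinates \<open>(P, Q)\<close> that diagonalize \<open>A\<close>, and carries the grids along, so it does not change the
  digits. The lamplighter group fixes the grids and moves the point: a lamp changes one digit in each
  sequence, without carry, and a step of the lamplighter changes the height by one level of the grids,
  so it shifts the digits. The actions commute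
  (\<open>actions_commute\<close>). The heights of both groups are translations of the real line by \<open>1\<close> and by the
  logarithm \<open>climb\<close> of \<open>l\<close> to base \<open>k\<close>, and translations commute whatever the ratio of the steps. A sign
  orients the second grid, for \<open>A\<close> may have the negative eigenvalue \<open>- 1 / l\<close>.

  A fundamental domain of the lamplighter group is given by the condition that the height lies in
  \<open>[0, 1)\<close> and that the cell of level \<open>0\<close> around the point contains the origin of the plane. To reach it
  the cell has to be moved by a whole number of cells, which means to add with carry, and almost
  surely the carry ends (\<open>lamp_fundamental_domain\<close>). For SOL the condition is that the centre of that
  cell lies in a fundamental parallelogram of the lattice (\<open>sol_return_ex1\<close>). The parallelogram is
  chosen so small that then the cell contains the origin (\<open>walk_sol_domain\<close>); so finitely many
  translates of the first domain cover the second. Conversely SOL acts properly on bounded sets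
  (\<open>finite_sol_returns\<close>), which gives the other covering and the boundedness of the cocycle with values
  in SOL.

  For the other cocycle, an element of SOL of length \<open>n\<close> moves the height by \<open>O(n)\<close> and the point by at
  most \<open>exp (O(n))\<close> (\<open>word_length_SOL_ge\<close>). So the carry that brings the point back starts at a place
  \<open>O(n)\<close>, and it runs for \<open>j\<close> more places with probability at most \<open>4 / 2\<^sup>j\<close> (\<open>long_carry_measure\<close>). As
  the word length in the lamplighter group is linear in the interval in which something happens
  (\<open>word_length_lamplighter_le\<close>), the cocycle has length \<open>O(n + j)\<close>. Its exponential with a small factor
  \<open>\<delta>\<close> has an integral of order at most \<open>exp (O(\<delta> n))\<close> (\<open>beta_integrable\<close>).\<close>

section \<open>Semidirect products and word length\<close>

lemma semidirect_product_simps: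
  "carrier (semidirect_product N H \<phi>) = carrier N \<times> carrier H"
  "(n, h) \<otimes>\<^bsub>semidirect_product N H \<phi>\<^esub> (n', h') = (n \<otimes>\<^bsub>N\<^esub> \<phi> h n', h \<otimes>\<^bsub>H\<^esub> h')"
  "\<one>\<^bsub>semidirect_product N H \<phi>\<^esub> = (\<one>\<^bsub>N\<^esub>, \<one>\<^bsub>H\<^esub>)"
  by (simp_all add: semidirect_product_def)

lemma group_semidirect_product:
  assumes N: "group N" and H: "group H"
    and hom: "\<And>h. h \<in> carrier H \<Longrightarrow> \<phi> h \<in> hom N N"
    and act: "\<And>h h' n. \<lbrakk>h \<in> carrier H; h' \<in> carrier H; n \<in> carrier N\<rbrakk>
                \<Longrightarrow> \<phi> (h \<otimes>\<^bsub>H\<^esub> h') n = \<phi> h (\<phi> h' n)"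
    and act_one: "\<And>n. n \<in> carrier N \<Longrightarrow> \<phi> \<one>\<^bsub>H\<^esub> n = n"
  shows "group (semidirect_product N H \<phi>)"
proof -
  interpret N: group N by fact
  interpret H: group H by fact
  have closed: "\<phi> h n \<in> carrier N" if "h \<in> carrier H" "n \<in> carrier N" for h n
    using hom_in_carrier[OF hom] that by blast
  have mult: "\<phi> h (n \<otimes>\<^bsub>N\<^esub> n') = \<phi> h n \<otimes>\<^bsub>N\<^esub> \<phi> h n'"
    if "h \<in> carrier H" "n \<in> carrier N" "n' \<in> carrier N" for h n n'
    using hom_mult[OF hom] that by blast
  show ?thesis
  proof (rule groupI)
    fix x assume "x \<in> carrier (semidirect_product N H \<phi>)"
    then obtain n h where x: "x = (n, h)" "n \<in> carrier N" "h \<in> carrier H"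
      by (auto simp: semidirect_product_simps)
    let ?y = "(\<phi> (inv\<^bsub>H\<^esub> h) (inv\<^bsub>N\<^esub> n), inv\<^bsub>H\<^esub> h)"
    have "?y \<otimes>\<^bsub>semidirect_product N H \<phi>\<^esub> x
        = (\<phi> (inv\<^bsub>H\<^esub> h) (inv\<^bsub>N\<^esub> n \<otimes>\<^bsub>N\<^esub> n), \<one>\<^bsub>H\<^esub>)"
      using x by (simp add: semidirect_product_simps mult[symmetric] del: N.l_inv)
    also have "\<dots> = \<one>\<^bsub>semidirect_product N H \<phi>\<^esub>"
      using x group_hom.hom_one[of N N "\<phi> (inv\<^bsub>H\<^esub> h)"] hom[of "inv\<^bsub>H\<^esub> h"]
      by (simp add: semidirect_product_simps group_hom_def group_hom_axioms_def N)
    finally show "\<exists>y\<in>carrier (semidirect_product N H \<phi>).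
        y \<otimes>\<^bsub>semidirect_product N H \<phi>\<^esub> x = \<one>\<^bsub>semidirect_product N H \<phi>\<^esub>"
      using x by (intro bexI[of _ ?y]) (auto simp: semidirect_product_simps closed)
  qed (auto simp: semidirect_product_simps closed mult act act_one N.m_assoc H.m_assoc)
qed

context group
begin

lemma foldr_mult_closed: "set ws \<subseteq> carrier G \<Longrightarrow> foldr (\<otimes>) ws \<one> \<in> carrier G"
  by (induction ws) auto

lemma foldr_mult_append:
  "\<lbrakk>set xs \<subseteq> carrier G; set ys \<subseteq> carrier G\<rbrakk>
    \<Longrightarrow> foldr (\<otimes>) (xs @ ys) \<one> = foldr (\<otimes>) xs \<one> \<otimes> foldr (\<otimes>) ys \<one>"
proof (induction xs)
  case Nil
  then show ?case using foldr_mult_closed[of ys] by simp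
next
  case (Cons a xs)
  then show ?case
    using foldr_mult_closed[of xs] foldr_mult_closed[of ys] by (simp add: m_assoc)
qed

lemma word_letters_closed:
  "S \<subseteq> carrier G \<Longrightarrow> S \<union> m_inv G ` S \<subseteq> carrier G"
  by auto

lemma generate_imp_word:
  assumes "S \<subseteq> carrier G" "g \<in> generate G S"
  shows "\<exists>ws. set ws \<subseteq> S \<union> m_inv G ` S \<and> foldr (\<otimes>) ws \<one> = g"
  using assms(2)
proof (induction rule: generate.induct)
  case one
  show ?case by (intro exI[of _ "[]"]) simp
next
  case (incl h)
  then show ?case using assms(1) by (intro exI[of _ "[h]"]) auto
next
  case (inv h)
  then show ?case using assms(1) by (intro exI[of _ "[inv h]"]) auto
next
  case (eng h1 h2)
  then obtain u v where "set u \<subseteq> S \<union> m_inv G ` S" "foldr (\<otimes>) u \<one> = h1"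
    "set v \<subseteq> S \<union> m_inv G ` S" "foldr (\<otimes>) v \<one> = h2" by blast
  then show ?case using foldr_mult_append[of u v] word_letters_closed[OF assms(1)]
    by (intro exI[of _ "u @ v"]) auto
qed

end

lemma word_length_attained:
  fixes G :: "'g monoid" (structure)
  assumes "group G" "finite_generating_set G S" "g \<in> carrier G"
  obtains ws where "length ws = word_length G S g" "set ws \<subseteq> S \<union> m_inv G ` S"
    "foldr (\<otimes>) ws \<one> = g"
proof -
  interpret group G by fact
  have "\<exists>n ws. length ws = n \<and> set ws \<subseteq> S \<union> m_inv G ` S \<and> foldr (\<otimes>) ws \<one> = g"
    using generate_imp_word[of S g] assms by (auto simp: finite_generating_set_def)
  from LeastI_ex[OF this] show ?thesis
    using that unfolding word_length_def by blast
qed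

lemma word_length_le:
  fixes G :: "'g monoid" (structure)
  shows "\<lbrakk>set ws \<subseteq> S \<union> m_inv G ` S; foldr (\<otimes>) ws \<one> = g\<rbrakk> \<Longrightarrow> word_length G S g \<le> length ws"
  unfolding word_length_def by (rule Least_le) auto

lemma word_length_one: "word_length G S \<one>\<^bsub>G\<^esub> = 0"
  using word_length_le[of "[]" S G "\<one>\<^bsub>G\<^esub>"] by simp

lemma word_length_mult_le:
  fixes G :: "'g monoid" (structure)
  assumes "group G" and S: "finite_generating_set G S" and "g \<in> carrier G" "h \<in> carrier G"
  shows "word_length G S (g \<otimes> h) \<le> word_length G S g + word_length G S h"
proof -
  interpret group G by fact
  from word_length_attained[OF \<open>group G\<close> S assms(3)] obtain u where u: "length u = word_length G S g"
    "set u \<subseteq> S \<union> m_inv G ` S" "foldr (\<otimes>) u \<one> = g" .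
  from word_length_attained[OF \<open>group G\<close> S assms(4)] obtain v where v: "length v = word_length G S h"
    "set v \<subseteq> S \<union> m_inv G ` S" "foldr (\<otimes>) v \<one> = h" .
  have "S \<union> m_inv G ` S \<subseteq> carrier G"
    using S word_letters_closed by (auto simp: finite_generating_set_def)
  then have "foldr (\<otimes>) (u @ v) \<one> = g \<otimes> h"
    using u v foldr_mult_append[of u v] by auto
  from word_length_le[OF _ this] u v show ?thesis by simp
qed

section \<open>The lamplighter group\<close>

lemma carrier_lamplighter:
  "k > 0 \<Longrightarrow> (f, m) \<in> carrier (lamplighter_group k) \<longleftrightarrow>
     (\<forall>i. 0 \<le> f i \<and> f i < int k) \<and> finite {i. f i \<noteq> 0}"
  by (auto simp: lamplighter_group_def semidirect_product_simps carrier_sum_group PiE_iff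
      carrier_integer_mod_group)

lemma mult_lamplighter:
  "(f, m) \<otimes>\<^bsub>lamplighter_group k\<^esub> (f', m') = (\<lambda>i. (f i + f' (i - m)) mod int k, m + m')"
  by (simp add: lamplighter_group_def semidirect_product_simps restrict_UNIV)

lemma one_lamplighter: "\<one>\<^bsub>lamplighter_group k\<^esub> = (\<lambda>i. 0, 0)"
  by (simp add: lamplighter_group_def semidirect_product_simps restrict_UNIV)

lemma finite_shifted_support:
  fixes f :: "int \<Rightarrow> int"
  assumes "finite {i. f i \<noteq> 0}"
  shows "finite {i. f (i - m) \<noteq> 0}"
proof -
  have "{i. f (i - m) \<noteq> 0} = (\<lambda>i. i + m) ` {i. f i \<noteq> 0}"
  proof (rule equalityI; rule subsetI)
    fix i assume "i \<in> {i. f (i - m) \<noteq> 0}"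
    then show "i \<in> (\<lambda>i. i + m) ` {i. f i \<noteq> 0}" by (intro image_eqI[of _ _ "i - m"]) auto
  qed auto
  then show ?thesis using assms by simp
qed

lemma group_lamplighter:
  assumes "k > 0"
  shows "group (lamplighter_group k)"
  unfolding lamplighter_group_def
proof (rule group_semidirect_product)
  let ?N = "sum_group (UNIV :: int set) (\<lambda>i. integer_mod_group k)"
  fix h :: int
  show "(\<lambda>f i. f (i - h)) \<in> hom ?N ?N"
    using assms finite_shifted_support[of _ h]
    by (auto simp: hom_def carrier_sum_group PiE_iff carrier_integer_mod_group)
qed (auto simp: algebra_simps)

text \<open>To reach an element, go to one end of an interval that contains the lit lamps, sweep over it once
  while setting the lamps, and return. This uses a number of generators linear in the length of the
  interval. The predicate \<open>V\<close> stands for any subadditive bound on cost: with the word length it gives the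
  linear estimate below, with membership in the generated subgroup it gives finite generation.\<close>

lemma lamplighter_sweep:
  fixes V :: "((int \<Rightarrow> int) \<times> int) \<Rightarrow> nat \<Rightarrow> bool"
  assumes k: "k \<ge> 2"
    and one: "V \<one>\<^bsub>lamplighter_group k\<^esub> 0"
    and mult: "\<And>g h m n. \<lbrakk>g \<in> carrier (lamplighter_group k); h \<in> carrier (lamplighter_group k);
                 V g m; V h n\<rbrakk> \<Longrightarrow> V (g \<otimes>\<^bsub>lamplighter_group k\<^esub> h) (m + n)"
    and mono: "\<And>g m n. \<lbrakk>V g m; m \<le> n\<rbrakk> \<Longrightarrow> V g n"
    and a: "V (\<lambda>i. if i = 0 then 1 else 0, 0) K"
    and t: "V (\<lambda>i. 0, 1) K" and t': "V (\<lambda>i. 0, -1) K"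
    and g: "(f, m) \<in> carrier (lamplighter_group k)" "\<forall>i. f i \<noteq> 0 \<longrightarrow> \<bar>i\<bar> \<le> int N"
      "\<bar>m\<bar> \<le> int N"
  shows "V (f, m) (((k + 2) * (2 * N + 1) + 3 * N) * K)"
proof -
  let ?G = "lamplighter_group k"
  have k0: "k > 0" using k by simp
  note carrier = carrier_lamplighter[OF k0]
  interpret group ?G by (rule group_lamplighter[OF k0])
  have lamp: "V (\<lambda>i. if i = 0 then int c else 0, 0) (c * K)" if "c < k" for c
    using that
  proof (induction c)
    case 0
    then show ?case using one by (simp add: one_lamplighter cong: if_cong)
  next
    case (Suc c)
    have "(\<lambda>i. if i = 0 then int (Suc c) else 0, 0) =
        (\<lambda>i. if i = 0 then 1 else 0, 0) \<otimes>\<^bsub>?G\<^esub> (\<lambda>i. if i = 0 then int c else 0, 0)"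
      using Suc.prems by (auto simp: mult_lamplighter fun_eq_iff)
    moreover have "V \<dots> (K + c * K)"
      using Suc k by (intro mult a) (auto simp: carrier)
    ultimately show ?case by simp
  qed
  have walk_mem: "(\<lambda>i. 0, j) \<in> carrier ?G" for j
    using k0 by (simp add: carrier)
  have walk: "V (\<lambda>i. 0, int n) (n * K) \<and> V (\<lambda>i. 0, - int n) (n * K)" for n
  proof (induction n)
    case 0
    then show ?case using one by (simp add: one_lamplighter)
  next
    case (Suc n)
    have "V ((\<lambda>i. 0, 1) \<otimes>\<^bsub>?G\<^esub> (\<lambda>i. 0, int n)) (K + n * K)"
      "V ((\<lambda>i. 0, -1) \<otimes>\<^bsub>?G\<^esub> (\<lambda>i. 0, - int n)) (K + n * K)"
      using Suc k by (auto intro!: mult t t' simp: carrier)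
    then show ?case by (simp add: mult_lamplighter)
  qed
  have walk_int: "V (\<lambda>i. 0, j) (n * K)" if "\<bar>j\<bar> \<le> int n" for j n
  proof -
    have "j = int (nat \<bar>j\<bar>) \<or> j = - int (nat \<bar>j\<bar>)" by linarith
    with walk[of "nat \<bar>j\<bar>"] have "V (\<lambda>i. 0, j) (nat \<bar>j\<bar> * K)" by auto
    moreover have "nat \<bar>j\<bar> * K \<le> n * K" using that by (intro mult_le_mono1) linarith
    ultimately show ?thesis by (rule mono)
  qed
  have sweep: "V (h, 0) (n * ((k + 2) * K))"
    if "(h, 0) \<in> carrier ?G" "\<forall>i. h i \<noteq> 0 \<longrightarrow> 0 \<le> i \<and> i < int n" for h n
    using that
  proof (induction n arbitrary: h)
    case 0
    have "h i = 0" for i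
      using spec[OF 0(2), of i] by (cases "h i = 0") simp_all
    then have "h = (\<lambda>i. 0)" by (rule ext)
    then show ?case using one by (simp add: one_lamplighter)
  next
    case (Suc n)
    let ?h = "\<lambda>i. if i < 0 then 0 else h (i + 1)"
    let ?d = "(\<lambda>i. if i = 0 then int (nat (h 0)) else 0, 0)"
    have fin: "finite {i. ?h i \<noteq> 0}"
    proof (rule finite_subset)
      show "{i. ?h i \<noteq> 0} \<subseteq> {0..int n}"
      proof
        fix i assume "i \<in> {i. ?h i \<noteq> 0}"
        then have "0 \<le> i" "h (i + 1) \<noteq> 0" by (auto split: if_splits)
        with Suc.prems(2) have "i + 1 < int (Suc n)" by blast
        with \<open>0 \<le> i\<close> show "i \<in> {0..int n}" by simp
      qed
    qed simp
    have mem: "(?h, 0) \<in> carrier ?G" "?d \<in> carrier ?G"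
      using Suc.prems(1) fin k0 by (simp_all only: carrier) simp_all
    have h0: "h i = 0" if "i < 0" for i
      using spec[OF Suc.prems(2), of i] that by linarith
    have "(h, 0) = ?d \<otimes>\<^bsub>?G\<^esub> ((\<lambda>i. 0, 1) \<otimes>\<^bsub>?G\<^esub> ((?h, 0) \<otimes>\<^bsub>?G\<^esub> (\<lambda>i. 0, -1)))"
      unfolding mult_lamplighter prod.inject fun_eq_iff
      using Suc.prems(1) h0 by (simp add: carrier)
    moreover have "V \<dots> (nat (h 0) * K + (K + (n * ((k + 2) * K) + K)))"
    proof (intro mult lamp t t')
      show "V (?h, 0) (n * ((k + 2) * K))"
      proof (intro Suc.IH mem allI impI)
        fix i assume "?h i \<noteq> 0"
        then have "0 \<le> i" "h (i + 1) \<noteq> 0" by (auto split: if_splits)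
        with Suc.prems(2) have "i + 1 < int (Suc n)" by blast
        with \<open>0 \<le> i\<close> show "0 \<le> i \<and> i < int n" by simp
      qed
      show "nat (h 0) < k" using Suc.prems(1) k0 by (auto simp: carrier nat_less_iff)
    qed (use mem walk_mem in \<open>simp_all add: m_closed\<close>)
    moreover have "nat (h 0) * K + (K + (n * ((k + 2) * K) + K)) \<le> Suc n * ((k + 2) * K)"
    proof -
      have "nat (h 0) \<le> k" using Suc.prems(1) k0 by (auto simp: carrier nat_le_iff less_imp_le)
      then have "nat (h 0) * K \<le> k * K" by simp
      then show ?thesis by (simp add: algebra_simps)
    qed
    ultimately show ?case using mono by metis
  qed
  let ?s = "\<lambda>i. f (i - int N)"
  have s: "(?s, 0) \<in> carrier ?G"
    using g(1) finite_shifted_support[of f "int N"] by (auto simp: carrier)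
  have "(f, m) = (\<lambda>i. 0, - int N) \<otimes>\<^bsub>?G\<^esub> ((?s, 0) \<otimes>\<^bsub>?G\<^esub> (\<lambda>i. 0, int N + m))"
    using g(1) by (auto simp: mult_lamplighter fun_eq_iff carrier)
  moreover have "V \<dots> (N * K + ((2 * N + 1) * ((k + 2) * K) + (2 * N) * K))"
  proof (intro mult walk_int sweep s)
    show "\<forall>i. ?s i \<noteq> 0 \<longrightarrow> 0 \<le> i \<and> i < int (2 * N + 1)"
    proof (intro allI impI)
      fix i assume "?s i \<noteq> 0"
      with g(2) have "\<bar>i - int N\<bar> \<le> int N" by blast
      then show "0 \<le> i \<and> i < int (2 * N + 1)" by linarith
    qed
  qed (use g(3) s walk_mem in \<open>simp_all add: m_closed\<close>)
  moreover have "N * K + ((2 * N + 1) * ((k + 2) * K) + (2 * N) * K)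
      = ((k + 2) * (2 * N + 1) + 3 * N) * K" by (simp add: algebra_simps)
  ultimately show ?thesis by (simp only:)
qed

lemma finite_support_bounded:
  fixes f :: "int \<Rightarrow> int"
  assumes "finite {i. f i \<noteq> 0}"
  obtains N :: nat where "\<forall>i. f i \<noteq> 0 \<longrightarrow> \<bar>i\<bar> \<le> int N" "\<bar>m\<bar> \<le> int N"
proof -
  have fin: "finite (insert m {i. f i \<noteq> 0})" using assms by simp
  then obtain N where "\<forall>i\<in>insert m {i. f i \<noteq> 0}. nat \<bar>i\<bar> \<le> N"
    using finite_nat_set_iff_bounded_le[of "(\<lambda>i. nat \<bar>i\<bar>) ` insert m {i. f i \<noteq> 0}"] by auto
  then show ?thesis by (intro that[of N]) auto
qed

lemma ex_finite_generating_set_lamplighter: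
  assumes k: "k \<ge> 2"
  shows "\<exists>S. finite_generating_set (lamplighter_group k) S"
proof -
  let ?G = "lamplighter_group k"
  let ?a = "(\<lambda>i::int. if i = 0 then 1 else 0 :: int, 0 :: int)" and ?t = "(\<lambda>i::int. 0 :: int, 1 :: int)"
  have k0: "k > 0" using k by simp
  note carrier = carrier_lamplighter[OF k0]
  interpret group ?G by (rule group_lamplighter[OF k0])
  have sub: "{?a, ?t} \<subseteq> carrier ?G" using k by (auto simp: carrier)
  have inv_t: "inv\<^bsub>?G\<^esub> ?t = (\<lambda>i. 0, -1)"
    by (rule inv_equality) (use k in \<open>auto simp: mult_lamplighter one_lamplighter carrier\<close>)
  have "(f, m) \<in> generate ?G {?a, ?t}" if fm: "(f, m) \<in> carrier ?G" for f m
  proof -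
    obtain N where N: "\<forall>i. f i \<noteq> 0 \<longrightarrow> \<bar>i\<bar> \<le> int N" "\<bar>m\<bar> \<le> int N"
      using finite_support_bounded[of f m] fm by (auto simp: carrier)
    show ?thesis
    proof (rule lamplighter_sweep[where V = "\<lambda>g _. g \<in> generate ?G {?a, ?t}" and K = 0, OF k])
      show "(\<lambda>i. 0, -1) \<in> generate ?G {?a, ?t}"
        using generate.inv[of ?t "{?a, ?t}" ?G] by (simp only: inv_t) simp
    qed (use fm N in \<open>simp_all add: generate.one generate.incl generate.eng\<close>)
  qed
  then have "carrier ?G \<subseteq> generate ?G {?a, ?t}" by (intro subrelI)
  then have "generate ?G {?a, ?t} = carrier ?G" using generate_incl[OF sub] by (intro equalityI)
  then have "finite_generating_set ?G {?a, ?t}"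
    unfolding finite_generating_set_def by (intro conjI sub) simp_all
  then show ?thesis by (rule exI)
qed

lemma word_length_lamplighter_le:
  assumes k: "k \<ge> 2" and S: "finite_generating_set (lamplighter_group k) S"
  obtains C :: nat where "\<And>f m N. \<lbrakk>(f, m) \<in> carrier (lamplighter_group k);
      \<forall>i. f i \<noteq> 0 \<longrightarrow> \<bar>i\<bar> \<le> int N; \<bar>m\<bar> \<le> int N\<rbrakk>
      \<Longrightarrow> word_length (lamplighter_group k) S (f, m) \<le> C * (N + 1)"
proof -
  let ?G = "lamplighter_group k"
  let ?l = "word_length ?G S"
  interpret group ?G by (rule group_lamplighter) (use k in simp)
  define K where "K = ?l (\<lambda>i. if i = 0 then 1 else 0, 0) + ?l (\<lambda>i. 0, 1) + ?l (\<lambda>i. 0, -1)"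
  have "?l (f, m) \<le> (2 * (k + 2) + 3) * K * (N + 1)"
    if "(f, m) \<in> carrier ?G" "\<forall>i. f i \<noteq> 0 \<longrightarrow> \<bar>i\<bar> \<le> int N" "\<bar>m\<bar> \<le> int N" for f m N
  proof -
    have "?l (f, m) \<le> ((k + 2) * (2 * N + 1) + 3 * N) * K"
    proof (rule lamplighter_sweep[where V = "\<lambda>g n. ?l g \<le> n", OF k])
      show "?l (g \<otimes>\<^bsub>?G\<^esub> h) \<le> m + n"
        if "g \<in> carrier ?G" "h \<in> carrier ?G" "?l g \<le> m" "?l h \<le> n" for g h m n
        using word_length_mult_le[OF is_group S that(1,2)] that by simp
    qed (use that in \<open>auto simp: K_def word_length_one\<close>)
    also have "\<dots> \<le> (2 * (k + 2) + 3) * K * (N + 1)" by (simp add: algebra_simps)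
    finally show ?thesis .
  qed
  then show ?thesis by (rule that)
qed

section \<open>SOL\<close>

lemma GL2_int_simps:
  "carrier GL2_int = {A. invertible A}" "A \<otimes>\<^bsub>GL2_int\<^esub> B = A ** B" "\<one>\<^bsub>GL2_int\<^esub> = mat 1"
  by (simp_all add: GL2_int_def)

lemma group_GL2_int: "group GL2_int"
proof (rule groupI)
  fix A assume "A \<in> carrier GL2_int"
  then obtain B where "A ** B = mat 1" "B ** A = mat 1"
    by (auto simp: GL2_int_simps invertible_def)
  then show "\<exists>B\<in>carrier GL2_int. B \<otimes>\<^bsub>GL2_int\<^esub> A = \<one>\<^bsub>GL2_int\<^esub>"
    by (auto simp: GL2_int_simps invertible_def)
next
  fix A B assume "A \<in> carrier GL2_int" "B \<in> carrier GL2_int"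
  then obtain A' B' where *: "A ** A' = mat 1" "A' ** A = mat 1" "B ** B' = mat 1" "B' ** B = mat 1"
    by (auto simp: GL2_int_simps invertible_def)
  have "(A ** B) ** (B' ** A') = A ** (B ** B') ** A'" "(B' ** A') ** (A ** B) = B' ** (A' ** A) ** B"
    by (simp_all add: matrix_mul_assoc)
  then have "(A ** B) ** (B' ** A') = mat 1" "(B' ** A') ** (A ** B) = mat 1"
    using * by simp_all
  then show "A \<otimes>\<^bsub>GL2_int\<^esub> B \<in> carrier GL2_int"
    by (auto simp: GL2_int_simps invertible_def)
next
  show "\<one>\<^bsub>GL2_int\<^esub> \<in> carrier GL2_int"
    by (auto simp: GL2_int_simps invertible_def intro: exI[of _ "mat 1"])
qed (auto simp: GL2_int_simps matrix_mul_assoc)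

lemma carrier_SOL: "carrier (SOL_group A) = UNIV"
  by (simp add: SOL_group_def semidirect_product_simps int_square_group_def integer_group_def)

lemma mult_SOL:
  "(v, n) \<otimes>\<^bsub>SOL_group A\<^esub> (v', n') = (v + (A [^]\<^bsub>GL2_int\<^esub> n) *v v', n + n')"
  by (simp add: SOL_group_def semidirect_product_simps int_square_group_def integer_group_def)

lemma one_SOL: "\<one>\<^bsub>SOL_group A\<^esub> = (0, 0)"
  by (simp add: SOL_group_def semidirect_product_simps int_square_group_def integer_group_def)

lemma group_int_square: "group int_square_group"
proof (rule groupI)
  fix x assume "x \<in> carrier int_square_group"
  show "\<exists>y\<in>carrier int_square_group. y \<otimes>\<^bsub>int_square_group\<^esub> x = \<one>\<^bsub>int_square_group\<^esub>"
    by (intro bexI[of _ "- x"]) (auto simp: int_square_group_def)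
qed (auto simp: int_square_group_def)

lemma group_SOL:
  assumes A: "A \<in> carrier GL2_int"
  shows "group (SOL_group A)"
proof -
  interpret GL: group GL2_int by (rule group_GL2_int)
  show ?thesis unfolding SOL_group_def
  proof (rule group_semidirect_product[OF group_int_square])
    show "(A [^]\<^bsub>GL2_int\<^esub> (h \<otimes>\<^bsub>integer_group\<^esub> h')) *v n
        = (A [^]\<^bsub>GL2_int\<^esub> h) *v ((A [^]\<^bsub>GL2_int\<^esub> h') *v n)" for h h' :: int and n
      using GL.int_pow_mult[OF A, of h h']
      by (simp add: integer_group_def GL2_int_simps matrix_vector_mul_assoc)
  qed (auto simp: hom_def int_square_group_def matrix_vector_right_distrib GL2_int_simps)
qed

lemma ex_finite_generating_set_SOL:
  assumes A: "A \<in> carrier GL2_int"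
  shows "\<exists>T. finite_generating_set (SOL_group A) T"
proof -
  let ?H = "SOL_group A"
  interpret GL: group GL2_int by (rule group_GL2_int)
  interpret group ?H by (rule group_SOL[OF A])
  have A0: "A [^]\<^bsub>GL2_int\<^esub> (0::int) = mat 1" by (simp add: GL2_int_simps)
  define T where "T = {(axis 1 1, 0), (axis 2 1, 0), (0 :: int^2, 1 :: int)}"
  have line: "(i *s e, 0) \<in> generate ?H T" if e: "(e, 0) \<in> T" for e i
  proof (induction i rule: int_induct[of _ 0])
    case base
    show ?case using generate.one[of ?H T] by (simp add: one_SOL)
  next
    case (step1 i)
    have "((i + 1) *s e, 0) = (i *s e, 0) \<otimes>\<^bsub>?H\<^esub> (e, 0)"
      by (simp add: mult_SOL A0 vec_eq_iff distrib_right del: int_pow_0)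
    then show ?case using generate.eng[OF step1(2) generate.incl[OF e]] by simp
  next
    case (step2 i)
    have "inv\<^bsub>?H\<^esub> (e, 0) = (- e, 0)"
      by (rule inv_equality) (auto simp: mult_SOL A0 one_SOL carrier_SOL simp del: int_pow_0)
    then have "(- e, 0) \<in> generate ?H T" using generate.inv[OF e, of ?H] by simp
    moreover have "((i - 1) *s e, 0) = (i *s e, 0) \<otimes>\<^bsub>?H\<^esub> (- e, 0)"
      by (simp add: mult_SOL A0 vec_eq_iff left_diff_distrib del: int_pow_0)
    ultimately show ?case using generate.eng[OF step2(2)] by simp
  qed
  have height: "(0, i) \<in> generate ?H T" for i
  proof (induction i rule: int_induct[of _ 0])
    case base
    show ?case using generate.one[of ?H T] by (simp add: one_SOL)
  next
    case (step1 i)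
    have "(0, i + 1) = (0, i) \<otimes>\<^bsub>?H\<^esub> (0, 1)" by (simp add: mult_SOL)
    then show ?case using generate.eng[OF step1(2), of "(0, 1)"] by (simp add: generate.incl T_def)
  next
    case (step2 i)
    have "inv\<^bsub>?H\<^esub> (0, 1) = (0, - 1)"
      by (rule inv_equality) (auto simp: mult_SOL one_SOL carrier_SOL)
    then have "(0, - 1) \<in> generate ?H T" using generate.inv[of "(0, 1)" T ?H] by (simp add: T_def)
    moreover have "(0, i - 1) = (0, i) \<otimes>\<^bsub>?H\<^esub> (0, - 1)" by (simp add: mult_SOL)
    ultimately show ?case using generate.eng[OF step2(2)] by simp
  qed
  have "h \<in> generate ?H T" for h
  proof -
    obtain v n where h: "h = (v, n)" by force
    have "h = ((v $ 1 *s axis 1 1, 0) \<otimes>\<^bsub>?H\<^esub> (v $ 2 *s axis 2 1, 0)) \<otimes>\<^bsub>?H\<^esub> (0, n)"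
      by (simp add: h mult_SOL A0 vec_eq_iff forall_2 axis_def del: int_pow_0)
    also have "\<dots> \<in> generate ?H T"
      by (intro generate.eng line height) (simp_all add: T_def)
    finally show ?thesis .
  qed
  then have "generate ?H T = carrier ?H" by (auto simp: carrier_SOL)
  then have "finite_generating_set ?H T"
    unfolding finite_generating_set_def by (simp add: carrier_SOL) (simp add: T_def)
  then show ?thesis ..
qed

definition linear_form :: "real \<Rightarrow> real \<Rightarrow> int^2 \<Rightarrow> real" where
  "linear_form a b v = a * real_of_int (v $ 1) + b * real_of_int (v $ 2)"

lemma linear_form_add: "linear_form a b (v + w) = linear_form a b v + linear_form a b w"
  by (simp add: linear_form_def algebra_simps)

lemma linear_form_0 [simp]: "linear_form a b 0 = 0"
  by (simp add: linear_form_def)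

text \<open>Left eigenvectors of \<open>A\<close> give coordinates on the plane in which \<open>A\<close> is diagonal. The lower left entry
  of \<open>A\<close> does not vanish, since otherwise \<open>l\<close> would be one of the diagonal entries and these would be
  \<open>\<plusminus>1\<close>. So the pairs formed by that entry and by \<open>l - A $ 1 $ 1\<close>, respectively \<open>m - A $ 1 $ 1\<close>, are
  independent eigenvectors. The second eigenvalue \<open>m\<close> may be negative. As eigenvectors may be
  rescaled, the lattice can be made as fine as desired.\<close>

lemma SOL_eigenforms:
  fixes A :: "int^2^2" and l r :: real
  assumes A: "A \<in> carrier GL2_int" and l: "l > 1" and r: "r > 0"
    and "\<exists>v::real^2. v \<noteq> 0 \<and> map_matrix real_of_int A *v v = l *s v"
  obtains m a b c d where "\<bar>l * m\<bar> = 1"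
    "\<And>v. linear_form a b (A *v v) = l * linear_form a b v"
    "\<And>v. linear_form c d (A *v v) = m * linear_form c d v"
    "a * d - b * c \<noteq> 0" "\<bar>a\<bar> + \<bar>b\<bar> < r" "\<bar>c\<bar> + \<bar>d\<bar> < r"
proof -
  let ?a = "A $ 1 $ 1" and ?b = "A $ 1 $ 2" and ?c = "A $ 2 $ 1" and ?d = "A $ 2 $ 2"
  obtain B where "A ** B = mat 1" using A by (auto simp: GL2_int_simps invertible_def)
  then have "det A * det B = 1" by (metis det_mul det_I)
  then have "\<bar>det A\<bar> = 1" by (simp add: zmult_eq_1_iff) auto
  then have det: "\<bar>?a * ?d - ?b * ?c\<bar> = 1" by (simp add: det_2)
  obtain v :: "real^2" where v: "v \<noteq> 0" "map_matrix real_of_int A *v v = l *s v"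
    using assms(4) by blast
  have e1: "real_of_int ?a * v $ 1 + ?b * v $ 2 = l * v $ 1"
    and e2: "real_of_int ?c * v $ 1 + ?d * v $ 2 = l * v $ 2"
    using arg_cong[OF v(2), of "\<lambda>w. w $ 1"] arg_cong[OF v(2), of "\<lambda>w. w $ 2"]
    by (simp_all add: matrix_vector_mult_def sum_2 map_matrix_def)
  have v0: "v $ 1 \<noteq> 0 \<or> v $ 2 \<noteq> 0" using v(1) by (simp add: vec_eq_iff forall_2)
  have "((?a - l) * (?d - l) - real_of_int ?b * ?c) * v $ 1 = 0"
    "((?a - l) * (?d - l) - real_of_int ?b * ?c) * v $ 2 = 0"
    using e1 e2 by algebra+
  then have char: "(?a - l) * (?d - l) - real_of_int ?b * ?c = 0" using v0 by auto
  have c0: "?c \<noteq> 0"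
  proof
    assume c: "?c = 0"
    then have "\<bar>?a * ?d\<bar> = 1" "\<bar>?d * ?a\<bar> = 1" using det by (simp_all add: mult.commute)
    then have "\<bar>?a\<bar> = 1" "\<bar>?d\<bar> = 1" by (blast intro: abs_zmult_eq_1)+
    moreover have "l = ?a \<or> l = ?d" using char c by auto
    ultimately show False using l by auto
  qed
  define m where "m = ?a + ?d - l"
  have lm: "l * m = real_of_int (?a * ?d - ?b * ?c)"
    using char by (simp add: m_def algebra_simps)
  have lm1: "\<bar>l * m\<bar> = 1" unfolding lm of_int_abs[symmetric] det by simp
  have "m < l"
  proof -
    have "\<bar>l\<bar> * \<bar>m\<bar> = 1" using lm1 by (simp add: abs_mult)
    then have "\<bar>m\<bar> = 1 / l" using l by (simp add: eq_divide_eq mult.commute)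
    then have "\<bar>m\<bar> < 1" using l by simp
    then show ?thesis using l by linarith
  qed
  have charm: "(?a - m) * (?d - m) - real_of_int ?b * ?c = 0"
    using char by (simp add: m_def algebra_simps)
  define C where "C = \<bar>real_of_int ?c\<bar> + \<bar>l - ?a\<bar> + \<bar>m - ?a\<bar> + 1"
  define s where "s = r / C"
  have C: "C > 0" by (simp add: C_def)
  have s: "s > 0" using C r by (simp add: s_def)
  show ?thesis
  proof (rule that[OF lm1])
    show "linear_form (s * ?c) (s * (l - ?a)) (A *v v) = l * linear_form (s * ?c) (s * (l - ?a)) v" for v
    proof -
      have "linear_form (s * ?c) (s * (l - ?a)) (A *v v) - l * linear_form (s * ?c) (s * (l - ?a)) v
          = - s * v $ 2 * ((?a - l) * (?d - l) - real_of_int ?b * ?c)"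
        by (simp add: linear_form_def matrix_vector_mult_def sum_2 algebra_simps)
      then show ?thesis using char by simp
    qed
    show "linear_form (s * ?c) (s * (m - ?a)) (A *v v) = m * linear_form (s * ?c) (s * (m - ?a)) v" for v
    proof -
      have "linear_form (s * ?c) (s * (m - ?a)) (A *v v) - m * linear_form (s * ?c) (s * (m - ?a)) v
          = - s * v $ 2 * ((?a - m) * (?d - m) - real_of_int ?b * ?c)"
        by (simp add: linear_form_def matrix_vector_mult_def sum_2 algebra_simps)
      then show ?thesis using charm by simp
    qed
    have "(s * ?c) * (s * (m - ?a)) - (s * (l - ?a)) * (s * ?c) = s * s * ?c * (m - l)"
      by (simp add: algebra_simps)
    also have "\<dots> \<noteq> 0" using s c0 \<open>m < l\<close> by simp
    finally show "(s * ?c) * (s * (m - ?a)) - (s * (l - ?a)) * (s * ?c) \<noteq> 0" .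
    have "\<bar>real_of_int ?c\<bar> + \<bar>l - ?a\<bar> < C" "\<bar>real_of_int ?c\<bar> + \<bar>m - ?a\<bar> < C"
      by (simp_all add: C_def)
    then have "s * (\<bar>real_of_int ?c\<bar> + \<bar>l - ?a\<bar>) < s * C" "s * (\<bar>real_of_int ?c\<bar> + \<bar>m - ?a\<bar>) < s * C"
      using s by simp_all
    moreover have "s * C = r" using C by (simp add: s_def)
    ultimately show "\<bar>s * ?c\<bar> + \<bar>s * (l - ?a)\<bar> < r" "\<bar>s * ?c\<bar> + \<bar>s * (m - ?a)\<bar> < r"
      using s by (simp_all add: abs_mult distrib_left)
  qed
qed

locale SOL_eigenbasis =
  fixes A :: "int^2^2" and l m :: real and a b c d :: real
  assumes A: "A \<in> carrier GL2_int" and l: "l > 1" and lm: "\<bar>l * m\<bar> = 1"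
    and eigen_P: "linear_form a b (A *v v) = l * linear_form a b v"
    and eigen_Q: "linear_form c d (A *v v) = m * linear_form c d v"
    and indep: "a * d - b * c \<noteq> 0"
begin

abbreviation "P \<equiv> linear_form a b"
abbreviation "Q \<equiv> linear_form c d"

lemma m_neq_0: "m \<noteq> 0" using lm by auto

lemma abs_m: "\<bar>m\<bar> = inverse l"
proof -
  have "l * \<bar>m\<bar> = 1" using lm l by (simp add: abs_mult)
  then show ?thesis using l by (simp add: field_simps)
qed

lemma eigen_power:
  fixes n :: int
  assumes ev: "\<And>v. linear_form a' b' (A *v v) = r * linear_form a' b' v" and r: "r \<noteq> 0"
  shows "linear_form a' b' ((A [^]\<^bsub>GL2_int\<^esub> n) *v v) = r powi n * linear_form a' b' v"
proof (induction n arbitrary: v rule: int_induct[of _ 0])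
  interpret GL: group GL2_int by (rule group_GL2_int)
  {
    case base
    show ?case by (simp add: GL2_int_simps)
  next
    case (step1 i)
    have "(A [^]\<^bsub>GL2_int\<^esub> (i + 1)) = (A [^]\<^bsub>GL2_int\<^esub> i) ** A"
      using GL.int_pow_mult[OF A, of i 1] A by (simp add: GL2_int_simps)
    then show ?case using step1 r
      by (simp add: matrix_vector_mul_assoc[symmetric] ev power_int_add)
  next
    case (step2 i)
    have "(A [^]\<^bsub>GL2_int\<^esub> i) = A ** (A [^]\<^bsub>GL2_int\<^esub> (i - 1))"
      using GL.int_pow_mult[OF A, of 1 "i - 1"] A by (simp add: GL2_int_simps)
    then have "r powi i * linear_form a' b' v = r * linear_form a' b' ((A [^]\<^bsub>GL2_int\<^esub> (i - 1)) *v v)"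
      using step2(2)[of v] by (simp add: matrix_vector_mul_assoc[symmetric] ev)
    then show ?case using r by (simp add: power_int_diff field_simps)
  }
qed

lemmas P_power = eigen_power[OF eigen_P] and Q_power = eigen_power[OF eigen_Q m_neq_0]

text \<open>The integer vectors form a lattice in the plane with coordinates \<open>(P, Q)\<close>. Coordinates with respect
  to the standard basis of the lattice give its fundamental parallelogram.\<close>

definition coord1 :: "real \<times> real \<Rightarrow> real" where
  "coord1 z = (d * fst z - b * snd z) / (a * d - b * c)"

definition coord2 :: "real \<times> real \<Rightarrow> real" where
  "coord2 z = (a * snd z - c * fst z) / (a * d - b * c)"

lemma fst_eq_coords: "fst z = a * coord1 z + b * coord2 z"
proof -
  have "(a * d - b * c) * fst z = a * (d * fst z - b * snd z) + b * (a * snd z - c * fst z)"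
    by (simp add: algebra_simps)
  then have "fst z = (a * (d * fst z - b * snd z) + b * (a * snd z - c * fst z)) / (a * d - b * c)"
    using indep by (metis nonzero_mult_div_cancel_left)
  then show ?thesis by (simp add: coord1_def coord2_def add_divide_distrib)
qed

lemma snd_eq_coords: "snd z = c * coord1 z + d * coord2 z"
proof -
  have "(a * d - b * c) * snd z = c * (d * fst z - b * snd z) + d * (a * snd z - c * fst z)"
    by (simp add: algebra_simps)
  then have "snd z = (c * (d * fst z - b * snd z) + d * (a * snd z - c * fst z)) / (a * d - b * c)"
    using indep by (metis nonzero_mult_div_cancel_left)
  then show ?thesis by (simp add: coord1_def coord2_def add_divide_distrib)
qed

lemma coord_translate:
  "coord1 (fst z + P v, snd z + Q v) = coord1 z + real_of_int (v $ 1)"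
  "coord2 (fst z + P v, snd z + Q v) = coord2 z + real_of_int (v $ 2)"
proof -
  have "d * (fst z + P v) - b * (snd z + Q v)
      = d * fst z - b * snd z + (a * d - b * c) * real_of_int (v $ 1)"
    "a * (snd z + Q v) - c * (fst z + P v)
      = a * snd z - c * fst z + (a * d - b * c) * real_of_int (v $ 2)"
    by (simp_all add: linear_form_def algebra_simps)
  then show "coord1 (fst z + P v, snd z + Q v) = coord1 z + real_of_int (v $ 1)"
    "coord2 (fst z + P v, snd z + Q v) = coord2 z + real_of_int (v $ 2)"
    using indep by (simp_all add: coord1_def coord2_def add_divide_distrib)
qed

definition parallelogram :: "(real \<times> real) set" where
  "parallelogram = {z. 0 \<le> coord1 z \<and> coord1 z < 1 \<and> 0 \<le> coord2 z \<and> coord2 z < 1}"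

lemma parallelogram_bounds:
  assumes "z \<in> parallelogram"
  shows "\<bar>fst z\<bar> \<le> \<bar>a\<bar> + \<bar>b\<bar>" "\<bar>snd z\<bar> \<le> \<bar>c\<bar> + \<bar>d\<bar>"
proof -
  have s: "\<bar>coord1 z\<bar> \<le> 1" "\<bar>coord2 z\<bar> \<le> 1" using assms by (auto simp: parallelogram_def)
  have "\<bar>x * coord1 z + y * coord2 z\<bar> \<le> \<bar>x\<bar> + \<bar>y\<bar>" for x y
  proof -
    have "\<bar>x * coord1 z\<bar> \<le> \<bar>x\<bar> * 1" "\<bar>y * coord2 z\<bar> \<le> \<bar>y\<bar> * 1"
      unfolding abs_mult using s by (auto intro!: mult_left_le)
    then show ?thesis by linarith
  qed
  then show "\<bar>fst z\<bar> \<le> \<bar>a\<bar> + \<bar>b\<bar>" "\<bar>snd z\<bar> \<le> \<bar>c\<bar> + \<bar>d\<bar>"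
    using fst_eq_coords[of z] snd_eq_coords[of z] by presburger+
qed

lemma parallelogram_ex1: "\<exists>!v. (fst z + P v, snd z + Q v) \<in> parallelogram"
proof (rule ex1I)
  let ?v = "vector [- \<lfloor>coord1 z\<rfloor>, - \<lfloor>coord2 z\<rfloor>] :: int^2"
  show "(fst z + P ?v, snd z + Q ?v) \<in> parallelogram"
    unfolding parallelogram_def mem_Collect_eq coord_translate by (simp; linarith)
  fix v assume "(fst z + P v, snd z + Q v) \<in> parallelogram"
  then have "v $ 1 = - \<lfloor>coord1 z\<rfloor>" "v $ 2 = - \<lfloor>coord2 z\<rfloor>"
    unfolding parallelogram_def mem_Collect_eq coord_translate by linarith+
  then show "v = ?v" by (simp add: vec_eq_iff forall_2)
qed

lemma continuous_coord: "continuous_on UNIV coord1" "continuous_on UNIV coord2"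
  unfolding coord1_def coord2_def using indep by (auto intro!: continuous_intros)

lemma parallelogram_borel: "parallelogram \<in> sets borel"
proof -
  have "coord1 \<in> borel_measurable borel" "coord2 \<in> borel_measurable borel"
    by (simp_all add: borel_measurable_continuous_onI continuous_coord)
  then show ?thesis unfolding parallelogram_def by measurable
qed

lemma emeasure_parallelogram:
  "emeasure lborel parallelogram \<noteq> 0" "emeasure lborel parallelogram \<noteq> \<infinity>"
proof -
  let ?U = "{z. 0 < coord1 z \<and> coord1 z < 1 \<and> 0 < coord2 z \<and> coord2 z < 1}"
  have "open ?U"
    by (intro open_Collect_conj open_Collect_less continuous_coord continuous_on_const)
  moreover have "(a * (1/2) + b * (1/2), c * (1/2) + d * (1/2)) \<in> ?U"
  proof -
    have "d * (a * (1/2) + b * (1/2)) - b * (c * (1/2) + d * (1/2)) = (a * d - b * c) * (1/2)"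
      "a * (c * (1/2) + d * (1/2)) - c * (a * (1/2) + b * (1/2)) = (a * d - b * c) * (1/2)"
      by (simp_all add: algebra_simps)
    then have "coord1 (a * (1/2) + b * (1/2), c * (1/2) + d * (1/2)) = 1/2"
      "coord2 (a * (1/2) + b * (1/2), c * (1/2) + d * (1/2)) = 1/2"
      unfolding coord1_def coord2_def fst_conv snd_conv using indep by simp_all
    then show ?thesis by simp
  qed
  ultimately have "?U \<notin> null_sets lborel"
    using open_not_negligible[of ?U] null_sets_completionI[of ?U lborel] negligible_iff_null_sets[of ?U]
    by blast
  moreover have "?U \<in> sets lborel" using \<open>open ?U\<close> by simp
  ultimately have "emeasure lborel ?U \<noteq> 0" by auto
  moreover have "emeasure lborel ?U \<le> emeasure lborel parallelogram"
    using parallelogram_borel by (intro emeasure_mono) (auto simp: parallelogram_def)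
  ultimately show "emeasure lborel parallelogram \<noteq> 0" by (intro notI) simp
  have "bounded parallelogram"
  proof (rule boundedI)
    fix z assume z: "z \<in> parallelogram"
    have "norm z \<le> norm (fst z) + norm (snd z)"
      using norm_Pair_le[of "fst z" "snd z"] by simp
    then show "norm z \<le> \<bar>a\<bar> + \<bar>b\<bar> + (\<bar>c\<bar> + \<bar>d\<bar>)" using parallelogram_bounds[OF z] by simp
  qed
  then show "emeasure lborel parallelogram \<noteq> \<infinity>"
    using emeasure_bounded_finite[of parallelogram] by simp
qed


lemma finite_lattice_ball: "finite {v. \<bar>P v\<bar> \<le> R \<and> \<bar>Q v\<bar> \<le> R}"
proof -
  define N1 where "N1 = (\<bar>d\<bar> * R + \<bar>b\<bar> * R) / \<bar>a * d - b * c\<bar>"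
  define N2 where "N2 = (\<bar>a\<bar> * R + \<bar>c\<bar> * R) / \<bar>a * d - b * c\<bar>"
  have bound: "\<bar>real_of_int (v $ 1)\<bar> \<le> N1" "\<bar>real_of_int (v $ 2)\<bar> \<le> N2"
    if v: "\<bar>P v\<bar> \<le> R" "\<bar>Q v\<bar> \<le> R" for v
  proof -
    have *: "\<bar>x * P v\<bar> \<le> \<bar>x\<bar> * R" "\<bar>x * Q v\<bar> \<le> \<bar>x\<bar> * R" for x
      using v by (auto simp: abs_mult intro!: mult_left_mono)
    have "(a * d - b * c) * v $ 1 = d * P v - b * Q v" "(a * d - b * c) * v $ 2 = a * Q v - c * P v"
      by (simp_all add: linear_form_def algebra_simps)
    then have "\<bar>a * d - b * c\<bar> * \<bar>real_of_int (v $ 1)\<bar> = \<bar>d * P v - b * Q v\<bar>"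
      "\<bar>a * d - b * c\<bar> * \<bar>real_of_int (v $ 2)\<bar> = \<bar>a * Q v - c * P v\<bar>"
      by (simp_all only: abs_mult[symmetric])
    moreover have "\<bar>d * P v - b * Q v\<bar> \<le> \<bar>d\<bar> * R + \<bar>b\<bar> * R"
      by (rule order_trans[OF abs_triangle_ineq4 add_mono[OF *(1)[of d] *(2)[of b]]])
    moreover have "\<bar>a * Q v - c * P v\<bar> \<le> \<bar>a\<bar> * R + \<bar>c\<bar> * R"
      by (rule order_trans[OF abs_triangle_ineq4 add_mono[OF *(2)[of a] *(1)[of c]]])
    ultimately show "\<bar>real_of_int (v $ 1)\<bar> \<le> N1" "\<bar>real_of_int (v $ 2)\<bar> \<le> N2"
      using indep by (simp_all add: N1_def N2_def pos_le_divide_eq mult.commute)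
  qed
  have "{v. \<bar>P v\<bar> \<le> R \<and> \<bar>Q v\<bar> \<le> R} \<subseteq> (\<lambda>(x, y). vector [x, y]) ` ({-\<lceil>N1\<rceil>..\<lceil>N1\<rceil>} \<times> {-\<lceil>N2\<rceil>..\<lceil>N2\<rceil>})"
  proof
    fix v assume "v \<in> {v. \<bar>P v\<bar> \<le> R \<and> \<bar>Q v\<bar> \<le> R}"
    then have "\<bar>real_of_int (v $ 1)\<bar> \<le> N1" "\<bar>real_of_int (v $ 2)\<bar> \<le> N2" using bound by auto
    then have "v $ 1 \<in> {-\<lceil>N1\<rceil>..\<lceil>N1\<rceil>}" "v $ 2 \<in> {-\<lceil>N2\<rceil>..\<lceil>N2\<rceil>}"
      unfolding atLeastAtMost_iff by linarith+
    moreover have "v = (\<lambda>(x, y). vector [x, y]) (v $ 1, v $ 2)" by (simp add: vec_eq_iff forall_2)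
    ultimately show "v \<in> (\<lambda>(x, y). vector [x, y]) ` ({-\<lceil>N1\<rceil>..\<lceil>N1\<rceil>} \<times> {-\<lceil>N2\<rceil>..\<lceil>N2\<rceil>})" by blast
  qed
  then show ?thesis by (rule finite_subset) simp
qed

lemma lattice_injective: "P v = 0 \<Longrightarrow> Q v = 0 \<Longrightarrow> v = 0"
proof -
  assume "P v = 0" "Q v = 0"
  moreover have "(a * d - b * c) * v $ 1 = d * P v - b * Q v" "(a * d - b * c) * v $ 2 = a * Q v - c * P v"
    by (simp_all add: linear_form_def algebra_simps)
  ultimately show "v = 0" using indep by (simp add: vec_eq_iff forall_2)
qed

lemma abs_powi_le:
  fixes n :: int and K :: real
  assumes "\<bar>real_of_int n\<bar> \<le> K"
  shows "l powi n \<le> l powr K" "\<bar>m powi n\<bar> \<le> l powr K"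
proof -
  have l0: "l > 0" using l by simp
  have "l powi i \<le> l powr K" if "real_of_int i \<le> K" for i
    using powr_real_of_int'[of l i] l0 l that powr_mono[of "real_of_int i" K l] by simp
  moreover have "\<bar>m powi n\<bar> = l powi (- n)"
    by (simp add: power_int_abs abs_m power_int_inverse power_int_minus)
  ultimately show "l powi n \<le> l powr K" "\<bar>m powi n\<bar> \<le> l powr K" using assms by auto
qed

text \<open>A single letter adds a bounded amount to the height and to the displacement, but before it is added
  the displacement of the rest of the word is multiplied by at most a constant. So a word climbs at
  most linearly in its length, and moves horizontally at most exponentially far.\<close>

lemma word_length_SOL_ge:
  assumes T: "finite_generating_set (SOL_group A) T"
  obtains K :: real where "K > 0"
    "\<And>v n. \<bar>real_of_int n\<bar> \<le> K * word_length (SOL_group A) T (v, n)"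
    "\<And>v n. \<bar>P v\<bar> \<le> exp (K * word_length (SOL_group A) T (v, n))"
    "\<And>v n. \<bar>Q v\<bar> \<le> exp (K * word_length (SOL_group A) T (v, n))"
proof -
  let ?H = "SOL_group A"
  let ?L = "T \<union> m_inv ?H ` T"
  have "finite ?L" using T by (auto simp: finite_generating_set_def)
  then obtain K0 :: nat where K0: "\<forall>h\<in>?L. nat (\<bar>snd h\<bar> + \<lceil>\<bar>P (fst h)\<bar>\<rceil> + \<lceil>\<bar>Q (fst h)\<bar>\<rceil>) \<le> K0"
    using finite_nat_set_iff_bounded_le[of "(\<lambda>h. nat (\<bar>snd h\<bar> + \<lceil>\<bar>P (fst h)\<bar>\<rceil> + \<lceil>\<bar>Q (fst h)\<bar>\<rceil>)) ` ?L"]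
    by auto
  have letter: "\<bar>real_of_int n\<bar> \<le> K0" "\<bar>P v\<bar> \<le> K0" "\<bar>Q v\<bar> \<le> K0" if "(v, n) \<in> ?L" for v n
  proof -
    have "nat (\<bar>n\<bar> + \<lceil>\<bar>P v\<bar>\<rceil> + \<lceil>\<bar>Q v\<bar>\<rceil>) \<le> K0" using bspec[OF K0 that] by simp
    moreover have "0 \<le> \<lceil>\<bar>P v\<bar>\<rceil>" "0 \<le> \<lceil>\<bar>Q v\<bar>\<rceil>" by linarith+
    ultimately show "\<bar>real_of_int n\<bar> \<le> K0" "\<bar>P v\<bar> \<le> K0" "\<bar>Q v\<bar> \<le> K0" by linarith+
  qed
  define B where "B = K0 + l powr K0"
  \<comment> \<open>\<open>B\<close> bounds the growth of the displacement caused by one letter, whence \<open>B \<le> exp K\<close> below.\<close>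
  define K where "K = K0 + ln B + 1"
  have "l powr K0 \<ge> 1" using l by (simp add: ge_one_powr_ge_zero)
  then have B: "B \<ge> 1" by (simp add: B_def)
  have K: "K > 0" "K \<ge> K0" "exp K \<ge> B"
  proof -
    have "ln B \<ge> 0" using B by simp
    then show "K > 0" "K \<ge> K0" by (simp_all add: K_def)
    have "exp K \<ge> exp (ln B)" by (subst exp_le_cancel_iff) (simp add: K_def)
    then show "exp K \<ge> B" using B by simp
  qed
  have step: "\<bar>x + r * y\<bar> \<le> exp (K * Suc n)"
    if "\<bar>x\<bar> \<le> K0" "\<bar>r\<bar> \<le> l powr K0" "\<bar>y\<bar> \<le> exp (K * n)" for x r y :: real and n :: nat
  proof -
    have "\<bar>x + r * y\<bar> \<le> \<bar>x\<bar> + \<bar>r\<bar> * \<bar>y\<bar>"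
      using abs_triangle_ineq[of x "r * y"] by (simp only: abs_mult)
    also have "\<dots> \<le> K0 + l powr K0 * exp (K * n)"
      using that by (intro add_mono mult_mono) simp_all
    also have "\<dots> \<le> K0 * exp (K * n) + l powr K0 * exp (K * n)"
      using mult_left_mono[of 1 "exp (K * n)" "real K0"] K(1) by simp
    also have "\<dots> = B * exp (K * n)" by (simp add: B_def distrib_right)
    also have "\<dots> \<le> exp K * exp (K * n)" using K(3) by simp
    also have "\<dots> = exp (K * Suc n)" by (simp add: mult_exp_exp distrib_left)
    finally show ?thesis .
  qed
  have word: "\<bar>real_of_int (snd h)\<bar> \<le> K * length ws \<and> \<bar>P (fst h)\<bar> \<le> exp (K * length ws)
      \<and> \<bar>Q (fst h)\<bar> \<le> exp (K * length ws)"
    if "set ws \<subseteq> ?L" "foldr (\<otimes>\<^bsub>?H\<^esub>) ws \<one>\<^bsub>?H\<^esub> = h" for ws h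
    using that
  proof (induction ws arbitrary: h)
    case Nil
    then show ?case by (auto simp: one_SOL)
  next
    case (Cons g ws)
    obtain w j where g: "g = (w, j)" by (metis surj_pair)
    obtain v n where h': "foldr (\<otimes>\<^bsub>?H\<^esub>) ws \<one>\<^bsub>?H\<^esub> = (v, n)"
      by (metis surj_pair)
    have IH: "\<bar>real_of_int n\<bar> \<le> K * length ws" "\<bar>P v\<bar> \<le> exp (K * length ws)"
      "\<bar>Q v\<bar> \<le> exp (K * length ws)"
      using Cons.IH[OF _ h'] Cons.prems(1) by simp_all
    have h: "h = (w + (A [^]\<^bsub>GL2_int\<^esub> j) *v v, j + n)"
      using Cons.prems(2) by (simp add: g h' mult_SOL)
    have gL: "(w, j) \<in> ?L" using Cons.prems(1) g by simp
    note L = letter[OF gL] abs_powi_le[OF letter(1)[OF gL]]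
    have "l powi j > 0" using l by simp
    then have lj: "\<bar>l powi j\<bar> \<le> l powr K0" using L(4) by simp
    have "\<bar>real_of_int (j + n)\<bar> \<le> K * length (g # ws)"
      using IH(1) L(1) K(2) by (simp add: distrib_left)
    moreover have "\<bar>P w + l powi j * P v\<bar> \<le> exp (K * Suc (length ws))"
      by (rule step[OF L(2) lj IH(2)])
    moreover have "\<bar>Q w + m powi j * Q v\<bar> \<le> exp (K * Suc (length ws))"
      by (rule step[OF L(3) L(5) IH(3)])
    ultimately show ?case
      using l by (simp add: h linear_form_add P_power Q_power)
  qed
  show ?thesis
  proof (rule that[OF K(1)])
    fix v n
    obtain ws where "length ws = word_length ?H T (v, n)" "set ws \<subseteq> ?L"
      "foldr (\<otimes>\<^bsub>?H\<^esub>) ws \<one>\<^bsub>?H\<^esub> = (v, n)"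
      using word_length_attained[OF group_SOL[OF A] T, of "(v, n)"] by (auto simp: carrier_SOL)
    from word[OF this(2,3)] this(1)
    show "\<bar>real_of_int n\<bar> \<le> K * word_length ?H T (v, n)"
      "\<bar>P v\<bar> \<le> exp (K * word_length ?H T (v, n))"
      "\<bar>Q v\<bar> \<le> exp (K * word_length ?H T (v, n))" by simp_all
  qed
qed

end

section \<open>Measure preserving maps\<close>

text \<open>By Fubini, the measure of a preimage is the integral over the base of the measures of the preimages
  under the fibre maps.\<close>

lemma distr_skew_product:
  assumes M: "sigma_finite_measure M"
    and \<phi> [measurable]: "\<phi> \<in> N \<rightarrow>\<^sub>M N" and distr_\<phi>: "distr N N \<phi> = N"
    and \<psi> [measurable]: "(\<lambda>(x, y). \<psi> x y) \<in> N \<Otimes>\<^sub>M M \<rightarrow>\<^sub>M M"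
    and distr_\<psi>: "\<And>x. x \<in> space N \<Longrightarrow> distr M M (\<psi> x) = M"
  shows "distr (N \<Otimes>\<^sub>M M) (N \<Otimes>\<^sub>M M) (\<lambda>(x, y). (\<phi> x, \<psi> x y)) = N \<Otimes>\<^sub>M M"
proof (rule measure_eqI)
  interpret M: sigma_finite_measure M by fact
  let ?T = "\<lambda>(x, y). (\<phi> x, \<psi> x y)"
  have T [measurable]: "?T \<in> N \<Otimes>\<^sub>M M \<rightarrow>\<^sub>M N \<Otimes>\<^sub>M M"
  proof -
    have "(\<lambda>z. (\<phi> (fst z), (\<lambda>(x, y). \<psi> x y) z)) \<in> N \<Otimes>\<^sub>M M \<rightarrow>\<^sub>M N \<Otimes>\<^sub>M M"
      by measurable
    then show ?thesis by (simp add: case_prod_beta')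
  qed
  fix A assume "A \<in> sets (distr (N \<Otimes>\<^sub>M M) (N \<Otimes>\<^sub>M M) ?T)"
  then have A [measurable]: "A \<in> sets (N \<Otimes>\<^sub>M M)" by simp
  have fibre: "emeasure M (Pair x -` (?T -` A \<inter> space (N \<Otimes>\<^sub>M M))) = emeasure M (Pair (\<phi> x) -` A)"
    if x: "x \<in> space N" for x
  proof -
    have \<psi>x: "\<psi> x \<in> M \<rightarrow>\<^sub>M M" using measurable_compose[OF measurable_Pair1'[OF x] \<psi>] by simp
    have "Pair x -` (?T -` A \<inter> space (N \<Otimes>\<^sub>M M)) = \<psi> x -` (Pair (\<phi> x) -` A) \<inter> space M"
      using x by (auto simp: space_pair_measure)
    also have "emeasure M \<dots> = emeasure (distr M M (\<psi> x)) (Pair (\<phi> x) -` A)"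
      using \<psi>x sets_Pair1[OF A, of "\<phi> x"] by (simp add: emeasure_distr)
    finally show ?thesis using distr_\<psi>[OF x] by simp
  qed
  have "emeasure (distr (N \<Otimes>\<^sub>M M) (N \<Otimes>\<^sub>M M) ?T) A = emeasure (N \<Otimes>\<^sub>M M) (?T -` A \<inter> space (N \<Otimes>\<^sub>M M))"
    by (simp add: emeasure_distr)
  also have "\<dots> = (\<integral>\<^sup>+x. emeasure M (Pair (\<phi> x) -` A) \<partial>N)"
    using M.emeasure_pair_measure_alt[OF measurable_sets[OF T A]] fibre
    by (simp cong: nn_integral_cong del: vimage_Int)
  also have "\<dots> = (\<integral>\<^sup>+x. emeasure M (Pair x -` A) \<partial>distr N N \<phi>)"
    using M.measurable_emeasure_Pair[OF A] by (simp add: nn_integral_distr)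
  also have "\<dots> = emeasure (N \<Otimes>\<^sub>M M) A"
    by (simp add: distr_\<phi> M.emeasure_pair_measure_alt)
  finally show "emeasure (distr (N \<Otimes>\<^sub>M M) (N \<Otimes>\<^sub>M M) ?T) A = emeasure (N \<Otimes>\<^sub>M M) A" .
qed simp

lemma distr_PiM_permute:
  fixes M :: "'a measure" and \<tau> :: "'i \<Rightarrow> 'i"
  assumes M: "prob_space M" and \<tau>: "bij \<tau>"
    and F [measurable]: "\<And>j. F j \<in> M \<rightarrow>\<^sub>M M" and distr_F: "\<And>j. distr M M (F j) = M"
  shows "distr (PiM UNIV (\<lambda>_. M)) (PiM UNIV (\<lambda>_. M)) (\<lambda>b j. F j (b (\<tau> j))) = PiM UNIV (\<lambda>_. M)"
    (is "distr ?P ?P ?T = ?P")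
proof (rule measure_eqI_PiM_infinite[symmetric, OF refl])
  interpret prob_space ?P by (intro prob_space_PiM M)
  show "finite_measure ?P" by unfold_locales
  have inj: "inj \<tau>" using \<tau> by (rule bij_is_inj)
  have T: "?T \<in> ?P \<rightarrow>\<^sub>M ?P"
    by (rule measurable_PiM_single') (auto simp: space_PiM PiE_iff intro: measurable_space[OF F])
  fix J and A :: "'i \<Rightarrow> 'a set" assume J: "finite J" "J \<subseteq> UNIV" and A: "\<And>i. i \<in> J \<Longrightarrow> A i \<in> sets M"
  let ?A = "\<lambda>i. F (inv_into UNIV \<tau> i) -` A (inv_into UNIV \<tau> i) \<inter> space M"
  have pre: "?T -` prod_emb UNIV (\<lambda>_. M) J (Pi\<^sub>E J A) \<inter> space ?P
      = prod_emb UNIV (\<lambda>_. M) (\<tau> ` J) (Pi\<^sub>E (\<tau> ` J) ?A)"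
    using inj by (auto simp: prod_emb_def space_PiM PiE_iff measurable_space[OF F] Pi_iff)
  have "emeasure (distr ?P ?P ?T) (prod_emb UNIV (\<lambda>_. M) J (Pi\<^sub>E J A))
      = emeasure ?P (prod_emb UNIV (\<lambda>_. M) (\<tau> ` J) (Pi\<^sub>E (\<tau> ` J) ?A))"
    using T J A by (subst emeasure_distr) (auto simp: pre intro!: sets_PiM_I)
  also have "\<dots> = (\<Prod>i\<in>\<tau> ` J. emeasure M (?A i))"
    using J A inj by (intro emeasure_PiM_emb M) (auto intro!: measurable_sets[OF F])
  also have "\<dots> = (\<Prod>j\<in>J. emeasure M (F j -` A j \<inter> space M))"
    using inj by (simp add: prod.reindex inj_on_subset[OF inj])
  also have "\<dots> = (\<Prod>j\<in>J. emeasure M (A j))"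
  proof (rule prod.cong[OF refl])
    fix j assume "j \<in> J"
    then have "emeasure M (F j -` A j \<inter> space M) = emeasure (distr M M (F j)) (A j)"
      using A by (simp add: emeasure_distr)
    then show "emeasure M (F j -` A j \<inter> space M) = emeasure M (A j)" by (simp add: distr_F)
  qed
  also have "\<dots> = emeasure ?P (prod_emb UNIV (\<lambda>_. M) J (Pi\<^sub>E J A))"
    using J A by (intro emeasure_PiM_emb[symmetric] M) auto
  finally show "emeasure ?P (prod_emb UNIV (\<lambda>_. M) J (Pi\<^sub>E J A))
      = emeasure (distr ?P ?P ?T) (prod_emb UNIV (\<lambda>_. M) J (Pi\<^sub>E J A))" by simp
qed simp

lemma distr_point_measure_bij:
  fixes c :: ennreal
  assumes "finite S" and f: "bij_betw f S S"
  shows "distr (point_measure S (\<lambda>_. c)) (point_measure S (\<lambda>_. c)) f = point_measure S (\<lambda>_. c)"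
proof (rule measure_eqI)
  let ?M = "point_measure S (\<lambda>_. c)"
  have fm: "f \<in> ?M \<rightarrow>\<^sub>M ?M" using f \<open>finite S\<close> by (auto simp: bij_betw_def space_point_measure)
  fix B assume "B \<in> sets (distr ?M ?M f)"
  then have B: "B \<subseteq> S" by (simp add: sets_point_measure)
  have inj: "inj_on f (f -` B \<inter> S)" using f by (auto simp: bij_betw_def intro: inj_on_subset)
  have "B \<subseteq> f ` S" using B f by (simp add: bij_betw_def)
  have "f ` (f -` B \<inter> S) = B"
  proof (intro equalityI subsetI)
    fix y assume "y \<in> B"
    with \<open>B \<subseteq> f ` S\<close> obtain x where "x \<in> S" "y = f x" by auto
    with \<open>y \<in> B\<close> show "y \<in> f ` (f -` B \<inter> S)" by (intro image_eqI[of _ _ x]) simp_all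
  qed auto
  then have "card (f -` B \<inter> S) = card B" using card_image[OF inj] by simp
  then show "emeasure (distr ?M ?M f) B = emeasure ?M B"
    using B fm \<open>finite S\<close>
    by (subst emeasure_distr) (auto simp: space_point_measure sets_point_measure emeasure_point_measure_finite)
qed simp

lemma distr_lborel_diagonal:
  fixes r s x y :: real
  assumes "\<bar>r * s\<bar> = 1"
  shows "distr lborel lborel (\<lambda>z::real \<times> real. (r * fst z + x, s * snd z + y)) = lborel"
proof -
  let ?c = "\<lambda>j::real \<times> real. if j = (1, 0) then r else s"
  have nz: "r \<noteq> 0" "s \<noteq> 0" using assms by auto
  have B: "(Basis :: (real \<times> real) set) = {(1, 0), (0, 1)}" by (auto simp: Basis_prod_def)
  have "lborel = density (distr lborel borel
      (\<lambda>z::real \<times> real. (x, y) + (\<Sum>j\<in>Basis. (?c j * (z \<bullet> j)) *\<^sub>R j))) (\<lambda>_. \<Prod>j\<in>Basis. \<bar>?c j\<bar>)"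
    by (rule lborel_affine_euclidean) (use nz in auto)
  also have "(\<Prod>j\<in>Basis. \<bar>?c j\<bar>) = 1" using assms by (simp add: B abs_mult)
  also have "(\<lambda>z::real \<times> real. (x, y) + (\<Sum>j\<in>Basis. (?c j * (z \<bullet> j)) *\<^sub>R j))
      = (\<lambda>z. (r * fst z + x, s * snd z + y))"
    by (auto simp: B fun_eq_iff inner_prod_def)
  finally show ?thesis by (simp add: density_1 cong: distr_cong)
qed

section \<open>Transport of couplings along an isomorphism\<close>

text \<open>Explicit formulas for the actions do not yield extensional maps. Extensionality is restored when the
  coupling is transported to sequences of real numbers.\<close>

locale plain_action = group G for G :: "'g monoid" (structure) +
  fixes M :: "'w measure" and act :: "'g \<Rightarrow> 'w \<Rightarrow> 'w"
  assumes act_measurable: "g \<in> carrier G \<Longrightarrow> act g \<in> M \<rightarrow>\<^sub>M M"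
    and act_one: "x \<in> space M \<Longrightarrow> act \<one> x = x"
    and act_mult: "\<lbrakk>g \<in> carrier G; h \<in> carrier G; x \<in> space M\<rbrakk> \<Longrightarrow> act (g \<otimes> h) x = act g (act h x)"
    and act_distr: "g \<in> carrier G \<Longrightarrow> distr M M (act g) = M"
    and act_free: "\<lbrakk>g \<in> carrier G; x \<in> space M; act g x = x\<rbrakk> \<Longrightarrow> g = \<one>"
begin

lemma act_closed: "\<lbrakk>g \<in> carrier G; x \<in> space M\<rbrakk> \<Longrightarrow> act g x \<in> space M"
  using measurable_space[OF act_measurable] .

lemma act_inv: "\<lbrakk>g \<in> carrier G; x \<in> space M\<rbrakk> \<Longrightarrow> act (inv g) (act g x) = x"
  "\<lbrakk>g \<in> carrier G; x \<in> space M\<rbrakk> \<Longrightarrow> act g (act (inv g) x) = x"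
  using act_mult[of "inv g" g x] act_mult[of g "inv g" x] act_one by simp_all

end

locale measure_iso =
  fixes M :: "'w measure" and N :: "'v measure" and e :: "'w \<Rightarrow> 'v" and i :: "'v \<Rightarrow> 'w"
  assumes e: "e \<in> M \<rightarrow>\<^sub>M N" and i: "i \<in> N \<rightarrow>\<^sub>M M"
    and ie: "x \<in> space M \<Longrightarrow> i (e x) = x" and ei: "y \<in> space N \<Longrightarrow> e (i y) = y"
begin

abbreviation "M' \<equiv> distr M N e"

lemma e_space: "x \<in> space M \<Longrightarrow> e x \<in> space N" using measurable_space[OF e] .
lemma i_space: "y \<in> space N \<Longrightarrow> i y \<in> space M" using measurable_space[OF i] .

lemma image_sets:
  assumes "X \<in> sets M"
  shows "e ` X \<in> sets N" "emeasure M' (e ` X) = emeasure M X"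
proof -
  have X: "X \<subseteq> space M" using assms by (rule sets.sets_into_space)
  have "e ` X = i -` X \<inter> space N"
    using X by (auto simp: ie e_space) (metis ei image_eqI)
  then show eX: "e ` X \<in> sets N" using measurable_sets[OF i assms] by simp
  have "e -` (e ` X) \<inter> space M = X"
    using X by auto (metis ie subsetD)
  then show "emeasure M' (e ` X) = emeasure M X" using eX by (simp add: emeasure_distr e)
qed

lemma AE_transport:
  assumes "AE x in M. P (e x)"
  shows "AE y in M'. P y"
proof -
  obtain Z where Z: "{x \<in> space M. \<not> P (e x)} \<subseteq> Z" "emeasure M Z = 0" "Z \<in> sets M"
    using AE_E[OF assms] .
  show ?thesis
  proof (rule AE_I)
    show "{y \<in> space M'. \<not> P y} \<subseteq> e ` Z"
    proof
      fix y assume "y \<in> {y \<in> space M'. \<not> P y}"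
      then have "y \<in> space N" "\<not> P (e (i y))" by (auto simp: ei)
      then have "i y \<in> Z" using Z(1) i_space by auto
      then show "y \<in> e ` Z" using \<open>y \<in> space N\<close> ei by (metis imageI)
    qed
  qed (use Z image_sets[OF Z(3)] in simp_all)
qed

text \<open>The word length of a cocycle is not known to be measurable, so the change of variables formula does
  not apply to it. One inequality holds for all functions, because the integral is a supremum over
  simple functions below the integrand.\<close>

lemma nn_integral_transport_le: "(\<integral>\<^sup>+y. f y \<partial>M') \<le> (\<integral>\<^sup>+x. f (e x) \<partial>M)"
proof (subst (1) nn_integral_def, rule SUP_least)
  fix g assume g: "g \<in> {g. simple_function M' g \<and> g \<le> f}"
  then have gm: "g \<in> borel_measurable N"
    using borel_measurable_simple_function[of M' g] by simp
  have "integral\<^sup>S M' g = (\<integral>\<^sup>+y. g y \<partial>M')"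
    using g by (simp add: nn_integral_eq_simple_integral)
  also have "\<dots> = (\<integral>\<^sup>+x. g (e x) \<partial>M)" using gm by (simp add: nn_integral_distr e)
  also have "\<dots> \<le> (\<integral>\<^sup>+x. f (e x) \<partial>M)" using g by (intro nn_integral_mono) (auto simp: le_fun_def)
  finally show "integral\<^sup>S M' g \<le> (\<integral>\<^sup>+x. f (e x) \<partial>M)" .
qed

definition act' :: "('g \<Rightarrow> 'w \<Rightarrow> 'w) \<Rightarrow> 'g \<Rightarrow> 'v \<Rightarrow> 'v" where
  "act' act g = (\<lambda>y\<in>space N. e (act g (i y)))"

lemma act'_e: "x \<in> space M \<Longrightarrow> act' act g (e x) = e (act g x)"
  by (simp add: act'_def e_space ie)

lemma e_eq_iff: "x \<in> space M \<Longrightarrow> x' \<in> space M \<Longrightarrow> e x = e x' \<longleftrightarrow> x = x'"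
  using ie by metis

lemma e_mem_iff: "x \<in> space M \<Longrightarrow> X \<subseteq> space M \<Longrightarrow> e x \<in> e ` X \<longleftrightarrow> x \<in> X"
  using e_eq_iff by auto

lemma free_mp_action_transport:
  assumes "plain_action G M act"
  shows "free_mp_action G M' (act' act)"
proof -
  interpret plain_action G M act by fact
  have extens: "act' act g \<in> extensional (space N)" for g by (simp add: act'_def)
  have closed: "act' act g y \<in> space N" if "g \<in> carrier G" "y \<in> space N" for g y
    using that by (simp add: act'_def e_space act_closed i_space)
  have comp: "act' act g (act' act h y) = act' act (g \<otimes>\<^bsub>G\<^esub> h) y"
    if "g \<in> carrier G" "h \<in> carrier G" "y \<in> space N" for g h y
    using that by (simp add: act'_def e_space act_closed i_space ie act_mult)
  have one: "act' act \<one>\<^bsub>G\<^esub> y = y" if "y \<in> space N" for y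
    using that by (simp add: act'_def act_one i_space ei)
  have bij: "act' act g \<in> Bij (space N)" if g: "g \<in> carrier G" for g
  proof -
    have "bij_betw (act' act g) (space N) (space N)"
      by (rule bij_betw_byWitness[of _ "act' act (inv\<^bsub>G\<^esub> g)"])
        (use g in \<open>auto simp: comp one closed\<close>)
    then show ?thesis by (simp add: Bij_def extens)
  qed
  have meas: "act' act g \<in> N \<rightarrow>\<^sub>M N" if "g \<in> carrier G" for g
  proof -
    have "(\<lambda>y. e (act g (i y))) \<in> N \<rightarrow>\<^sub>M N"
      using measurable_comp[OF measurable_comp[OF i act_measurable[OF that]] e] by (simp add: comp_def)
    then show ?thesis by (subst measurable_cong) (auto simp: act'_def)
  qed
  have hom: "act' act \<in> hom G (BijGroup (space N))"
  proof (rule homI)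
    fix g h assume gh: "g \<in> carrier G" "h \<in> carrier G"
    show "act' act (g \<otimes>\<^bsub>G\<^esub> h) = act' act g \<otimes>\<^bsub>BijGroup (space N)\<^esub> act' act h"
    proof (rule ext)
      fix y
      show "act' act (g \<otimes>\<^bsub>G\<^esub> h) y = (act' act g \<otimes>\<^bsub>BijGroup (space N)\<^esub> act' act h) y"
        using comp[OF gh, of y] bij[OF gh(1)] bij[OF gh(2)]
        by (cases "y \<in> space N") (simp_all add: BijGroup_def compose_def act'_def[of act "g \<otimes>\<^bsub>G\<^esub> h"])
    qed
  qed (use bij in \<open>simp add: BijGroup_def\<close>)
  show ?thesis
  proof (intro free_mp_action.intro free_mp_action_axioms.intro group_action.intro)
    show "group_hom G (BijGroup (space M')) (act' act)"
      using hom group_BijGroup[of "space N"]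
      by (simp add: group_hom_def group_hom_axioms_def is_group)
  next
    fix g assume g: "g \<in> carrier G"
    show "act' act g \<in> M' \<rightarrow>\<^sub>M M'" using meas[OF g] by simp
    have "distr M' M' (act' act g) = distr M' N (act' act g)" by (simp cong: distr_cong)
    also have "\<dots> = distr M N (\<lambda>x. act' act g (e x))"
      using meas[OF g] e by (subst distr_distr) (auto simp: comp_def)
    also have "\<dots> = distr M N (\<lambda>x. e (act g x))" by (intro distr_cong) (auto simp: act'_e)
    also have "\<dots> = distr (distr M M (act g)) N e"
      using act_measurable[OF g] e by (subst distr_distr) (auto simp: comp_def)
    finally show "distr M' M' (act' act g) = M'" by (simp add: act_distr[OF g])
    show "g = \<one>\<^bsub>G\<^esub>" if "y \<in> space M'" "act' act g y = y" for y
    proof -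
      have "e (act g (i y)) = e (i y)" using that by (simp add: act'_def ei)
      then have "act g (i y) = i y" using that g by (simp add: e_eq_iff act_closed i_space)
      with act_free[OF g, of "i y"] i_space[of y] that show ?thesis by simp
    qed
  qed
qed

lemma fundamental_domain_transport:
  assumes "plain_action G M act" and X: "fundamental_domain G M act X"
  shows "fundamental_domain G M' (act' act) (e ` X)"
proof -
  interpret plain_action G M act by fact
  have XM: "X \<in> sets M" and ae: "AE x in M. \<exists>!g. g \<in> carrier G \<and> act g x \<in> X"
    using X by (auto simp: fundamental_domain_def)
  have "act' act g (e x) \<in> e ` X \<longleftrightarrow> act g x \<in> X" if "g \<in> carrier G" "x \<in> space M" for g x
    using that sets.sets_into_space[OF XM] by (simp add: act'_e e_mem_iff act_closed)
  then have iff: "(g \<in> carrier G \<and> act' act g (e x) \<in> e ` X) \<longleftrightarrow> (g \<in> carrier G \<and> act g x \<in> X)"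
    if "x \<in> space M" for g x
    using that by blast
  have "AE x in M. \<exists>!g. g \<in> carrier G \<and> act' act g (e x) \<in> e ` X"
    using ae AE_space by eventually_elim (simp add: iff)
  from AE_transport[OF this] show ?thesis
    unfolding fundamental_domain_def using image_sets(1)[OF XM] by simp
qed

lemma covered_transport:
  assumes "plain_action G M act" and X: "X \<subseteq> space M" and Y: "Y \<subseteq> space M"
    and cov: "covered_by_finitely_many_translates G M act X Y"
  shows "covered_by_finitely_many_translates G M' (act' act) (e ` X) (e ` Y)"
proof -
  obtain F where F: "finite F" "F \<subseteq> carrier G" "AE x in M. x \<in> Y \<longrightarrow> x \<in> (\<Union>g\<in>F. act g ` X)"
    using cov by (auto simp: covered_by_finitely_many_translates_def)
  have "AE x in M. e x \<in> e ` Y \<longrightarrow> e x \<in> (\<Union>g\<in>F. act' act g ` (e ` X))"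
    using F(3) AE_space
  proof eventually_elim
    case (elim x)
    show ?case
    proof
      assume "e x \<in> e ` Y"
      then have "x \<in> Y" using elim(2) Y by (simp add: e_mem_iff)
      then obtain g z where "g \<in> F" "z \<in> X" "x = act g z" using elim(1) by auto
      then show "e x \<in> (\<Union>g\<in>F. act' act g ` (e ` X))"
        using X act'_e[of z act g] by (intro UN_I[of g]) (auto intro!: image_eqI[of _ _ "e z"])
    qed
  qed
  from AE_transport[OF this] F(1,2) show ?thesis
    unfolding covered_by_finitely_many_translates_def by blast
qed

lemma coupling_cocycle_transport:
  assumes "plain_action G M act" "plain_action H M act2" and X: "X \<subseteq> space M"
    and x: "x \<in> space M" and g: "g \<in> carrier G"
  shows "coupling_cocycle H (act' act2) (e ` X) (act' act) g (e x) = coupling_cocycle H act2 X act g x"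
proof -
  interpret G: plain_action G M act by fact
  interpret H: plain_action H M act2 by fact
  have "act' act2 h (act' act g (e x)) \<in> e ` X \<longleftrightarrow> act2 h (act g x) \<in> X" if "h \<in> carrier H" for h
    using that x g X by (simp add: act'_e e_mem_iff G.act_closed H.act_closed)
  then show ?thesis
    unfolding coupling_cocycle_def by (simp cong: conj_cong)
qed

lemma Linf_exp_diamond_transport:
  assumes G: "plain_action G M actG" and H: "plain_action H M actH"
    and XG: "XG \<subseteq> space M" and XH: "XH \<subseteq> space M"
    and int: "Linf_exp_diamond_integrable G H M actG actH XG XH"
  shows "Linf_exp_diamond_integrable G H M' (act' actG) (act' actH) (e ` XG) (e ` XH)"
  unfolding Linf_exp_diamond_integrable_def
proof (intro conjI allI impI ballI)
  show "\<exists>S. finite_generating_set G S" "\<exists>T. finite_generating_set H T"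
    using int by (auto simp: Linf_exp_diamond_integrable_def)
next
  fix S T g assume S: "finite_generating_set G S" and T: "finite_generating_set H T" and g: "g \<in> carrier G"
  have "\<exists>C::nat. AE x in M. x \<in> XH \<longrightarrow> word_length H T (coupling_cocycle H actH XH actG g x) \<le> C"
    using int S T g unfolding Linf_exp_diamond_integrable_def by blast
  then obtain C :: nat where C: "AE x in M. x \<in> XH \<longrightarrow> word_length H T (coupling_cocycle H actH XH actG g x) \<le> C"
    by blast
  have "AE x in M. e x \<in> e ` XH \<longrightarrow>
      word_length H T (coupling_cocycle H (act' actH) (e ` XH) (act' actG) g (e x)) \<le> C"
    using C AE_space
    by eventually_elim (simp add: e_mem_iff XH coupling_cocycle_transport[OF G H XH _ g])
  from AE_transport[OF this]
  show "\<exists>C. AE x in M'. x \<in> e ` XH \<longrightarrow>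
      word_length H T (coupling_cocycle H (act' actH) (e ` XH) (act' actG) g x) \<le> C"
    by blast
next
  fix S T and \<epsilon> :: real
  assume S: "finite_generating_set G S" and T: "finite_generating_set H T" and "\<epsilon> > 0"
  then obtain \<delta> C where \<delta>C: "\<delta> > 0" "C > 0" and bound: "\<And>h. h \<in> carrier H \<Longrightarrow>
      (\<integral>\<^sup>+x\<in>XG. ennreal (exp (\<delta> * real (word_length G S (coupling_cocycle G actG XG actH h x)))) \<partial>M)
        \<le> ennreal (C * exp (\<epsilon> * real (word_length H T h)))"
    using int unfolding Linf_exp_diamond_integrable_def by meson
  have "(\<integral>\<^sup>+y\<in>e ` XG. ennreal (exp (\<delta> * real (word_length G S
        (coupling_cocycle G (act' actG) (e ` XG) (act' actH) h y)))) \<partial>M')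
      \<le> ennreal (C * exp (\<epsilon> * real (word_length H T h)))" if h: "h \<in> carrier H" for h
  proof -
    have "(\<integral>\<^sup>+y\<in>e ` XG. ennreal (exp (\<delta> * real (word_length G S
        (coupling_cocycle G (act' actG) (e ` XG) (act' actH) h y)))) \<partial>M')
      \<le> (\<integral>\<^sup>+x. ennreal (exp (\<delta> * real (word_length G S
        (coupling_cocycle G (act' actG) (e ` XG) (act' actH) h (e x))))) * indicator (e ` XG) (e x) \<partial>M)"
      by (rule nn_integral_transport_le)
    also have "\<dots> = (\<integral>\<^sup>+x\<in>XG. ennreal (exp (\<delta> * real (word_length G S
        (coupling_cocycle G actG XG actH h x)))) \<partial>M)"
      by (intro nn_integral_cong)
        (simp add: coupling_cocycle_transport[OF H G XG _ h] indicator_def e_mem_iff XG)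
    also note bound[OF h]
    finally show ?thesis .
  qed
  with \<delta>C show "\<exists>\<delta>>0. \<exists>C>0. \<forall>h\<in>carrier H.
      (\<integral>\<^sup>+y\<in>e ` XG. ennreal (exp (\<delta> * real (word_length G S
        (coupling_cocycle G (act' actG) (e ` XG) (act' actH) h y)))) \<partial>M')
      \<le> ennreal (C * exp (\<epsilon> * real (word_length H T h)))"
    by blast
qed

lemma sigma_finite_transport:
  assumes "sigma_finite_measure M"
  shows "sigma_finite_measure M'"
proof -
  interpret sigma_finite_measure M by fact
  obtain F where F: "countable F" "F \<subseteq> sets M" "\<Union>F = space M" "\<forall>a\<in>F. emeasure M a \<noteq> \<infinity>"
    using sigma_finite_countable by auto
  show ?thesis
  proof
    have "e ` space M = space N"
      using e_space ei i_space by (auto simp: image_iff) metis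
    then have "\<Union>((`) e ` F) = space M'" using F(3) by (simp add: image_Union[symmetric])
    then show "\<exists>F. countable F \<and> F \<subseteq> sets M' \<and> \<Union>F = space M' \<and> (\<forall>a\<in>F. emeasure M' a \<noteq> \<infinity>)"
      using F image_sets by (intro exI[of _ "(`) e ` F"]) auto
  qed
qed

lemma me_coupling_transport:
  assumes G: "plain_action G M actG" and H: "plain_action H M actH"
    and "sigma_finite_measure M" and N: "standard_borel M'"
    and commute: "\<And>g h x. \<lbrakk>g \<in> carrier G; h \<in> carrier H; x \<in> space M\<rbrakk>
      \<Longrightarrow> actG g (actH h x) = actH h (actG g x)"
    and XG: "fundamental_domain G M actG XG" and XH: "fundamental_domain H M actH XH"
    and "emeasure M XH = 1" "emeasure M XG < \<infinity>"
  shows "me_coupling G H M' (act' actG) (act' actH) (e ` XG) (e ` XH)"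
proof -
  interpret G: plain_action G M actG by fact
  interpret H: plain_action H M actH by fact
  have sets: "XG \<in> sets M" "XH \<in> sets M" using XG XH by (auto simp: fundamental_domain_def)
  show ?thesis
  proof (intro me_coupling.intro me_coupling_axioms.intro free_mp_action_transport
      sigma_finite_transport fundamental_domain_transport assms)
    show "act' actG g (act' actH h y) = act' actH h (act' actG g y)"
      if "g \<in> carrier G" "h \<in> carrier H" "y \<in> space M'" for g h y
      using that by (simp add: act'_def i_space ie e_space G.act_closed H.act_closed commute)
  qed (use assms image_sets(2)[OF sets(1)] image_sets(2)[OF sets(2)] in simp_all)
qed

end

lemma second_countable_euclidean:
  "second_countable (euclidean :: 'a::second_countable_topology topology)"
proof -
  obtain B :: "'a set set" where B: "countable B" "topological_basis B"
    using ex_countable_basis by blast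
  show ?thesis unfolding second_countable_def
    using B topological_basis_open[OF B(2)] topological_basisE[OF B(2)]
    by (intro exI[of _ B]) (metis open_openin)
qed

lemma standard_borel_closed_subset:
  fixes R :: "'a::polish_space set"
  assumes R: "closed R" and M: "space M = R" "sets M = sets (restrict_space borel R)"
  shows "standard_borel M"
  unfolding standard_borel_def
proof (intro exI[of _ "subtopology euclidean R"] conjI)
  show "topspace (subtopology euclidean R) = space M" by (simp add: M)
  show "completely_metrizable_space (subtopology euclidean R)"
    using R by (intro completely_metrizable_space_closedin completely_metrizable_space_euclidean)
      simp
  show "separable_space (subtopology euclidean R)"
    by (intro second_countable_imp_separable_space second_countable_subtopology
        second_countable_euclidean)
  have "sets M = (\<inter>) R ` sets borel" by (simp only: M sets_restrict_space)
  also have "\<dots> = (\<inter>) R ` sigma_sets UNIV {S. open S}" by (simp only: sets_borel)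
  also have "\<dots> = sigma_sets R ((\<inter>) R ` {S. open S})"
  proof (rule sigma_sets_Int)
    show "R \<in> sigma_sets UNIV {S. open S}" using borel_closed[OF R] by (simp only: sets_borel)
  qed simp
  also have "(\<inter>) R ` {S. open S} = {U. openin (subtopology euclidean R) U}"
    unfolding openin_open by blast
  finally show "sets M = sigma_sets (space M) {U. openin (subtopology euclidean R) U}"
    by (simp only: M(1))
qed

section \<open>The coupling space and the action of the lamplighter group\<close>

text \<open>The two digit sequences are both indexed by \<open>\<int>\<close>, but their places run in opposite directions: in
  the first (\<open>s = True\<close>) place \<open>i\<close> has weight \<open>k\<^sup>i\<close>, and in the second it has weight \<open>k\<close> to the power
  \<open>- 1 - i\<close>. Hence exactly one of the two reads a lamp as an integral place; \<open>place s j\<close> is the lamp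
  of weight \<open>k\<^sup>j\<close> in sequence \<open>s\<close>, and \<open>place (\<not> s) j\<close> is the lamp of weight \<open>1 / k\<^sup>j\<^sup>+\<^sup>1\<close>.\<close>

definition place :: "bool \<Rightarrow> nat \<Rightarrow> int" where
  "place s j = (if s then int j else - 1 - int j)"

definition weight :: "nat \<Rightarrow> bool \<Rightarrow> int \<Rightarrow> real" where
  "weight k s i = real k powi (if s then i else - 1 - i)"

text \<open>The sides of a cell of level \<open>0\<close> at height \<open>u\<close>; the second side is oriented by the sign \<open>\<sigma>\<close>.\<close>

definition scale :: "nat \<Rightarrow> bool \<Rightarrow> real \<Rightarrow> bool \<Rightarrow> real" where
  "scale k s u \<sigma> = (if s then real k powr (- u) else (if \<sigma> then 1 else - 1) * real k powr u)"

text \<open>A point of the coupling is a point \<open>(p, q)\<close> of the plane at height \<open>u\<close>, with a sign \<open>\<sigma>\<close> and a pair of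
  nested grids with base \<open>k\<close>, one for each coordinate axis. The grids are recorded by the digits that
  \<open>p\<close> and \<open>q\<close> have relative to them.\<close>

type_synonym digits = "bool \<times> int \<Rightarrow> int"
type_synonym coupling_point = "(digits \<times> real \<times> bool) \<times> real \<times> real"

definition digit_measure :: "nat \<Rightarrow> digits measure" where
  "digit_measure k = PiM UNIV (\<lambda>_. uniform_count_measure {0..<int k})"

definition sign_measure :: "real \<Rightarrow> bool measure" where
  "sign_measure \<kappa> = point_measure UNIV (\<lambda>_. ennreal \<kappa>)"

abbreviation height_measure :: "real \<Rightarrow> (real \<times> bool) measure" where
  "height_measure \<kappa> \<equiv> lborel \<Otimes>\<^sub>M sign_measure \<kappa>"

abbreviation base_measure :: "nat \<Rightarrow> real \<Rightarrow> (digits \<times> real \<times> bool) measure" where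
  "base_measure k \<kappa> \<equiv> digit_measure k \<Otimes>\<^sub>M (lborel \<Otimes>\<^sub>M sign_measure \<kappa>)"

definition coupling_measure :: "nat \<Rightarrow> real \<Rightarrow> coupling_point measure" where
  "coupling_measure k \<kappa> =
     base_measure k \<kappa> \<Otimes>\<^sub>M lborel"

definition shift :: "int \<Rightarrow> digits \<Rightarrow> digits" where
  "shift m x = (\<lambda>(s, i). x (s, i - m))"

text \<open>Lamps act on the digits without carry, and the point moves within the fixed grids: its displacement
  is the change of the number that the digits represent, in units of the current cell.\<close>

definition toggle :: "nat \<Rightarrow> (int \<Rightarrow> int) \<Rightarrow> digits \<Rightarrow> digits" where
  "toggle k f x = (\<lambda>(s, i). (x (s, i) + f i) mod int k)"

definition displacement :: "nat \<Rightarrow> bool \<Rightarrow> (int \<Rightarrow> int) \<Rightarrow> digits \<Rightarrow> real" where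
  "displacement k s f x =
     (\<Sum>i | f i \<noteq> 0. real_of_int (toggle k f x (s, i) - x (s, i)) * weight k s i)"

definition lamp_act :: "nat \<Rightarrow> (int \<Rightarrow> int) \<times> int \<Rightarrow> coupling_point \<Rightarrow> coupling_point" where
  "lamp_act k = (\<lambda>(f, m) ((x, (u, \<sigma>)), (p, q)).
     ((toggle k f (shift m x), (u + real_of_int m, \<sigma>)),
      (p + scale k True (u + real_of_int m) \<sigma> * displacement k True f (shift m x),
       q + scale k False (u + real_of_int m) \<sigma> * displacement k False f (shift m x))))"

lemma shift_shift: "shift m (shift n x) = shift (m + n) x"
  by (simp add: shift_def fun_eq_iff algebra_simps)

lemma shift_0 [simp]: "shift 0 x = x"
  by (simp add: shift_def fun_eq_iff)

lemma shift_toggle: "shift m (toggle k f x) = toggle k (\<lambda>i. f (i - m)) (shift m x)"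
  by (simp add: shift_def toggle_def fun_eq_iff)

lemma toggle_toggle:
  "toggle k f (toggle k f' x) = toggle k (\<lambda>i. (f i + f' i) mod int k) x"
  by (simp add: toggle_def fun_eq_iff mod_add_left_eq mod_add_right_eq algebra_simps)

lemma scale_add:
  "k > 0 \<Longrightarrow> scale k s (u + real_of_int m) \<sigma> * real k powi (if s then m else - m) = scale k s u \<sigma>"
proof -
  assume k: "k > 0"
  then have *: "real k powi j = real k powr real_of_int j" for j
    by (simp add: powr_real_of_int')
  show ?thesis unfolding * using k by (simp add: scale_def powr_add[symmetric])
qed

lemma weight_place: "weight k s (place s j) = real k ^ j"
  by (simp add: weight_def place_def power_int_of_nat)

lemma weight_place_other: "k > 0 \<Longrightarrow> weight k s (place (\<not> s) j) = 1 / real k ^ Suc j"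
  by (simp add: weight_def place_def power_int_minus_divide[symmetric] power_int_of_nat[symmetric]
      del: of_nat_power power_Suc power_int_of_nat)

locale digit_base = fixes k :: nat assumes k: "k \<ge> 2"
begin

lemma k_pos: "k > 0" "real k > 0" "real k \<ge> 2" "int k > 0" using k by auto

definition "digit_seqs = {x :: digits. \<forall>i. 0 \<le> x i \<and> x i < int k}"

lemma space_digit_measure: "space (digit_measure k) = digit_seqs"
  by (auto simp: digit_measure_def space_PiM PiE_iff space_uniform_count_measure digit_seqs_def)

lemma digit_seqsD: "x \<in> digit_seqs \<Longrightarrow> 0 \<le> x i" "x \<in> digit_seqs \<Longrightarrow> x i < int k"
  unfolding digit_seqs_def by blast+

lemma shift_digit_seqs: "x \<in> digit_seqs \<Longrightarrow> shift m x \<in> digit_seqs"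
  by (auto simp: digit_seqs_def shift_def)

lemma toggle_digit_seqs: "toggle k f x \<in> digit_seqs"
  using k_pos by (auto simp: digit_seqs_def toggle_def)

lemma toggle_unchanged: "x \<in> digit_seqs \<Longrightarrow> f i = 0 \<Longrightarrow> toggle k f x (s, i) = x (s, i)"
  by (simp add: digit_seqs_def toggle_def)

lemma displacement_eq_sum:
  assumes x: "x \<in> digit_seqs" and F: "finite F" "{i. f i \<noteq> 0} \<subseteq> F"
  shows "displacement k s f x = (\<Sum>i\<in>F. real_of_int (toggle k f x (s, i) - x (s, i)) * weight k s i)"
  unfolding displacement_def using F x
  by (intro sum.mono_neutral_left) (auto simp: toggle_unchanged)

text \<open>Displacements add up because the grids stay fixed while the point moves; this is the cocycle identity
  behind \<open>lamp_act_mult\<close>.\<close>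

lemma displacement_compose:
  assumes x: "x \<in> digit_seqs" and f: "finite {i. f i \<noteq> 0}" "finite {i. f' i \<noteq> 0}"
  shows "displacement k s (\<lambda>i. (f i + f' i) mod int k) x
      = displacement k s f' x + displacement k s f (toggle k f' x)"
proof -
  let ?F = "{i. f i \<noteq> 0} \<union> {i. f' i \<noteq> 0}"
  have F: "finite ?F" using f by simp
  have sub: "{i. (f i + f' i) mod int k \<noteq> 0} \<subseteq> ?F" "{i. f i \<noteq> 0} \<subseteq> ?F" "{i. f' i \<noteq> 0} \<subseteq> ?F"
    by auto
  show ?thesis
    unfolding displacement_eq_sum[OF x F sub(1)] displacement_eq_sum[OF x F sub(3)]
      displacement_eq_sum[OF toggle_digit_seqs F sub(2)] toggle_toggle sum.distrib[symmetric]
    by (intro sum.cong) (simp_all add: algebra_simps)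
qed

lemma displacement_shift:
  "displacement k s (\<lambda>i. f (i - m)) (shift m x)
     = real k powi (if s then m else - m) * displacement k s f x"
proof -
  have "displacement k s (\<lambda>i. f (i - m)) (shift m x)
      = (\<Sum>i | f i \<noteq> 0. real_of_int (toggle k f x (s, i) - x (s, i)) * weight k s (i + m))"
    unfolding displacement_def
    by (rule sum.reindex_bij_witness[of _ "\<lambda>i. i + m" "\<lambda>i. i - m"])
      (auto simp: shift_def toggle_def)
  also have "\<dots> = (\<Sum>i | f i \<noteq> 0. real k powi (if s then m else - m)
      * (real_of_int (toggle k f x (s, i) - x (s, i)) * weight k s i))"
  proof (rule sum.cong[OF refl])
    fix i
    have "weight k s (i + m) = real k powi (if s then m else - m) * weight k s i"
      using k_pos by (auto simp: weight_def power_int_add[symmetric] algebra_simps)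
    then show "real_of_int (toggle k f x (s, i) - x (s, i)) * weight k s (i + m)
        = real k powi (if s then m else - m)
          * (real_of_int (toggle k f x (s, i) - x (s, i)) * weight k s i)"
      by simp
  qed
  finally show ?thesis by (simp add: displacement_def sum_distrib_left)
qed

lemma scaled_displacement_shift:
  "scale k s (u + real_of_int m) \<sigma> * displacement k s (\<lambda>i. f (i - m)) (shift m x)
     = scale k s u \<sigma> * displacement k s f x"
  unfolding displacement_shift mult.assoc[symmetric] scale_add[OF k_pos(1)] ..

lemma displacement_zero [simp]: "displacement k s (\<lambda>i. 0) x = 0"
  by (simp add: displacement_def)

lemma lamp_act_mult:
  assumes x: "x \<in> digit_seqs" and f: "finite {i. f i \<noteq> 0}" "finite {i. f' i \<noteq> 0}"
  shows "lamp_act k ((f, m) \<otimes>\<^bsub>lamplighter_group k\<^esub> (f', m')) ((x, (u, \<sigma>)), (p, q))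
      = lamp_act k (f, m) (lamp_act k (f', m') ((x, (u, \<sigma>)), (p, q)))"
proof -
  let ?x = "shift m' x" and ?f = "\<lambda>i. f' (i - m)"
  have x': "shift m ?x \<in> digit_seqs" using x by (intro shift_digit_seqs)
  have disp: "displacement k s (\<lambda>i. (f i + ?f i) mod int k) (shift m ?x)
      = displacement k s ?f (shift m ?x) + displacement k s f (toggle k ?f (shift m ?x))" for s
    by (rule displacement_compose[OF x' f(1) finite_shifted_support[OF f(2)]])
  have scaled: "scale k s (u + (m + m')) \<sigma> * displacement k s (\<lambda>i. (f i + ?f i) mod int k) (shift m ?x)
      = scale k s (u + m') \<sigma> * displacement k s f' ?x
        + scale k s (u + m' + m) \<sigma> * displacement k s f (shift m (toggle k f' ?x))" for s
    using scaled_displacement_shift[of s "u + m'" m \<sigma> f' ?x]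
    unfolding disp shift_toggle by (simp add: distrib_left algebra_simps)
  show ?thesis
    using scaled[of True] scaled[of False]
    by (simp add: lamp_act_def mult_lamplighter shift_toggle toggle_toggle shift_shift algebra_simps)
qed

lemma space_coupling_measure:
  "space (coupling_measure k \<kappa>) = (digit_seqs \<times> UNIV) \<times> UNIV"
  by (auto simp: coupling_measure_def space_pair_measure space_digit_measure sign_measure_def
      space_point_measure)

lemma prob_space_digit: "prob_space (uniform_count_measure {0..<int k})"
  using k_pos by (intro prob_space_uniform_count_measure) auto

lemma prob_space_digit_measure: "prob_space (digit_measure k)"
  unfolding digit_measure_def by (intro prob_space_PiM prob_space_digit)

lemma sigma_finite_sign_measure: "sigma_finite_measure (sign_measure \<kappa>)"
proof -
  have "finite_measure (sign_measure \<kappa>)"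
    by (intro finite_measureI)
      (simp add: sign_measure_def space_point_measure emeasure_point_measure_finite ennreal_mult_eq_top_iff)
  then show ?thesis by (simp add: finite_measure_def)
qed

lemma sigma_finite_height: "sigma_finite_measure (height_measure \<kappa>)"
  by (intro sigma_finite_pair_measure lborel.sigma_finite_measure_axioms sigma_finite_sign_measure)

lemma sigma_finite_digit_measure: "sigma_finite_measure (digit_measure k)"
  using prob_space_digit_measure by (simp add: prob_space_def finite_measure_def)

lemma sigma_finite_base: "sigma_finite_measure (base_measure k \<kappa>)"
  by (intro sigma_finite_pair_measure sigma_finite_height sigma_finite_digit_measure)

lemma sigma_finite_coupling_measure: "sigma_finite_measure (coupling_measure k \<kappa>)"
  unfolding coupling_measure_def
  by (intro sigma_finite_pair_measure lborel.sigma_finite_measure_axioms sigma_finite_base)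

lemma measurable_digit [measurable]: "(\<lambda>x. real_of_int (x i)) \<in> borel_measurable (digit_measure k)"
proof -
  have "(\<lambda>x. x i) \<in> digit_measure k \<rightarrow>\<^sub>M uniform_count_measure {0..<int k}"
    unfolding digit_measure_def by (rule measurable_component_singleton) simp
  moreover have "real_of_int \<in> borel_measurable (uniform_count_measure {0..<int k})"
    by (simp add: measurable_def space_uniform_count_measure sets_uniform_count_measure)
  ultimately show ?thesis by (rule measurable_compose)
qed

lemma measurable_toggle_shift [measurable]:
  "(\<lambda>x. toggle k f (shift m x)) \<in> digit_measure k \<rightarrow>\<^sub>M digit_measure k"
proof -
  have "(\<lambda>x. toggle k f (shift m x)) = (\<lambda>x j. (x (fst j, snd j - m) + f (snd j)) mod int k)"
    by (simp add: toggle_def shift_def fun_eq_iff)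
  moreover have "\<dots> \<in> digit_measure k \<rightarrow>\<^sub>M digit_measure k"
    unfolding digit_measure_def
  proof (rule measurable_PiM_single')
    fix j :: "bool \<times> int"
    let ?D = "uniform_count_measure {0..<int k}"
    have "(\<lambda>x. x (fst j, snd j - m)) \<in> PiM UNIV (\<lambda>_. ?D) \<rightarrow>\<^sub>M ?D"
      by (rule measurable_component_singleton) simp
    moreover have "(\<lambda>d. (d + f (snd j)) mod int k) \<in> ?D \<rightarrow>\<^sub>M ?D"
      using k_pos by (simp add: measurable_def space_uniform_count_measure sets_uniform_count_measure)
    ultimately show "(\<lambda>x. (x (fst j, snd j - m) + f (snd j)) mod int k) \<in> PiM UNIV (\<lambda>_. ?D) \<rightarrow>\<^sub>M ?D"
      by (rule measurable_compose)
  qed (use k_pos in \<open>auto simp: space_PiM space_uniform_count_measure\<close>)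
  ultimately show ?thesis by simp
qed

lemma distr_toggle_shift:
  "distr (digit_measure k) (digit_measure k) (\<lambda>x. toggle k f (shift m x)) = digit_measure k"
proof -
  let ?D = "uniform_count_measure {0..<int k}"
  let ?F = "\<lambda>j d. (d + f (snd j)) mod int k" and ?t = "\<lambda>j :: bool \<times> int. (fst j, snd j - m)"
  have eq: "(\<lambda>x. toggle k f (shift m x)) = (\<lambda>x j. ?F j (x (?t j)))"
    by (simp add: toggle_def shift_def fun_eq_iff)
  have bij: "bij_betw (?F j) {0..<int k} {0..<int k}" for j
    by (rule bij_betw_byWitness[of _ "\<lambda>d. (d - f (snd j)) mod int k"])
      (use k_pos in \<open>auto simp: mod_simps\<close>)
  show ?thesis unfolding eq digit_measure_def
  proof (rule distr_PiM_permute[OF prob_space_digit])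
    show "bij ?t" by (rule o_bij[of "\<lambda>j. (fst j, snd j + m)"]) (auto simp: fun_eq_iff)
    show "?F j \<in> ?D \<rightarrow>\<^sub>M ?D" for j
      using k_pos by (simp add: measurable_def space_uniform_count_measure sets_uniform_count_measure)
    show "distr ?D ?D (?F j) = ?D" for j
      unfolding uniform_count_measure_def by (rule distr_point_measure_bij[OF _ bij]) simp
  qed
qed

lemma measurable_displacement [measurable]: "displacement k s f \<in> borel_measurable (digit_measure k)"
proof -
  have "(\<lambda>x. real_of_int (toggle k f (shift 0 x) j)) \<in> borel_measurable (digit_measure k)" for j
    by (rule measurable_compose[OF measurable_toggle_shift measurable_digit])
  then have [measurable]: "(\<lambda>x. real_of_int (toggle k f x j)) \<in> borel_measurable (digit_measure k)" for j
    by simp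
  have "displacement k s f = (\<lambda>x. \<Sum>i | f i \<noteq> 0.
      (real_of_int (toggle k f x (s, i)) - real_of_int (x (s, i))) * weight k s i)"
    by (simp add: displacement_def fun_eq_iff)
  also have "\<dots> \<in> borel_measurable (digit_measure k)" by measurable
  finally show ?thesis .
qed

lemma measurable_shift [measurable]: "shift m \<in> digit_measure k \<rightarrow>\<^sub>M digit_measure k"
proof -
  have "toggle k (\<lambda>i. 0) (shift m x) = shift m x" if "x \<in> space (digit_measure k)" for x
    using shift_digit_seqs[of x m] that
    by (auto simp: fun_eq_iff toggle_def digit_seqs_def space_digit_measure)
  then show ?thesis
    using measurable_toggle_shift[of "\<lambda>i. 0" m]
    by (simp only: measurable_cong[of "digit_measure k" "\<lambda>x. toggle k (\<lambda>i. 0) (shift m x)" "shift m"])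
qed

lemma measurable_scale [measurable]:
  "(\<lambda>h. scale k s (fst h) (snd h)) \<in> borel_measurable (height_measure \<kappa>)"
proof -
  have [measurable]: "(\<lambda>\<sigma>. if \<sigma> then 1 else - 1 :: real) \<in> borel_measurable (sign_measure \<kappa>)"
    by (simp add: sign_measure_def)
  have "(\<lambda>h. if s then real k powr (- fst h) else (if snd h then 1 else - 1) * real k powr (fst h))
      \<in> borel_measurable (height_measure \<kappa>)"
    by (cases s) (simp_all, measurable)
  then show ?thesis by (simp add: scale_def)
qed

lemma distr_height:
  assumes g: "bij g"
  shows "(\<lambda>h. (fst h + t, g (snd h))) \<in> height_measure \<kappa> \<rightarrow>\<^sub>M height_measure \<kappa>" (is ?A)
    and "distr (height_measure \<kappa>) (height_measure \<kappa>) (\<lambda>h. (fst h + t, g (snd h)))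
      = height_measure \<kappa>" (is ?B)
proof -
  have gm [measurable]: "g \<in> sign_measure \<kappa> \<rightarrow>\<^sub>M sign_measure \<kappa>"
    by (simp add: sign_measure_def space_point_measure)
  show ?A by measurable
  have "distr (height_measure \<kappa>) (height_measure \<kappa>) (\<lambda>(u, \<sigma>). (u + t, g \<sigma>))
      = height_measure \<kappa>"
  proof (rule distr_skew_product[OF sigma_finite_sign_measure])
    show "(\<lambda>u. u + t) \<in> lborel \<rightarrow>\<^sub>M lborel" by measurable
    show "distr lborel lborel (\<lambda>u. u + t) = lborel"
      using lborel_distr_plus[of t] by (simp add: add.commute[of _ t] cong: distr_cong)
    show "(\<lambda>(u, \<sigma>). g \<sigma>) \<in> height_measure \<kappa> \<rightarrow>\<^sub>M sign_measure \<kappa>" by measurable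
    show "distr (sign_measure \<kappa>) (sign_measure \<kappa>) g = sign_measure \<kappa>" for u :: real
      unfolding sign_measure_def by (rule distr_point_measure_bij) (use g in auto)
  qed
  then show ?B by (simp add: case_prod_beta')
qed

text \<open>Both groups act by maps of the following kind: they permute the digits and translate the height
  independently of each other, and then move the plane by an affine map of determinant \<open>\<plusminus>1\<close> whose
  translation part depends on digits, height and sign.\<close>

lemma coupling_measure_preserving:
  fixes D :: "digits \<Rightarrow> digits" and g :: "bool \<Rightarrow> bool"
    and U V :: "digits \<Rightarrow> real \<Rightarrow> bool \<Rightarrow> real" and r s t :: real
  assumes D [measurable]: "D \<in> digit_measure k \<rightarrow>\<^sub>M digit_measure k"
    and distr_D: "distr (digit_measure k) (digit_measure k) D = digit_measure k"
    and g: "bij g" and rs: "\<bar>r * s\<bar> = 1"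
    and U [measurable]: "(\<lambda>w. U (fst w) (fst (snd w)) (snd (snd w)))
      \<in> borel_measurable (base_measure k \<kappa>)"
    and V [measurable]: "(\<lambda>w. V (fst w) (fst (snd w)) (snd (snd w)))
      \<in> borel_measurable (base_measure k \<kappa>)"
  defines "T \<equiv> \<lambda>((x, (u, \<sigma>)), (p, q)). ((D x, (u + t, g \<sigma>)), (r * p + U x u \<sigma>, s * q + V x u \<sigma>))"
  shows "T \<in> coupling_measure k \<kappa> \<rightarrow>\<^sub>M coupling_measure k \<kappa>"
    and "distr (coupling_measure k \<kappa>) (coupling_measure k \<kappa>) T = coupling_measure k \<kappa>"
proof -
  let ?S = "height_measure \<kappa>"
  let ?B = "digit_measure k \<Otimes>\<^sub>M ?S"
  let ?\<phi> = "\<lambda>w. (D (fst w), (fst (snd w) + t, g (snd (snd w))))"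
  let ?\<psi> = "\<lambda>w z. (r * fst z + U (fst w) (fst (snd w)) (snd (snd w)),
                  s * snd z + V (fst w) (fst (snd w)) (snd (snd w)))"
  have T: "T = (\<lambda>(w, z). (?\<phi> w, ?\<psi> w z))" by (auto simp: T_def fun_eq_iff)
  note height = distr_height[OF g, where t = t and \<kappa> = \<kappa>]
  have gm [measurable]: "g \<in> sign_measure \<kappa> \<rightarrow>\<^sub>M sign_measure \<kappa>"
    by (simp add: sign_measure_def space_point_measure)
  have \<phi>: "?\<phi> \<in> ?B \<rightarrow>\<^sub>M ?B" by measurable
  have \<psi>': "(\<lambda>a. ?\<psi> (fst a) (snd a)) \<in> ?B \<Otimes>\<^sub>M (borel :: (real \<times> real) measure) \<rightarrow>\<^sub>M borel \<Otimes>\<^sub>M borel"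
  proof -
    have UV: "(\<lambda>a. U (fst (fst a)) (fst (snd (fst a))) (snd (snd (fst a))))
        \<in> borel_measurable (?B \<Otimes>\<^sub>M (borel :: (real \<times> real) measure))"
      "(\<lambda>a. V (fst (fst a)) (fst (snd (fst a))) (snd (snd (fst a))))
        \<in> borel_measurable (?B \<Otimes>\<^sub>M (borel :: (real \<times> real) measure))"
      using measurable_compose[OF measurable_fst U] measurable_compose[OF measurable_fst V] by simp_all
    have [measurable]: "(\<lambda>a. fst (snd a)) \<in> borel_measurable (?B \<Otimes>\<^sub>M (borel :: (real \<times> real) measure))"
      "(\<lambda>a. snd (snd a)) \<in> borel_measurable (?B \<Otimes>\<^sub>M (borel :: (real \<times> real) measure))"
      using measurable_compose[OF measurable_snd, of fst borel borel ?B]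
        measurable_compose[OF measurable_snd, of snd borel borel ?B]
      by (simp_all add: borel_prod[symmetric])
    show ?thesis using UV by (intro measurable_Pair borel_measurable_add borel_measurable_times) simp_all
  qed
  then have \<psi>: "(\<lambda>(w, z). ?\<psi> w z) \<in> ?B \<Otimes>\<^sub>M lborel \<rightarrow>\<^sub>M lborel"
    by (simp add: case_prod_beta' borel_prod cong: measurable_cong_sets)
  have "(\<lambda>a. (?\<phi> (fst a), ?\<psi> (fst a) (snd a))) \<in> ?B \<Otimes>\<^sub>M lborel \<rightarrow>\<^sub>M ?B \<Otimes>\<^sub>M lborel"
    using measurable_compose[OF measurable_fst \<phi>] \<psi>
    by (intro measurable_Pair) (simp_all add: case_prod_beta')
  then show "T \<in> coupling_measure k \<kappa> \<rightarrow>\<^sub>M coupling_measure k \<kappa>"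
    unfolding T coupling_measure_def by (simp add: case_prod_beta')
  have "distr ?B ?B (\<lambda>(x, h). (D x, (fst h + t, g (snd h)))) = ?B"
  proof (rule distr_skew_product[OF sigma_finite_height D distr_D])
    show "(\<lambda>(x, h). (fst h + t, g (snd h))) \<in> ?B \<rightarrow>\<^sub>M ?S"
      using measurable_compose[OF measurable_snd height(1)] by (simp add: case_prod_beta')
  qed (rule height(2))
  then have distr_\<phi>: "distr ?B ?B ?\<phi> = ?B" by (simp add: case_prod_beta')
  show "distr (coupling_measure k \<kappa>) (coupling_measure k \<kappa>) T = coupling_measure k \<kappa>"
    unfolding T coupling_measure_def
    by (rule distr_skew_product[OF lborel.sigma_finite_measure_axioms \<phi> distr_\<phi> \<psi>])
      (rule distr_lborel_diagonal[OF rs])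
qed

lemma plain_action_lamp: "plain_action (lamplighter_group k) (coupling_measure k \<kappa>) (lamp_act k)"
proof (intro plain_action.intro plain_action_axioms.intro group_lamplighter k_pos(1))
  let ?G = "lamplighter_group k" and ?M = "coupling_measure k \<kappa>"
  note carrier = carrier_lamplighter[OF k_pos(1)]
  fix g assume g: "g \<in> carrier ?G"
  obtain f m where gfm: "g = (f, m)" by (metis surj_pair)
  have act: "lamp_act k g = (\<lambda>((x, (u, \<sigma>)), (p, q)).
     ((toggle k f (shift m x), (u + real_of_int m, id \<sigma>)),
      (1 * p + scale k True (u + real_of_int m) \<sigma> * displacement k True f (shift m x),
       1 * q + scale k False (u + real_of_int m) \<sigma> * displacement k False f (shift m x))))"
    by (simp add: lamp_act_def gfm)
  have meas: "(\<lambda>w. scale k s (fst (snd w) + real_of_int m) (snd (snd w)) * displacement k s f (shift m (fst w)))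
      \<in> borel_measurable (base_measure k \<kappa>)" for s
  proof (intro borel_measurable_times)
    show "(\<lambda>w. displacement k s f (shift m (fst w)))
        \<in> borel_measurable (base_measure k \<kappa>)"
      by measurable
    show "(\<lambda>w. scale k s (fst (snd w) + real_of_int m) (snd (snd w)))
        \<in> borel_measurable (base_measure k \<kappa>)"
      using measurable_compose[OF measurable_snd
          measurable_compose[OF distr_height(1)[OF bij_id, where t = "real_of_int m" and \<kappa> = \<kappa>] measurable_scale[of s \<kappa>]]]
      by simp
  qed
  note mp = coupling_measure_preserving[OF measurable_toggle_shift distr_toggle_shift bij_id _ meas meas,
      of 1 1 f m "real_of_int m"]
  show "lamp_act k g \<in> ?M \<rightarrow>\<^sub>M ?M" unfolding act by (rule mp(1)) simp
  show "distr ?M ?M (lamp_act k g) = ?M" unfolding act by (rule mp(2)) simp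
  show "g = \<one>\<^bsub>?G\<^esub>" if w: "w \<in> space ?M" "lamp_act k g w = w" for w
  proof -
    obtain x u \<sigma> p q where wx: "w = ((x, (u, \<sigma>)), (p, q))" by (metis surj_pair)
    have x: "x \<in> digit_seqs" using w(1) by (simp add: wx space_coupling_measure)
    have m: "m = 0" using w(2) by (simp add: act wx)
    have "toggle k f x (True, i) = x (True, i)" for i
      using w(2) by (simp add: act wx m)
    then have "(x (True, i) + f i) mod int k = x (True, i) mod int k" for i
      using digit_seqsD[OF x] by (simp add: toggle_def)
    then have "int k dvd f i" for i by (simp add: mod_eq_dvd_iff)
    moreover have "0 \<le> f i" "f i < int k" for i using g by (auto simp: gfm carrier)
    ultimately have "f i = 0" for i using zdvd_imp_le[of "int k" "f i"] by (metis linorder_not_le order_le_less)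
    then show ?thesis by (simp add: gfm m one_lamplighter fun_eq_iff)
  qed
  show "lamp_act k (g \<otimes>\<^bsub>?G\<^esub> h) w = lamp_act k g (lamp_act k h w)"
    if "h \<in> carrier ?G" "w \<in> space ?M" for h w
  proof -
    obtain f' m' where h: "h = (f', m')" by (metis surj_pair)
    obtain x u \<sigma> p q where wx: "w = ((x, (u, \<sigma>)), (p, q))" by (metis surj_pair)
    have "x \<in> digit_seqs" using that(2) by (simp add: wx space_coupling_measure)
    then show ?thesis using that(1) g unfolding h gfm wx
      by (intro lamp_act_mult) (simp_all add: carrier)
  qed
next
  show "lamp_act k \<one>\<^bsub>lamplighter_group k\<^esub> w = w" if "w \<in> space (coupling_measure k \<kappa>)" for w
    using that by (auto simp: space_coupling_measure one_lamplighter lamp_act_def toggle_def digit_seqs_def)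
qed

end

section \<open>The action of SOL\<close>

locale lamp_sol = digit_base k + SOL_eigenbasis A l m a b c d
  for k :: nat and A :: "int^2^2" and l m a b c d :: real +
  assumes small: "\<bar>a\<bar> + \<bar>b\<bar> < 1 / (2 * real k)" "\<bar>c\<bar> + \<bar>d\<bar> < 1 / (2 * real k)"
begin

text \<open>A step of the lamplighter changes the height by \<open>1\<close>; the generator \<open>A\<close> changes it by the logarithm of
  \<open>l\<close> to base \<open>k\<close>, so that it stretches cells and plane by the same factor.\<close>

definition climb :: real where "climb = log (real k) l"

lemma climb_pos: "climb > 0"
  using k_pos l by (simp add: climb_def)

lemma k_powr_climb: "real k powr (real_of_int n * climb) = l powi n"
proof -
  have "real k powr (real_of_int n * climb) = (real k powr climb) powr real_of_int n"
    by (simp add: powr_powr mult.commute)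
  also have "real k powr climb = l" using k_pos l by (simp add: climb_def)
  also have "l powr real_of_int n = l powi n" using l by (intro powr_real_of_int') auto
  finally show ?thesis .
qed

definition keeps_sign :: "int \<Rightarrow> bool" where "keeps_sign n \<longleftrightarrow> even n \<or> m > 0"

lemma m_powi: "m powi n = (if keeps_sign n then 1 else - 1) * l powi (- n)"
proof (cases "m > 0")
  case True
  then have "keeps_sign n" by (simp add: keeps_sign_def)
  moreover have "m powi n = inverse l powi n" using True abs_m by simp
  ultimately show ?thesis by (simp add: power_int_inverse power_int_minus)
next
  case False
  then have "keeps_sign n = even n" by (simp add: keeps_sign_def)
  moreover have "m = - inverse l" using False abs_m by linarith
  then have "m powi n = (- inverse l) powi n" by (rule arg_cong)
  ultimately show ?thesis by (simp add: power_int_inverse power_int_minus power_int_minus_left)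
qed

definition sol_act :: "(int^2) \<times> int \<Rightarrow> coupling_point \<Rightarrow> coupling_point" where
  "sol_act = (\<lambda>(v, n) ((x, (u, \<sigma>)), (p, q)).
     ((x, (u - real_of_int n * climb, \<sigma> = keeps_sign n)), (l powi n * p + P v, m powi n * q + Q v)))"

lemma scale_sol:
  "scale k s (u - real_of_int n * climb) (\<sigma> = keeps_sign n)
     = (if s then l powi n else m powi n) * scale k s u \<sigma>"
proof (cases s)
  case True
  have "real k powr (- (u - real_of_int n * climb)) = real k powr (- u) * real k powr (real_of_int n * climb)"
    by (simp add: powr_add[symmetric])
  with True show ?thesis by (simp add: scale_def k_powr_climb)
next
  case False
  have "real k powr (u - real_of_int n * climb) = real k powr u * real k powr (real_of_int (- n) * climb)"
    by (simp add: powr_add[symmetric])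
  with False show ?thesis unfolding k_powr_climb by (auto simp: scale_def m_powi)
qed

lemma keeps_sign_add: "((\<sigma> = keeps_sign n') = keeps_sign n) = (\<sigma> = keeps_sign (n + n'))"
  by (auto simp: keeps_sign_def)

lemma plain_action_sol: "plain_action (SOL_group A) (coupling_measure k \<kappa>) sol_act"
proof (intro plain_action.intro plain_action_axioms.intro group_SOL A)
  let ?M = "coupling_measure k \<kappa>" and ?H = "SOL_group A"
  fix h :: "(int^2) \<times> int" obtain v n where h: "h = (v, n)" by (metis surj_pair)
  have act: "sol_act h = (\<lambda>((x, (u, \<sigma>)), (p, q)). ((x, (u + - (real_of_int n * climb), (\<lambda>\<sigma>. \<sigma> = keeps_sign n) \<sigma>)),
      (l powi n * p + P v, m powi n * q + Q v)))"
    by (auto simp: sol_act_def h)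
  have bij: "bij (\<lambda>\<sigma>. \<sigma> = keeps_sign n)"
    by (rule o_bij[of "\<lambda>\<sigma>. \<sigma> = keeps_sign n"]) (auto simp: fun_eq_iff)
  have "\<bar>l powi n * m powi n\<bar> = 1"
    using lm by (simp add: power_int_mult_distrib[symmetric] power_int_abs)
  note mp = coupling_measure_preserving[OF measurable_ident _ bij this,
      where U = "\<lambda>_ _ _. P v" and V = "\<lambda>_ _ _. Q v" and t = "- (real_of_int n * climb)"]
  show "sol_act h \<in> ?M \<rightarrow>\<^sub>M ?M" unfolding act by (rule mp(1)[unfolded id_def]) simp_all
  show "distr ?M ?M (sol_act h) = ?M" unfolding act by (rule mp(2)[unfolded id_def]) simp_all
  show "h = \<one>\<^bsub>?H\<^esub>" if "sol_act h w = w" for w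
  proof -
    obtain x u \<sigma> p q where wx: "w = ((x, (u, \<sigma>)), (p, q))" by (metis surj_pair)
    have n: "n = 0" using that climb_pos by (simp add: wx h sol_act_def)
    then have "P v = 0" "Q v = 0" using that by (simp_all add: wx h sol_act_def)
    then show ?thesis using lattice_injective by (simp add: h n one_SOL)
  qed
  show "sol_act (h \<otimes>\<^bsub>?H\<^esub> h') w = sol_act h (sol_act h' w)" for h' w
  proof -
    obtain v' n' where h': "h' = (v', n')" by (metis surj_pair)
    obtain x u \<sigma> p q where wx: "w = ((x, (u, \<sigma>)), (p, q))" by (metis surj_pair)
    have lm0: "l \<noteq> 0" "m \<noteq> 0" using l m_neq_0 by auto
    show ?thesis using lm0
      by (simp add: h h' wx sol_act_def mult_SOL keeps_sign_add linear_form_add P_power Q_power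
          power_int_add algebra_simps)
  qed
next
  show "sol_act \<one>\<^bsub>SOL_group A\<^esub> w = w" for w
    by (cases w) (auto simp: sol_act_def one_SOL keeps_sign_def)
qed

text \<open>SOL stretches the plane and the cells by the same factors, and the displacement of the point by lamps
  is measured in units of the cell.\<close>

lemma actions_commute: "lamp_act k g (sol_act h w) = sol_act h (lamp_act k g w)"
proof -
  obtain f j where g: "g = (f, j)" by (metis surj_pair)
  obtain v n where h: "h = (v, n)" by (metis surj_pair)
  obtain x u \<sigma> p q where w: "w = ((x, (u, \<sigma>)), (p, q))" by (metis surj_pair)
  have "u - real_of_int n * climb + real_of_int j = (u + real_of_int j) - real_of_int n * climb" by simp
  then have "scale k s (u - real_of_int n * climb + real_of_int j) (\<sigma> = keeps_sign n)
      = (if s then l powi n else m powi n) * scale k s (u + real_of_int j) \<sigma>" for s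
    by (simp only: scale_sol)
  then show ?thesis
    by (simp add: g h w lamp_act_def sol_act_def distrib_left)
qed

end

section \<open>Digit arithmetic\<close>

context digit_base
begin

lemma place_inj: "inj (place s)"
  by (auto simp: inj_def place_def split: if_splits)

lemma place_ex:
  fixes i :: int
  obtains j where "i = place s j" | j where "i = place (\<not> s) j"
proof (cases "(0 \<le> i) = s")
  case True
  then have "i = place s (nat (if s then i else - 1 - i))" by (auto simp: place_def)
  then show ?thesis using that by blast
next
  case False
  then have "i = place (\<not> s) (nat (if s then - 1 - i else i))" by (auto simp: place_def)
  then show ?thesis using that by blast
qed

lemma place_disjoint: "place s j \<noteq> place (\<not> s) j'"
  by (auto simp: place_def)

lemma finite_place_support:
  "finite {i. f i \<noteq> (0::int)} \<Longrightarrow> finite {j. f (place s j) \<noteq> 0}"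
  using finite_vimageI[OF _ place_inj, of "{i. f i \<noteq> 0}" s] by (simp add: vimage_def)

lemma sum_split_places:
  fixes g :: "int \<Rightarrow> real"
  assumes "finite {i. f i \<noteq> (0::int)}"
  shows "(\<Sum>i | f i \<noteq> 0. g i)
    = (\<Sum>j | f (place s j) \<noteq> 0. g (place s j)) + (\<Sum>j | f (place (\<not> s) j) \<noteq> 0. g (place (\<not> s) j))"
proof -
  let ?A = "\<lambda>s. {j. f (place s j) \<noteq> 0}"
  have "i \<in> place s ` ?A s \<union> place (\<not> s) ` ?A (\<not> s)" if "f i \<noteq> 0" for i
    using that by (rule_tac i = i and s = s in place_ex) auto
  then have "{i. f i \<noteq> 0} = place s ` ?A s \<union> place (\<not> s) ` ?A (\<not> s)" by auto
  moreover have "place s ` ?A s \<inter> place (\<not> s) ` ?A (\<not> s) = {}" using place_disjoint by auto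
  moreover note finite_place_support[OF assms, of s] finite_place_support[OF assms, of "\<not> s"]
  ultimately show ?thesis
    by (simp add: sum.union_disjoint sum.reindex inj_on_subset[OF place_inj])
qed

definition fraction :: "bool \<Rightarrow> digits \<Rightarrow> real" where
  "fraction s x = (\<Sum>j. real_of_int (x (s, place (\<not> s) j)) / real k ^ Suc j)"

definition carry :: "bool \<Rightarrow> (int \<Rightarrow> int) \<Rightarrow> digits \<Rightarrow> int" where
  "carry s f x = (\<Sum>j | f (place s j) \<noteq> 0. (toggle k f x (s, place s j) - x (s, place s j)) * int k ^ j)"

lemma sums_max_fraction: "(\<lambda>j. real (k - 1) / real k ^ Suc j) sums 1"
proof -
  have "(\<lambda>j. (1 / real k) ^ j) sums (1 / (1 - 1 / real k))"
    using k_pos by (intro geometric_sums) simp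
  then have *: "(\<lambda>j. real (k - 1) / real k * (1 / real k) ^ j) sums (real (k - 1) / real k * (1 / (1 - 1 / real k)))"
    by (rule sums_mult)
  have "real (k - 1) / real k * (1 / (1 - 1 / real k)) = 1"
    using k by (simp add: of_nat_diff field_simps)
  moreover have "real (k - 1) / real k * (1 / real k) ^ j = real (k - 1) / real k ^ Suc j" for j
    by (simp add: power_one_over)
  ultimately show ?thesis using * by (simp only:)
qed

lemma fraction_term:
  assumes "x \<in> digit_seqs"
  shows "0 \<le> real_of_int (x i) / real k ^ Suc j" "real_of_int (x i) / real k ^ Suc j \<le> real (k - 1) / real k ^ Suc j"
proof -
  have "0 \<le> x i" "x i \<le> int (k - 1)" using digit_seqsD[OF assms, of i] k by (auto simp: of_nat_diff)
  then have "0 \<le> real_of_int (x i)" "real_of_int (x i) \<le> real (k - 1)" by linarith+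
  then show "0 \<le> real_of_int (x i) / real k ^ Suc j" "real_of_int (x i) / real k ^ Suc j \<le> real (k - 1) / real k ^ Suc j"
    using k_pos by (auto intro!: divide_right_mono divide_nonneg_nonneg)
qed

lemma summable_fraction:
  assumes "x \<in> digit_seqs"
  shows "summable (\<lambda>j. real_of_int (x (s, place s' j)) / real k ^ Suc j)"
proof (rule summable_comparison_test'[OF sums_summable[OF sums_max_fraction]])
  show "norm (real_of_int (x (s, place s' j)) / real k ^ Suc j) \<le> real (k - 1) / real k ^ Suc j" for j
    using fraction_term[OF assms] by (simp only: real_norm_def abs_of_nonneg)
qed

lemma fraction_bounds:
  assumes "x \<in> digit_seqs"
  shows "0 \<le> fraction s x" "fraction s x \<le> 1"
  unfolding fraction_def
  using suminf_nonneg[OF summable_fraction[OF assms]] fraction_term[OF assms]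
    suminf_le[OF fraction_term(2)[OF assms] summable_fraction[OF assms] sums_summable[OF sums_max_fraction]]
    sums_unique[OF sums_max_fraction]
  by simp_all

lemma measurable_fraction [measurable]: "fraction s \<in> borel_measurable (digit_measure k)"
  unfolding fraction_def by measurable

text \<open>Digits at fractional places change the position of the point within its cell of level \<open>0\<close>, the others
  move the cell by a whole number of cells.\<close>

lemma displacement_split:
  assumes x: "x \<in> digit_seqs" and f: "finite {i. f i \<noteq> 0}"
  shows "displacement k s f x = real_of_int (carry s f x) + (fraction s (toggle k f x) - fraction s x)"
proof -
  let ?t = "toggle k f x"
  have "fraction s ?t - fraction s x
      = (\<Sum>j. real_of_int (?t (s, place (\<not> s) j)) / real k ^ Suc j - real_of_int (x (s, place (\<not> s) j)) / real k ^ Suc j)"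
    unfolding fraction_def by (intro suminf_diff summable_fraction toggle_digit_seqs x)
  also have "\<dots> = (\<Sum>j | f (place (\<not> s) j) \<noteq> 0.
      real_of_int (?t (s, place (\<not> s) j)) / real k ^ Suc j - real_of_int (x (s, place (\<not> s) j)) / real k ^ Suc j)"
    by (intro suminf_finite finite_place_support f) (simp add: toggle_unchanged[OF x])
  also have "\<dots> = (\<Sum>j | f (place (\<not> s) j) \<noteq> 0.
      real_of_int (?t (s, place (\<not> s) j) - x (s, place (\<not> s) j)) * weight k s (place (\<not> s) j))"
    by (simp add: weight_place_other[OF k_pos(1)] diff_divide_distrib)
  finally show ?thesis
    unfolding displacement_def sum_split_places[OF f, of _ s]
    by (simp add: carry_def weight_place)
qed

definition value_below :: "bool \<Rightarrow> nat \<Rightarrow> digits \<Rightarrow> int" where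
  "value_below s N x = (\<Sum>j<N. x (s, place s j) * int k ^ j)"

lemma carry_eq_value_below:
  assumes x: "x \<in> digit_seqs" and N: "\<And>j. f (place s j) \<noteq> 0 \<Longrightarrow> j < N"
  shows "carry s f x = value_below s N (toggle k f x) - value_below s N x"
proof -
  have "carry s f x = (\<Sum>j<N. (toggle k f x (s, place s j) - x (s, place s j)) * int k ^ j)"
    unfolding carry_def by (rule sum.mono_neutral_left) (auto simp: N toggle_unchanged[OF x])
  then show ?thesis by (simp add: value_below_def sum_subtractf left_diff_distrib)
qed

lemma digit_sum_unique:
  fixes d d' :: "nat \<Rightarrow> int"
  assumes "\<And>j. 0 \<le> d j \<and> d j < int k" "\<And>j. 0 \<le> d' j \<and> d' j < int k"
    and "(\<Sum>j<N. d j * int k ^ j) = (\<Sum>j<N. d' j * int k ^ j)" and "j < N"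
  shows "d j = d' j"
  using assms
proof (induction N arbitrary: d d' j)
  case (Suc N)
  have split: "(\<Sum>j<Suc N. e j * int k ^ j) = e 0 + int k * (\<Sum>j<N. e (Suc j) * int k ^ j)" for e
    by (simp add: sum.lessThan_Suc_shift sum_distrib_left algebra_simps del: sum.lessThan_Suc)
  have eq: "d 0 + int k * (\<Sum>j<N. d (Suc j) * int k ^ j) = d' 0 + int k * (\<Sum>j<N. d' (Suc j) * int k ^ j)"
    using Suc.prems(3) unfolding split .
  then have "(d 0 + int k * (\<Sum>j<N. d (Suc j) * int k ^ j)) mod int k
      = (d' 0 + int k * (\<Sum>j<N. d' (Suc j) * int k ^ j)) mod int k" by simp
  then have d0: "d 0 = d' 0" using Suc.prems(1,2)[of 0] by simp
  then have rest: "(\<Sum>j<N. d (Suc j) * int k ^ j) = (\<Sum>j<N. d' (Suc j) * int k ^ j)"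
    using eq k_pos by simp
  show ?case
  proof (cases j)
    case 0
    then show ?thesis using d0 by simp
  next
    case (Suc i)
    then show ?thesis
      using Suc.IH[of "\<lambda>j. d (Suc j)" "\<lambda>j. d' (Suc j)" i] Suc.prems rest by simp
  qed
qed simp

lemma digit_expansion:
  fixes y :: int
  shows "(\<Sum>j<N. (y div int k ^ j mod int k) * int k ^ j) = y mod int k ^ N"
proof (induction N)
  case (Suc N)
  have "y mod (int k ^ N * int k) = int k ^ N * (y div int k ^ N mod int k) + y mod int k ^ N"
    by (rule zmod_zmult2_eq) simp
  then show ?case using Suc by (simp add: algebra_simps)
qed simp

text \<open>A number has only one expansion in base \<open>k\<close>.\<close>

lemma carry_injective:
  assumes x: "x \<in> digit_seqs"
    and f: "(f, m) \<in> carrier (lamplighter_group k)" "(f', m') \<in> carrier (lamplighter_group k)"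
    and eq: "\<And>s. carry s f x = carry s f' x"
  shows "f = f'"
proof
  note carrier = carrier_lamplighter[OF k_pos(1)]
  fix i :: int
  define s where "s \<longleftrightarrow> 0 \<le> i"
  have "i = place s (nat (if s then i else - 1 - i))" by (auto simp: s_def place_def)
  then obtain j where j: "i = place s j" by blast
  have "finite ({j. f (place s j) \<noteq> 0} \<union> {j. f' (place s j) \<noteq> 0} \<union> {j})"
    using f by (auto simp: carrier intro: finite_place_support)
  then obtain N where N: "\<forall>j\<in>{j. f (place s j) \<noteq> 0} \<union> {j. f' (place s j) \<noteq> 0} \<union> {j}. j < N"
    using finite_nat_set_iff_bounded by blast
  have "value_below s N (toggle k f x) = value_below s N (toggle k f' x)"
    using eq[of s] carry_eq_value_below[OF x, of f s N] carry_eq_value_below[OF x, of f' s N] N by simp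
  then have "toggle k f x (s, place s j) = toggle k f' x (s, place s j)"
    unfolding value_below_def
    using digit_sum_unique[of "\<lambda>j. toggle k f x (s, place s j)" "\<lambda>j. toggle k f' x (s, place s j)" N j]
      digit_seqsD[OF toggle_digit_seqs] N by simp
  then have "(x (s, i) + f i) mod int k = (x (s, i) + f' i) mod int k"
    by (simp add: toggle_def j)
  then have "f i mod int k = f' i mod int k" by (simp add: mod_eq_dvd_iff)
  then show "f i = f' i" using f by (simp add: carrier)
qed

text \<open>To move the cell by \<open>D s\<close>, write the sum of \<open>D s\<close> and the number formed by the old digits in base
  \<open>k\<close>. The two sequences do not interfere, since every lamp has an integral place in exactly one of
  them.\<close>

lemma carry_surjective:
  assumes x: "x \<in> digit_seqs"
    and D: "\<And>s. 0 \<le> value_below s N x + D s" "\<And>s. value_below s N x + D s < int k ^ N"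
  obtains f where "(f, m) \<in> carrier (lamplighter_group k)" "\<forall>i. f i \<noteq> 0 \<longrightarrow> \<bar>i\<bar> \<le> int N"
    "\<And>s. carry s f x = D s"
proof -
  define y where "y s = value_below s N x + D s" for s
  define f where "f i = (let s = (0 \<le> i); j = nat (if s then i else - 1 - i)
    in if j < N then (y s div int k ^ j mod int k - x (s, i)) mod int k else 0)" for i
  have f_place: "f (place s j) = (if j < N then (y s div int k ^ j mod int k - x (s, place s j)) mod int k else 0)" for s j
    by (cases s) (simp_all add: f_def place_def Let_def)
  have supp: "\<bar>i\<bar> \<le> int N" if "f i \<noteq> 0" for i
    using that by (auto simp: f_def Let_def split: if_splits)
  have "- int N \<le> i \<and> i \<le> int N" if "f i \<noteq> 0" for i using supp[OF that] by linarith
  then have "{i. f i \<noteq> 0} \<subseteq> {- int N..int N}" by auto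
  then have "finite {i. f i \<noteq> 0}" by (rule finite_subset) simp
  moreover have "0 \<le> f i \<and> f i < int k" for i using k_pos by (auto simp: f_def Let_def)
  ultimately have car: "(f, m) \<in> carrier (lamplighter_group k)"
    using carrier_lamplighter[OF k_pos(1)] by blast
  have "carry s f x = D s" for s
  proof -
    have "toggle k f x (s, place s j) = y s div int k ^ j mod int k" if "j < N" for j
      using that by (simp add: toggle_def f_place mod_add_right_eq)
    then have "value_below s N (toggle k f x) = (\<Sum>j<N. (y s div int k ^ j mod int k) * int k ^ j)"
      unfolding value_below_def by (intro sum.cong) auto
    also have "\<dots> = y s" using D[of s] unfolding digit_expansion y_def by simp
    finally show ?thesis
      using carry_eq_value_below[OF x, of f s N] by (auto simp: f_place y_def split: if_splits)
  qed
  then show ?thesis using that car supp by blast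
qed

lemma value_below_ge:
  assumes x: "x \<in> digit_seqs" and j: "j < N" "x (s, place s j) \<noteq> 0"
  shows "int k ^ j \<le> value_below s N x"
proof -
  have "int k ^ j \<le> x (s, place s j) * int k ^ j"
    using digit_seqsD(1)[OF x, of "(s, place s j)"] j(2) k_pos by (simp add: mult_le_cancel_right1)
  also have "\<dots> \<le> value_below s N x"
    unfolding value_below_def
    by (rule member_le_sum[of j "{..<N}" "\<lambda>j. x (s, place s j) * int k ^ j"])
      (use j digit_seqsD(1)[OF x] k_pos in \<open>auto intro!: mult_nonneg_nonneg\<close>)
  finally show ?thesis .
qed

lemma sum_max_digits: "(\<Sum>j<N. (int k - 1) * int k ^ j) = int k ^ N - 1"
  by (induction N) (simp_all add: algebra_simps)

lemma value_below_le:
  assumes x: "x \<in> digit_seqs" and j: "j < N" "x (s, place s j) \<noteq> int k - 1"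
  shows "value_below s N x \<le> int k ^ N - 1 - int k ^ j"
proof -
  define x' where "x' i = int k - 1 - x i" for i
  have x': "x' \<in> digit_seqs"
    using digit_seqsD[OF x] by (auto simp: digit_seqs_def x'_def) (smt (verit))
  have "value_below s N x' = (\<Sum>j<N. (int k - 1) * int k ^ j - x (s, place s j) * int k ^ j)"
    by (simp add: value_below_def x'_def left_diff_distrib)
  also have "\<dots> = int k ^ N - 1 - value_below s N x"
    by (simp add: sum_subtractf sum_max_digits value_below_def)
  finally have "value_below s N x' = int k ^ N - 1 - value_below s N x" .
  moreover have "int k ^ j \<le> value_below s N x'" using j by (intro value_below_ge x') (auto simp: x'_def)
  ultimately show ?thesis by simp
qed

text \<open>To add a number of size at most \<open>k\<close> to the power \<open>N0\<close> causes at most one carry or borrow into place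
  \<open>N0\<close>. It is absorbed before place \<open>N\<close>, unless from \<open>N0\<close> on all digits are \<open>k - 1\<close> (a carry passes) or
  all are \<open>0\<close> (a borrow passes).\<close>

lemma carry_absorbed:
  assumes x: "x \<in> digit_seqs" and D: "\<bar>D\<bar> \<le> int k ^ N0"
    and "\<exists>j. N0 \<le> j \<and> j < N \<and> x (s, place s j) \<noteq> 0"
    and "\<exists>j. N0 \<le> j \<and> j < N \<and> x (s, place s j) \<noteq> int k - 1"
  shows "0 \<le> value_below s N x + D" "value_below s N x + D < int k ^ N"
proof -
  obtain i where i: "N0 \<le> i" "i < N" "x (s, place s i) \<noteq> 0" using assms(3) by blast
  obtain j where j: "N0 \<le> j" "j < N" "x (s, place s j) \<noteq> int k - 1" using assms(4) by blast
  have "int k ^ N0 \<le> int k ^ i" "int k ^ N0 \<le> int k ^ j"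
    using i(1) j(1) k by (auto intro!: power_increasing)
  with value_below_ge[OF x i(2,3)] value_below_le[OF x j(2,3)] D
  show "0 \<le> value_below s N x + D" "value_below s N x + D < int k ^ N" by linarith+
qed

section \<open>The fundamental domain of the lamplighter group\<close>

text \<open>The position of the origin of the plane relative to the corner of the cell of level \<open>0\<close> that contains
  the point, in units of the cell.\<close>

definition origin_pos :: "bool \<Rightarrow> coupling_point \<Rightarrow> real" where
  "origin_pos s = (\<lambda>((x, (u, \<sigma>)), (p, q)). fraction s x - (if s then p else q) / scale k s u \<sigma>)"

definition lamp_domain :: "coupling_point set" where
  "lamp_domain = {w. fst (fst w) \<in> digit_seqs \<and> 0 \<le> fst (snd (fst w)) \<and> fst (snd (fst w)) < 1 \<and>
     (\<forall>s. 0 \<le> origin_pos s w \<and> origin_pos s w < 1)}"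

definition walk :: "int \<Rightarrow> coupling_point \<Rightarrow> coupling_point" where
  "walk m = (\<lambda>((x, (u, \<sigma>)), z). ((shift m x, (u + real_of_int m, \<sigma>)), z))"

lemma scale_neq_0: "scale k s u \<sigma> \<noteq> 0"
  using k_pos by (simp add: scale_def)

lemma lamp_act_walk: "x \<in> digit_seqs \<Longrightarrow> lamp_act k (\<lambda>i. 0, m) ((x, (u, \<sigma>)), z) = walk m ((x, (u, \<sigma>)), z)"
  by (cases z) (auto simp: lamp_act_def walk_def toggle_def shift_def digit_seqs_def fun_eq_iff)

lemma origin_pos_lamp_act:
  assumes x: "x \<in> digit_seqs" and f: "finite {i. f i \<noteq> 0}"
  shows "origin_pos s (lamp_act k (f, m) ((x, h), z))
    = origin_pos s (walk m ((x, h), z)) - real_of_int (carry s f (shift m x))"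
proof -
  obtain u \<sigma> p q where hz: "h = (u, \<sigma>)" "z = (p, q)" by (metis surj_pair)
  show ?thesis
    using scale_neq_0[of s "u + real_of_int m" \<sigma>]
    by (auto simp: hz origin_pos_def lamp_act_def walk_def displacement_split[OF shift_digit_seqs[OF x] f]
        add_divide_distrib)
qed

text \<open>The lamplighter can bring the height into \<open>[0, 1)\<close> in only one way, and then his lamps have to carry
  the cell of the point onto the cell of the origin.\<close>

lemma lamp_act_in_domain_iff:
  assumes x: "x \<in> digit_seqs" and f: "finite {i. f i \<noteq> 0}"
  shows "lamp_act k (f, m) ((x, (u, \<sigma>)), z) \<in> lamp_domain \<longleftrightarrow>
    m = - \<lfloor>u\<rfloor> \<and> (\<forall>s. carry s f (shift m x) = \<lfloor>origin_pos s (walk m ((x, (u, \<sigma>)), z))\<rfloor>)"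
proof -
  have fst: "fst (lamp_act k (f, m) ((x, (u, \<sigma>)), z)) = (toggle k f (shift m x), (u + real_of_int m, \<sigma>))"
    by (cases z) (simp add: lamp_act_def)
  have "0 \<le> u + real_of_int m \<and> u + real_of_int m < 1 \<longleftrightarrow> m = - \<lfloor>u\<rfloor>" by linarith
  moreover have "0 \<le> e - real_of_int j \<and> e - real_of_int j < 1 \<longleftrightarrow> j = \<lfloor>e\<rfloor>" for e j by linarith
  ultimately show ?thesis
    unfolding lamp_domain_def mem_Collect_eq fst origin_pos_lamp_act[OF x f]
    by (simp add: toggle_digit_seqs conj_assoc[symmetric])
qed

lemma lamp_domain_unique:
  assumes w: "w \<in> space (coupling_measure k \<kappa>)"
    and g: "g \<in> carrier (lamplighter_group k)" "lamp_act k g w \<in> lamp_domain"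
    and g': "g' \<in> carrier (lamplighter_group k)" "lamp_act k g' w \<in> lamp_domain"
  shows "g = g'"
proof -
  obtain f m f' m' where gf: "g = (f, m)" "g' = (f', m')" by (metis surj_pair)
  obtain x u \<sigma> z where wx: "w = ((x, (u, \<sigma>)), z)" by (metis surj_pair)
  have x: "x \<in> digit_seqs" using w by (auto simp: wx space_coupling_measure)
  note iff = lamp_act_in_domain_iff[OF x]
  have fin: "finite {i. f i \<noteq> 0}" "finite {i. f' i \<noteq> 0}"
    using g(1) g'(1) by (auto simp: gf carrier_lamplighter[OF k_pos(1)])
  have "m = - \<lfloor>u\<rfloor> \<and> (\<forall>s. carry s f (shift m x) = \<lfloor>origin_pos s (walk m ((x, (u, \<sigma>)), z))\<rfloor>)"
    "m' = - \<lfloor>u\<rfloor> \<and> (\<forall>s. carry s f' (shift m' x) = \<lfloor>origin_pos s (walk m' ((x, (u, \<sigma>)), z))\<rfloor>)"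
    by (rule iffD1[OF iff[OF fin(1)] g(2)[unfolded gf wx]],
        rule iffD1[OF iff[OF fin(2)] g'(2)[unfolded gf wx]])
  then have *: "m = - \<lfloor>u\<rfloor>" "m' = - \<lfloor>u\<rfloor>"
    "\<forall>s. carry s f (shift m x) = \<lfloor>origin_pos s (walk m ((x, (u, \<sigma>)), z))\<rfloor>"
    "\<forall>s. carry s f' (shift m' x) = \<lfloor>origin_pos s (walk m' ((x, (u, \<sigma>)), z))\<rfloor>"
    by blast+
  then have "m' = m" by simp
  have "carry s f (shift m x) = carry s f' (shift m x)" for s
    using *(3,4) unfolding \<open>m' = m\<close> by simp
  then have "f = f'"
    by (rule carry_injective[OF shift_digit_seqs[OF x] g(1)[unfolded gf] g'(1)[unfolded gf]])
  with \<open>m' = m\<close> show ?thesis by (simp add: gf)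
qed

end

context digit_base
begin

text \<open>The event that a carry or borrow into place \<open>2 n\<close> may pass on to place \<open>2 n + j\<close>. The factor \<open>2\<close> leaves room
  for a shift of the digits by at most \<open>n\<close>.\<close>

definition long_carry :: "nat \<Rightarrow> nat \<Rightarrow> digits set" where
  "long_carry n j = {x \<in> digit_seqs. \<exists>s. (\<forall>t<j. x (s, place s (2 * n + t)) = 0) \<or>
     (\<forall>t<j. x (s, place s (2 * n + t)) = int k - 1)}"

lemma long_carry_0: "long_carry n 0 = digit_seqs"
  by (auto simp: long_carry_def)

lemma emeasure_constant_block:
  fixes s :: bool and n j :: nat
  assumes d: "0 \<le> d" "d < int k"
  defines "B \<equiv> {x \<in> digit_seqs. \<forall>t<j. x (s, place s (n + t)) = d}"
  shows "B \<in> sets (digit_measure k)" "emeasure (digit_measure k) B \<le> ennreal ((1 / 2) ^ j)"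
proof -
  let ?D = "uniform_count_measure {0..<int k}"
  interpret product_prob_space "\<lambda>_. ?D" "UNIV :: (bool \<times> int) set"
    by (intro product_prob_spaceI prob_space_digit)
  define J where "J = (\<lambda>t. (s, place s (n + t))) ` {..<j}"
  have inj: "inj_on (\<lambda>t. (s, place s (n + t))) {..<j}"
    by (rule inj_onI) (use injD[OF place_inj] in fastforce)
  have B: "B = {x \<in> space (PiM UNIV (\<lambda>_. ?D)). \<forall>i\<in>J. x i \<in> {d}}"
    unfolding B_def J_def space_digit_measure[symmetric] digit_measure_def by auto
  have single: "{d} \<in> sets ?D" using d by (simp add: sets_uniform_count_measure)
  show "B \<in> sets (digit_measure k)"
    unfolding B digit_measure_def using single
    by (intro sets.sets_Collect_finite_All sets_Collect_single) (auto simp: J_def)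
  have "emeasure (digit_measure k) B = (\<Prod>i\<in>J. emeasure ?D {d})"
    unfolding B digit_measure_def by (rule emeasure_PiM_Collect) (use single in \<open>auto simp: J_def\<close>)
  also have "\<dots> = ennreal (1 / real k) ^ j"
    using d inj by (simp add: emeasure_uniform_count_measure J_def card_image)
  also have "\<dots> \<le> ennreal (1 / 2) ^ j"
    using k by (intro power_mono ennreal_leI) (simp_all add: field_simps)
  also have "\<dots> = ennreal ((1 / 2) ^ j)" by (rule ennreal_power) simp
  finally show "emeasure (digit_measure k) B \<le> ennreal ((1 / 2) ^ j)" .
qed

lemma long_carry_measure:
  shows "long_carry n j \<in> sets (digit_measure k)"
    and "emeasure (digit_measure k) (long_carry n j) \<le> ennreal (4 * (1 / 2) ^ j)"
proof -
  let ?B = "\<lambda>s d. {x \<in> digit_seqs. \<forall>t<j. x (s, place s (2 * n + t)) = d}"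
  let ?E = "emeasure (digit_measure k)" and ?e = "ennreal ((1 / 2) ^ j)"
  have d: "0 \<le> (0::int)" "0 < int k" "0 \<le> int k - 1" "int k - 1 < int k" using k by auto
  define P where "P s = ?B s 0 \<union> ?B s (int k - 1)" for s
  have P: "P s \<in> sets (digit_measure k)" "?E (P s) \<le> ?e + ?e" for s
  proof -
    note B0 = emeasure_constant_block[OF d(1,2), of j s "2 * n"]
      and B1 = emeasure_constant_block[OF d(3,4), of j s "2 * n"]
    show "P s \<in> sets (digit_measure k)" unfolding P_def by (rule sets.Un[OF B0(1) B1(1)])
    show "?E (P s) \<le> ?e + ?e" unfolding P_def
      by (rule order_trans[OF emeasure_subadditive[OF B0(1) B1(1)] add_mono[OF B0(2) B1(2)]])
  qed
  have eq: "long_carry n j = P True \<union> P False"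
    unfolding long_carry_def ex_bool_eq P_def by blast
  show "long_carry n j \<in> sets (digit_measure k)"
    unfolding eq by (rule sets.Un[OF P(1) P(1)])
  have "?E (long_carry n j) \<le> (?e + ?e) + (?e + ?e)"
    unfolding eq by (rule order_trans[OF emeasure_subadditive[OF P(1) P(1)] add_mono[OF P(2) P(2)]])
  also have "\<dots> = ennreal (4 * (1 / 2) ^ j)"
    by (simp add: ennreal_plus[symmetric] del: ennreal_plus)
  finally show "?E (long_carry n j) \<le> ennreal (4 * (1 / 2) ^ j)" .
qed

text \<open>A carry that never ends would have to pass through infinitely many equal digits.\<close>

lemma AE_short_carry: "AE x in digit_measure k. \<forall>n. \<exists>j. x \<notin> long_carry n j"
proof (subst AE_all_countable, intro allI)
  fix n
  let ?Z = "\<Inter>j. long_carry n j"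
  have sets: "?Z \<in> sets (digit_measure k)"
    by (rule sets.countable_INT) (auto intro: long_carry_measure)
  have "emeasure (digit_measure k) ?Z \<le> ennreal (4 * (1 / 2) ^ j)" for j
    by (rule order_trans[OF emeasure_mono[OF _ long_carry_measure(1)] long_carry_measure(2)]) auto
  moreover have "(\<lambda>j. ennreal (4 * (1 / 2) ^ j)) \<longlonglongrightarrow> ennreal (4 * 0)"
    by (intro tendsto_ennrealI tendsto_mult tendsto_const LIMSEQ_realpow_zero) auto
  ultimately have "emeasure (digit_measure k) ?Z \<le> ennreal (4 * 0)"
    by (intro LIMSEQ_le_const) auto
  then have "?Z \<in> null_sets (digit_measure k)" using sets by (auto simp: null_sets_def)
  then show "AE x in digit_measure k. \<exists>j. x \<notin> long_carry n j"
    by (rule AE_I') auto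
qed

lemma AE_coupling_measure:
  assumes "AE x in digit_measure k. Q x"
  shows "AE w in coupling_measure k \<kappa>. Q (fst (fst w))"
proof -
  interpret S: sigma_finite_measure "height_measure \<kappa>" by (rule sigma_finite_height)
  obtain Z where Z: "{x \<in> space (digit_measure k). \<not> Q x} \<subseteq> Z" "emeasure (digit_measure k) Z = 0"
    "Z \<in> sets (digit_measure k)"
    using AE_E[OF assms] .
  have "Z \<in> null_sets (digit_measure k)" using Z by auto
  then have "Z \<times> space (height_measure \<kappa>) \<in> null_sets (base_measure k \<kappa>)"
    by (rule S.times_in_null_sets1[OF _ sets.top])
  then have "(Z \<times> space (height_measure \<kappa>)) \<times> space lborel \<in> null_sets (coupling_measure k \<kappa>)"
    unfolding coupling_measure_def by (rule lborel.times_in_null_sets1[OF _ sets.top])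
  then show ?thesis
    by (rule AE_I') (use Z(1) in \<open>auto simp: space_coupling_measure space_digit_measure
        space_pair_measure sign_measure_def space_point_measure\<close>)
qed

lemma shift_place:
  assumes "nat \<bar>m\<bar> \<le> i"
  obtains i' where "i \<le> i' + nat \<bar>m\<bar>" "i' \<le> i + nat \<bar>m\<bar>" "place s i' - m = place s i"
proof (cases s)
  case True
  then show ?thesis using that[of "nat (int i + m)"] assms by (auto simp: place_def)
next
  case False
  then show ?thesis using that[of "nat (int i - m)"] assms by (auto simp: place_def)
qed

text \<open>If the height is at most \<open>n\<close> and the origin lies within \<open>k\<^sup>n\<close> cells, then a carry into place \<open>n\<close> of the
  shifted digits has to be absorbed. The shift is by at most \<open>n\<close>, so the digits that absorb it lie
  between the places \<open>n\<close> and \<open>3 n + j\<close>.\<close>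

lemma short_carry_return:
  assumes x: "x \<in> digit_seqs" and u: "\<bar>\<lfloor>u\<rfloor>\<bar> \<le> int n"
    and e: "\<And>s. \<bar>\<lfloor>origin_pos s (walk (- \<lfloor>u\<rfloor>) ((x, (u, \<sigma>)), z))\<rfloor>\<bar> \<le> int k ^ n"
    and short: "x \<notin> long_carry n j"
  obtains f where "(f, - \<lfloor>u\<rfloor>) \<in> carrier (lamplighter_group k)"
    "\<forall>i. f i \<noteq> 0 \<longrightarrow> \<bar>i\<bar> \<le> int (3 * n + j)"
    "lamp_act k (f, - \<lfloor>u\<rfloor>) ((x, (u, \<sigma>)), z) \<in> lamp_domain"
proof -
  define m where "m = - \<lfloor>u\<rfloor>"
  define y where "y = shift m x"
  define D where "D s = \<lfloor>origin_pos s (walk m ((x, (u, \<sigma>)), z))\<rfloor>" for s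
  have m: "nat \<bar>m\<bar> \<le> n" using u by (simp add: m_def nat_le_iff)
  have y: "y \<in> digit_seqs" unfolding y_def by (rule shift_digit_seqs[OF x])
  have move: "\<exists>j'. n \<le> j' \<and> j' < 3 * n + j \<and> y (s, place s j') \<noteq> d"
    if t: "t < j" "x (s, place s (2 * n + t)) \<noteq> d" for s t d
  proof -
    obtain i' where "2 * n + t \<le> i' + nat \<bar>m\<bar>" "i' \<le> 2 * n + t + nat \<bar>m\<bar>" "place s i' - m = place s (2 * n + t)"
      using shift_place[of m "2 * n + t" s] m by auto
    then show ?thesis using m t by (intro exI[of _ i']) (auto simp: y_def shift_def)
  qed
  have ex: "\<exists>t<j. x (s, place s (2 * n + t)) \<noteq> 0" "\<exists>t<j. x (s, place s (2 * n + t)) \<noteq> int k - 1" for s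
    using short x by (auto simp: long_carry_def)
  have absorbed: "0 \<le> value_below s (3 * n + j) y + D s"
    "value_below s (3 * n + j) y + D s < int k ^ (3 * n + j)" for s
  proof -
    obtain t where t: "t < j" "x (s, place s (2 * n + t)) \<noteq> 0" using ex(1)[of s] by blast
    obtain t' where t': "t' < j" "x (s, place s (2 * n + t')) \<noteq> int k - 1" using ex(2)[of s] by blast
    have "\<bar>D s\<bar> \<le> int k ^ n" using e[of s] by (simp only: D_def m_def)
    from carry_absorbed[OF y this move[OF t] move[OF t']]
    show "0 \<le> value_below s (3 * n + j) y + D s"
      "value_below s (3 * n + j) y + D s < int k ^ (3 * n + j)" .
  qed
  obtain f where f: "(f, m) \<in> carrier (lamplighter_group k)"
    "\<forall>i. f i \<noteq> 0 \<longrightarrow> \<bar>i\<bar> \<le> int (3 * n + j)" "\<And>s. carry s f y = D s"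
    using carry_surjective[where m = m, OF y absorbed] by metis
  have "finite {i. f i \<noteq> 0}" using f(1) by (simp add: carrier_lamplighter[OF k_pos(1)])
  then have "lamp_act k (f, m) ((x, (u, \<sigma>)), z) \<in> lamp_domain"
    using f(3) by (simp add: lamp_act_in_domain_iff[OF x] m_def D_def y_def)
  then show ?thesis by (intro that[of f]) (use f in \<open>simp_all only: m_def\<close>)
qed

lemma measurable_origin_pos [measurable]: "origin_pos s \<in> borel_measurable (coupling_measure k \<kappa>)"
proof -
  let ?B = "base_measure k \<kappa>"
  have "(\<lambda>w. fraction s (fst (fst w))) \<in> borel_measurable (?B \<Otimes>\<^sub>M lborel)"
    by (intro measurable_compose[OF measurable_fst] measurable_compose[OF measurable_fst measurable_fraction])
  moreover have "(\<lambda>w. scale k s (fst (snd (fst w))) (snd (snd (fst w)))) \<in> borel_measurable (?B \<Otimes>\<^sub>M lborel)"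
    by (intro measurable_compose[OF measurable_fst] measurable_compose[OF measurable_snd measurable_scale])
  moreover have "(\<lambda>w. (if s then fst (snd w) else snd (snd w))) \<in> borel_measurable (?B \<Otimes>\<^sub>M (lborel :: (real \<times> real) measure))"
    by (rule measurable_compose[OF measurable_snd]) (cases s, simp_all add: borel_prod[symmetric])
  ultimately have "(\<lambda>w. fraction s (fst (fst w)) - (if s then fst (snd w) else snd (snd w))
      / scale k s (fst (snd (fst w))) (snd (snd (fst w)))) \<in> borel_measurable (coupling_measure k \<kappa>)"
    unfolding coupling_measure_def by (intro borel_measurable_diff borel_measurable_divide)
  then show ?thesis by (simp add: origin_pos_def case_prod_beta')
qed

lemma measurable_height [measurable]: "(\<lambda>w. fst (snd (fst w))) \<in> borel_measurable (coupling_measure k \<kappa>)"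
  unfolding coupling_measure_def
  by (intro measurable_compose[OF measurable_fst] measurable_compose[OF measurable_snd] measurable_fst'') simp

lemma lamp_domain_sets: "lamp_domain \<in> sets (coupling_measure k \<kappa>)"
proof -
  have "lamp_domain = {w \<in> space (coupling_measure k \<kappa>). 0 \<le> fst (snd (fst w)) \<and> fst (snd (fst w)) < 1
      \<and> (0 \<le> origin_pos True w \<and> origin_pos True w < 1) \<and> (0 \<le> origin_pos False w \<and> origin_pos False w < 1)}"
    by (auto simp: lamp_domain_def space_coupling_measure) (case_tac s; simp)+
  also have "\<dots> \<in> sets (coupling_measure k \<kappa>)" by measurable
  finally show ?thesis .
qed

lemma scale_bounds:
  assumes "0 \<le> u" "u < 1"
  shows "\<bar>scale k s u \<sigma>\<bar> \<le> real k" "1 / real k \<le> \<bar>scale k s u \<sigma>\<bar>"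
proof -
  have "real k powr u \<le> real k powr 1" "real k powr (- u) \<le> real k powr 1"
    "real k powr (- 1) \<le> real k powr u" "real k powr (- 1) \<le> real k powr (- u)"
    using assms k_pos by (intro powr_mono; simp)+
  moreover have "real k powr (- 1) = 1 / real k" using k_pos by (simp add: powr_minus_divide)
  ultimately show "\<bar>scale k s u \<sigma>\<bar> \<le> real k" "1 / real k \<le> \<bar>scale k s u \<sigma>\<bar>"
    using k_pos by (auto simp: scale_def abs_mult)
qed

lemma origin_pos_bound:
  assumes x: "x \<in> digit_seqs" and u: "0 \<le> u" "u < 1"
  shows "\<bar>origin_pos s ((x, (u, \<sigma>)), (p, q))\<bar> \<le> 1 + real k * \<bar>if s then p else q\<bar>"
proof -
  let ?z = "if s then p else q" and ?c = "scale k s u \<sigma>"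
  have "1 / \<bar>?c\<bar> \<le> real k"
    using scale_bounds(2)[OF u, of s \<sigma>] k_pos scale_neq_0[of s u \<sigma>] by (simp add: field_simps)
  then have "\<bar>?z\<bar> * (1 / \<bar>?c\<bar>) \<le> \<bar>?z\<bar> * real k" by (rule mult_left_mono) simp
  then have "\<bar>?z / ?c\<bar> \<le> real k * \<bar>?z\<bar>" by (simp add: abs_divide mult.commute)
  moreover have "\<bar>fraction s x\<bar> \<le> 1" using fraction_bounds[OF x, of s] by simp
  moreover have "origin_pos s ((x, (u, \<sigma>)), (p, q)) = fraction s x - ?z / ?c" by (simp add: origin_pos_def)
  ultimately show ?thesis using abs_triangle_ineq4[of "fraction s x" "?z / ?c"] by linarith
qed

lemma lamp_domain_bounded:
  assumes "((x, (u, \<sigma>)), (p, q)) \<in> lamp_domain"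
  shows "x \<in> digit_seqs" "0 \<le> u" "u < 1" "\<bar>p\<bar> \<le> real k" "\<bar>q\<bar> \<le> real k"
proof -
  show x: "x \<in> digit_seqs" and u: "0 \<le> u" "u < 1" using assms by (auto simp: lamp_domain_def)
  have "\<bar>if s then p else q\<bar> \<le> real k" for s
  proof -
    let ?z = "if s then p else q" and ?c = "scale k s u \<sigma>"
    have "0 \<le> fraction s x - ?z / ?c" "fraction s x - ?z / ?c < 1"
      using assms by (auto simp: lamp_domain_def origin_pos_def)
    then have "\<bar>?z / ?c\<bar> \<le> 1" using fraction_bounds[OF x, of s] by linarith
    then have "\<bar>?z\<bar> \<le> \<bar>?c\<bar>" using scale_neq_0[of s u \<sigma>] by (simp add: abs_divide)
    then show ?thesis using scale_bounds(1)[OF u, of s \<sigma>] by linarith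
  qed
  from this[of True] this[of False] show "\<bar>p\<bar> \<le> real k" "\<bar>q\<bar> \<le> real k" by simp_all
qed

lemma lamp_fundamental_domain:
  "fundamental_domain (lamplighter_group k) (coupling_measure k \<kappa>) (lamp_act k) lamp_domain"
  unfolding fundamental_domain_def
proof (intro conjI lamp_domain_sets)
  show "AE w in coupling_measure k \<kappa>. \<exists>!g. g \<in> carrier (lamplighter_group k) \<and> lamp_act k g w \<in> lamp_domain"
    using AE_coupling_measure[OF AE_short_carry] AE_space
  proof eventually_elim
    case (elim w)
    obtain x u \<sigma> z where w: "w = ((x, (u, \<sigma>)), z)" by (metis surj_pair)
    have x: "x \<in> digit_seqs" using elim(2) by (auto simp: w space_coupling_measure)
    let ?e = "\<lambda>s. \<bar>\<lfloor>origin_pos s (walk (- \<lfloor>u\<rfloor>) ((x, (u, \<sigma>)), z))\<rfloor>\<bar>"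
    define n where "n = nat (\<bar>\<lfloor>u\<rfloor>\<bar> + ?e True + ?e False)"
    have n: "int n < int k ^ n"
      using of_nat_less_iff[of n "k ^ n", where 'a = int] power_gt_expt[of k n] k by simp
    have "\<bar>\<lfloor>u\<rfloor>\<bar> \<le> int n" by (simp add: n_def)
    moreover have "?e s \<le> int n" for s by (cases s) (simp_all add: n_def)
    then have "?e s \<le> int k ^ n" for s using n by (meson less_imp_le order_trans)
    moreover obtain j where "x \<notin> long_carry n j" using elim(1) by (auto simp: w)
    ultimately obtain f where "(f, - \<lfloor>u\<rfloor>) \<in> carrier (lamplighter_group k)"
      "lamp_act k (f, - \<lfloor>u\<rfloor>) ((x, (u, \<sigma>)), z) \<in> lamp_domain"
      using short_carry_return[OF x, of u n \<sigma> z j] by metis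
    then show ?case using lamp_domain_unique[OF elim(2)] unfolding w by blast
  qed
qed

lemma emeasure_base_box:
  assumes E: "E \<in> sets (digit_measure k)" and U: "U \<in> sets borel" and \<kappa>: "\<kappa> \<ge> 0"
  defines "B \<equiv> base_measure k \<kappa>"
  shows "E \<times> (U \<times> UNIV) \<in> sets B"
    and "emeasure B (E \<times> (U \<times> UNIV)) = emeasure (digit_measure k) E * (emeasure lborel U * ennreal (2 * \<kappa>))"
proof -
  interpret S: sigma_finite_measure "height_measure \<kappa>" by (rule sigma_finite_height)
  interpret S': sigma_finite_measure "sign_measure \<kappa>" by (rule sigma_finite_sign_measure)
  have "emeasure (sign_measure \<kappa>) UNIV = ennreal \<kappa> + ennreal \<kappa>"
    by (simp add: sign_measure_def emeasure_point_measure_finite mult_2)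
  also have "\<dots> = ennreal (\<kappa> + \<kappa>)" using \<kappa> by (intro ennreal_plus[symmetric])
  finally have sign: "UNIV \<in> sets (sign_measure \<kappa>)" "emeasure (sign_measure \<kappa>) UNIV = ennreal (2 * \<kappa>)"
    by (simp_all only: sign_measure_def sets_point_measure mult_2 Pow_UNIV UNIV_I)
  have U': "U \<in> sets lborel" using U by simp
  note UU = pair_measureI[OF U' sign(1)]
  show "E \<times> (U \<times> UNIV) \<in> sets B" unfolding B_def by (rule pair_measureI[OF E UU])
  have "emeasure B (E \<times> (U \<times> UNIV))
      = emeasure (digit_measure k) E * emeasure (height_measure \<kappa>) (U \<times> UNIV)"
    unfolding B_def by (rule S.emeasure_pair_measure_Times[OF E UU])
  also have "emeasure (height_measure \<kappa>) (U \<times> UNIV) = emeasure lborel U * ennreal (2 * \<kappa>)"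
    unfolding sign(2)[symmetric] by (rule S'.emeasure_pair_measure_Times[OF U' sign(1)])
  finally show "emeasure B (E \<times> (U \<times> UNIV))
      = emeasure (digit_measure k) E * (emeasure lborel U * ennreal (2 * \<kappa>))" .
qed

lemma emeasure_box:
  assumes E: "E \<in> sets (digit_measure k)" and U: "U \<in> sets borel" and Z: "Z \<in> sets borel"
    and \<kappa>: "\<kappa> \<ge> 0"
  shows "emeasure (coupling_measure k \<kappa>) ((E \<times> (U \<times> UNIV)) \<times> Z)
    = emeasure (digit_measure k) E * (emeasure lborel U * ennreal (2 * \<kappa>)) * emeasure lborel Z"
proof -
  have Z': "Z \<in> sets lborel" using Z by simp
  show ?thesis
    unfolding coupling_measure_def emeasure_base_box(2)[OF E U \<kappa>, symmetric]
    by (rule lborel.emeasure_pair_measure_Times[OF emeasure_base_box(1)[OF E U \<kappa>] Z'])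
qed

definition carry_box :: "digits set \<Rightarrow> coupling_point set" where
  "carry_box E = (E \<times> ({0..1} \<times> UNIV)) \<times> ({- real k..real k} \<times> {- real k..real k})"

lemma carry_box_sets: "E \<in> sets (digit_measure k) \<Longrightarrow> carry_box E \<in> sets (coupling_measure k \<kappa>)"
  unfolding carry_box_def coupling_measure_def
  by (intro pair_measureI) (auto simp: sign_measure_def sets_point_measure borel_prod[symmetric])

lemma emeasure_carry_box:
  assumes "E \<in> sets (digit_measure k)" "\<kappa> \<ge> 0"
  shows "emeasure (coupling_measure k \<kappa>) (carry_box E) = emeasure (digit_measure k) E * ennreal (8 * \<kappa> * real k ^ 2)"
proof -
  let ?I = "{- real k..real k}"
  have "emeasure lborel (?I \<times> ?I) = emeasure lborel ?I * emeasure lborel ?I"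
    by (subst lborel_prod[symmetric], subst lborel.emeasure_pair_measure_Times) simp_all
  also have "\<dots> = ennreal (2 * real k) * ennreal (2 * real k)" by simp
  finally have "emeasure lborel (?I \<times> ?I) = ennreal (4 * real k ^ 2)"
    by (simp add: ennreal_mult[symmetric] power2_eq_square)
  moreover have "?I \<times> ?I \<in> sets borel" by (simp add: borel_prod[symmetric])
  ultimately show ?thesis
    unfolding carry_box_def using assms
    by (simp add: emeasure_box mult.assoc ennreal_mult[symmetric])
qed

lemma lamp_domain_subset_carry_box: "lamp_domain \<subseteq> carry_box digit_seqs"
proof
  fix w assume w: "w \<in> lamp_domain"
  obtain x u \<sigma> p q where wx: "w = ((x, (u, \<sigma>)), (p, q))" by (metis surj_pair)
  note b = lamp_domain_bounded[OF w[unfolded wx]]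
  have "u \<in> {0..1}" "p \<in> {- real k..real k}" "q \<in> {- real k..real k}"
    unfolding atLeastAtMost_iff using b(2-5) by linarith+
  then show "w \<in> carry_box digit_seqs" using b(1) by (simp add: wx carry_box_def)
qed

lemma digit_seqs_sets: "digit_seqs \<in> sets (digit_measure k)"
  using sets.top[of "digit_measure k"] by (simp add: space_digit_measure)

lemma emeasure_lamp_domain:
  assumes "\<kappa> \<ge> 0"
  shows "emeasure (coupling_measure k \<kappa>) lamp_domain < \<infinity>"
proof -
  have "emeasure (coupling_measure k \<kappa>) lamp_domain \<le> emeasure (coupling_measure k \<kappa>) (carry_box digit_seqs)"
    by (intro emeasure_mono lamp_domain_subset_carry_box carry_box_sets digit_seqs_sets)
  also have "\<dots> = ennreal (8 * \<kappa> * real k ^ 2)"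
    using prob_space.emeasure_space_1[OF prob_space_digit_measure]
    by (simp add: emeasure_carry_box[OF digit_seqs_sets assms] space_digit_measure)
  also have "\<dots> < \<infinity>" by simp
  finally show ?thesis .
qed

text \<open>The length of a carry has a geometric tail with ratio \<open>1 / 2\<close>, regardless of the place \<open>n\<close> where it
  starts. So a function that grows at most exponentially in it, with base \<open>r < 2\<close>, is integrable.\<close>

lemma integral_carry_length:
  fixes \<Phi> :: "coupling_point \<Rightarrow> ennreal"
  assumes r: "1 \<le> r" "r < 2" and E: "E \<ge> 0" and \<kappa>: "\<kappa> \<ge> 0"
    and \<Phi>: "\<And>w j. w \<in> lamp_domain \<Longrightarrow> fst (fst w) \<notin> long_carry n j \<Longrightarrow> \<Phi> w \<le> ennreal (E * r ^ j)"
  shows "(\<integral>\<^sup>+w\<in>lamp_domain. \<Phi> w \<partial>coupling_measure k \<kappa>)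
    \<le> ennreal (E * (r * (4 * (8 * \<kappa> * real k ^ 2)) / (1 - r / 2)))"
proof -
  let ?M = "coupling_measure k \<kappa>" and ?W = "8 * \<kappa> * real k ^ 2"
  have "AE w in ?M. \<Phi> w * indicator lamp_domain w
      \<le> (\<Sum>i. ennreal (E * r * r ^ i) * indicator (carry_box (long_carry n i)) w)"
    using AE_coupling_measure[OF AE_short_carry]
  proof eventually_elim
    case (elim w)
    show ?case
    proof (cases "w \<in> lamp_domain")
      case True
      define j where "j = (LEAST j. fst (fst w) \<notin> long_carry n j)"
      have j: "fst (fst w) \<notin> long_carry n j" unfolding j_def using elim by (rule_tac LeastI_ex) blast
      have w_box: "w \<in> carry_box digit_seqs" using True lamp_domain_subset_carry_box by blast
      then have "fst (fst w) \<in> digit_seqs" by (auto simp: carry_box_def)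
      then have "j \<noteq> 0" using j long_carry_0[of n] by metis
      then obtain i where i: "j = Suc i" by (cases j) auto
      have "fst (fst w) \<in> long_carry n i" using not_less_Least[of i "\<lambda>j. fst (fst w) \<notin> long_carry n j"]
        by (simp add: j_def[symmetric] i)
      then have "w \<in> carry_box (long_carry n i)" using w_box by (auto simp: carry_box_def)
      then have "\<Phi> w * indicator lamp_domain w \<le> ennreal (E * r * r ^ i) * indicator (carry_box (long_carry n i)) w"
        using \<Phi>[OF True j] True by (simp add: i mult.assoc)
      also have "\<dots> \<le> (\<Sum>i. ennreal (E * r * r ^ i) * indicator (carry_box (long_carry n i)) w)"
      proof -
        define F :: "nat \<Rightarrow> ennreal" where "F i = ennreal (E * r * r ^ i) * indicator (carry_box (long_carry n i)) w" for i
        have "sum F {i} \<le> suminf F" by (intro sum_le_suminf summableI) auto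
        then have "F i \<le> suminf F" by simp
        then show ?thesis by (simp only: F_def[abs_def])
      qed
      finally show ?thesis .
    qed simp
  qed
  then have "(\<integral>\<^sup>+w\<in>lamp_domain. \<Phi> w \<partial>?M)
      \<le> (\<integral>\<^sup>+w. (\<Sum>i. ennreal (E * r * r ^ i) * indicator (carry_box (long_carry n i)) w) \<partial>?M)"
    by (rule nn_integral_mono_AE)
  also have "\<dots> = (\<Sum>i. \<integral>\<^sup>+w. ennreal (E * r * r ^ i) * indicator (carry_box (long_carry n i)) w \<partial>?M)"
  proof (rule nn_integral_suminf)
    have [measurable]: "carry_box (long_carry n i) \<in> sets ?M" for i by (intro carry_box_sets long_carry_measure)
    show "(\<lambda>w. ennreal (E * r * r ^ i) * indicator (carry_box (long_carry n i)) w) \<in> borel_measurable ?M" for i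
      by measurable
  qed
  also have "\<dots> = (\<Sum>i. ennreal (E * r * r ^ i) * emeasure ?M (carry_box (long_carry n i)))"
    by (intro suminf_cong nn_integral_cmult_indicator carry_box_sets long_carry_measure)
  also have "\<dots> \<le> (\<Sum>i. ennreal (E * r * (4 * ?W) * (r / 2) ^ i))"
  proof (intro suminf_le summableI)
    fix i
    have "ennreal (E * r * r ^ i) * emeasure ?M (carry_box (long_carry n i))
        \<le> ennreal (E * r * r ^ i) * (ennreal (4 * (1 / 2) ^ i) * ennreal ?W)"
      unfolding emeasure_carry_box[OF long_carry_measure(1) \<kappa>]
      by (intro mult_left_mono mult_right_mono long_carry_measure(2)) auto
    also have "\<dots> = ennreal (E * r * r ^ i * (4 * (1 / 2) ^ i * ?W))"
    proof -
      have nn: "0 \<le> E * r * r ^ i" "0 \<le> 4 * (1 / 2 :: real) ^ i" "0 \<le> ?W" using r E \<kappa> by simp_all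
      show ?thesis
        by (simp only: ennreal_mult[OF nn(1) mult_nonneg_nonneg[OF nn(2,3)]] ennreal_mult[OF nn(2,3)])
    qed
    also have "E * r * r ^ i * (4 * (1 / 2) ^ i * ?W) = E * r * (4 * ?W) * (r / 2) ^ i"
      by (simp add: power_divide)
    finally show "ennreal (E * r * r ^ i) * emeasure ?M (carry_box (long_carry n i))
        \<le> ennreal (E * r * (4 * ?W) * (r / 2) ^ i)" .
  qed
  also have "\<dots> = ennreal (\<Sum>i. E * r * (4 * ?W) * (r / 2) ^ i)"
    using r E \<kappa> by (intro suminf_ennreal2) (auto intro!: summable_mult summable_geometric)
  also have "(\<Sum>i. E * r * (4 * ?W) * (r / 2) ^ i) = E * (r * (4 * ?W) / (1 - r / 2))"
    using r suminf_geometric[of "r / 2"] by (subst suminf_mult) (auto intro!: summable_geometric)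
  finally show ?thesis .
qed

end

section \<open>The fundamental domain of SOL\<close>

context lamp_sol
begin

text \<open>The vector from the point to the centre of its unit cell, after the lamplighter has walked the
  height into \<open>[0, 1)\<close>. Finitely many translates of \<open>lamp_domain\<close> would not cover a domain for SOL that
  is given by the position of the point itself, because cells that are separated from the origin by a
  grid line of high level need long carries. But if the centre of the cell lies in the small
  fundamental parallelogram of the lattice, then the cell contains the origin and no carry is needed.\<close>

definition offset :: "bool \<Rightarrow> digits \<Rightarrow> real \<Rightarrow> bool \<Rightarrow> real" where
  "offset s x u \<sigma> = scale k s (u - real_of_int \<lfloor>u\<rfloor>) \<sigma> * (1 / 2 - fraction s (shift (- \<lfloor>u\<rfloor>) x))"

definition sol_domain :: "coupling_point set" where
  "sol_domain = {((x, (u, \<sigma>)), (p, q)) | x u \<sigma> p q. x \<in> digit_seqs \<and> 0 \<le> u \<and> u < climb \<and>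
     (p + offset True x u \<sigma>, q + offset False x u \<sigma>) \<in> parallelogram}"

lemma sol_domain_iff:
  "((x, (u, \<sigma>)), (p, q)) \<in> sol_domain \<longleftrightarrow> x \<in> digit_seqs \<and> 0 \<le> u \<and> u < climb \<and>
     (p + offset True x u \<sigma>, q + offset False x u \<sigma>) \<in> parallelogram"
  by (auto simp: sol_domain_def)

lemma offset_bound:
  assumes "x \<in> digit_seqs"
  shows "\<bar>offset s x u \<sigma>\<bar> \<le> real k"
proof -
  let ?u = "u - real_of_int \<lfloor>u\<rfloor>"
  have "0 \<le> ?u" "?u < 1" by linarith+
  then have "\<bar>scale k s ?u \<sigma>\<bar> \<le> real k" by (rule scale_bounds(1))
  moreover have "\<bar>1 / 2 - fraction s (shift (- \<lfloor>u\<rfloor>) x)\<bar> \<le> 1"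
    using fraction_bounds[OF shift_digit_seqs[OF assms, of "- \<lfloor>u\<rfloor>"], of s] by linarith
  ultimately have "\<bar>scale k s ?u \<sigma>\<bar> * \<bar>1 / 2 - fraction s (shift (- \<lfloor>u\<rfloor>) x)\<bar> \<le> real k * 1"
    by (intro mult_mono) auto
  then show ?thesis by (simp add: offset_def abs_mult)
qed

lemma parallelogram_small:
  assumes "z \<in> parallelogram"
  shows "\<bar>fst z\<bar> < 1 / (2 * real k)" "\<bar>snd z\<bar> < 1 / (2 * real k)" "\<bar>fst z\<bar> \<le> 1" "\<bar>snd z\<bar> \<le> 1"
proof -
  show *: "\<bar>fst z\<bar> < 1 / (2 * real k)" "\<bar>snd z\<bar> < 1 / (2 * real k)"
    using parallelogram_bounds[OF assms] small by linarith+
  have "1 / (2 * real k) \<le> 1" using k_pos by simp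
  then show "\<bar>fst z\<bar> \<le> 1" "\<bar>snd z\<bar> \<le> 1" using * by linarith+
qed

lemma sol_domain_bounded:
  assumes "((x, (u, \<sigma>)), (p, q)) \<in> sol_domain"
  shows "x \<in> digit_seqs" "0 \<le> u" "u < climb" "\<bar>p\<bar> \<le> real k + 1" "\<bar>q\<bar> \<le> real k + 1"
proof -
  show x: "x \<in> digit_seqs" and "0 \<le> u" "u < climb" using assms by (auto simp: sol_domain_iff)
  have "(p + offset True x u \<sigma>, q + offset False x u \<sigma>) \<in> parallelogram"
    using assms by (simp add: sol_domain_iff)
  from parallelogram_small(3,4)[OF this] have "\<bar>p + offset True x u \<sigma>\<bar> \<le> 1" "\<bar>q + offset False x u \<sigma>\<bar> \<le> 1"
    by simp_all
  with offset_bound[OF x, of True u \<sigma>] offset_bound[OF x, of False u \<sigma>]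
  show "\<bar>p\<bar> \<le> real k + 1" "\<bar>q\<bar> \<le> real k + 1" by linarith+
qed

lemma height_return: "0 \<le> u - real_of_int n * climb \<and> u - real_of_int n * climb < climb \<longleftrightarrow> n = \<lfloor>u / climb\<rfloor>"
proof -
  have "n = \<lfloor>u / climb\<rfloor> \<longleftrightarrow> real_of_int n \<le> u / climb \<and> u / climb < real_of_int n + 1"
    by (metis floor_eq_iff)
  also have "\<dots> \<longleftrightarrow> real_of_int n * climb \<le> u \<and> u < (real_of_int n + 1) * climb"
    using climb_pos by (simp add: pos_le_divide_eq pos_divide_less_eq)
  also have "\<dots> \<longleftrightarrow> 0 \<le> u - real_of_int n * climb \<and> u - real_of_int n * climb < climb"
    by (auto simp: distrib_right)
  finally show ?thesis ..
qed

lemma sol_act_in_domain_iff: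
  fixes u :: real and \<sigma> :: bool
  assumes "x \<in> digit_seqs"
  defines "u' n \<equiv> u - real_of_int n * climb" and "\<sigma>' n \<equiv> (\<sigma> = keeps_sign n)"
  shows "sol_act (v, n) ((x, (u, \<sigma>)), (p, q)) \<in> sol_domain \<longleftrightarrow> n = \<lfloor>u / climb\<rfloor> \<and>
    (l powi n * p + offset True x (u' n) (\<sigma>' n) + P v, m powi n * q + offset False x (u' n) (\<sigma>' n) + Q v) \<in> parallelogram"
  using assms(1) height_return[of u n] unfolding u'_def \<sigma>'_def
  by (simp add: sol_act_def sol_domain_iff conj_assoc[symmetric] add_ac)

lemma sol_return_ex1:
  assumes w: "w \<in> space (coupling_measure k \<kappa>)"
  shows "\<exists>!h. h \<in> carrier (SOL_group A) \<and> sol_act h w \<in> sol_domain"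
proof -
  obtain x u \<sigma> p q where wx: "w = ((x, (u, \<sigma>)), (p, q))" by (metis surj_pair)
  have x: "x \<in> digit_seqs" using w by (simp add: wx space_coupling_measure)
  let ?n = "\<lfloor>u / climb\<rfloor>"
  let ?z = "(l powi ?n * p + offset True x (u - real_of_int ?n * climb) (\<sigma> = keeps_sign ?n),
             m powi ?n * q + offset False x (u - real_of_int ?n * climb) (\<sigma> = keeps_sign ?n))"
  obtain v where v: "(fst ?z + P v, snd ?z + Q v) \<in> parallelogram"
    "\<And>v'. (fst ?z + P v', snd ?z + Q v') \<in> parallelogram \<Longrightarrow> v' = v"
    using parallelogram_ex1[of ?z] by blast
  show ?thesis
  proof (rule ex1I[of _ "(v, ?n)"])
    show "(v, ?n) \<in> carrier (SOL_group A) \<and> sol_act (v, ?n) w \<in> sol_domain"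
      using v(1) by (simp add: wx carrier_SOL sol_act_in_domain_iff[OF x])
    fix h assume h: "h \<in> carrier (SOL_group A) \<and> sol_act h w \<in> sol_domain"
    obtain v' n where vn: "h = (v', n)" by (metis surj_pair)
    have "n = ?n \<and> (l powi n * p + offset True x (u - real_of_int n * climb) (\<sigma> = keeps_sign n) + P v',
        m powi n * q + offset False x (u - real_of_int n * climb) (\<sigma> = keeps_sign n) + Q v') \<in> parallelogram"
      by (rule iffD1[OF sol_act_in_domain_iff[OF x] conjunct2[OF h, unfolded wx vn]])
    then have n: "n = ?n" and "(fst ?z + P v', snd ?z + Q v') \<in> parallelogram" by auto
    then show "h = (v, ?n)" using v(2)[of v'] by (simp add: vn)
  qed
qed

text \<open>SOL acts properly on bounded parts of the plane and of the heights, and the offset is bounded.\<close>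

lemma finite_sol_returns:
  "finite {h. \<exists>x u \<sigma> p q. x \<in> digit_seqs \<and> \<bar>u\<bar> \<le> R \<and> \<bar>p\<bar> \<le> R \<and> \<bar>q\<bar> \<le> R \<and>
     sol_act h ((x, (u, \<sigma>)), (p, q)) \<in> sol_domain}" (is "finite ?H")
proof -
  define N where "N = \<lceil>R / climb\<rceil> + 1"
  define B where "B = 1 + real k + l powr real_of_int N * R"
  have "?H \<subseteq> {v. \<bar>P v\<bar> \<le> B \<and> \<bar>Q v\<bar> \<le> B} \<times> {- N..N}"
  proof
    fix h assume "h \<in> ?H"
    then obtain x u \<sigma> p q where x: "x \<in> digit_seqs" and R: "\<bar>u\<bar> \<le> R" "\<bar>p\<bar> \<le> R" "\<bar>q\<bar> \<le> R"
      and dom: "sol_act h ((x, (u, \<sigma>)), (p, q)) \<in> sol_domain" by blast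
    obtain v n where h: "h = (v, n)" by (metis surj_pair)
    let ?o = "\<lambda>s. offset s x (u - real_of_int n * climb) (\<sigma> = keeps_sign n)"
    have "n = \<lfloor>u / climb\<rfloor> \<and> (l powi n * p + ?o True + P v, m powi n * q + ?o False + Q v) \<in> parallelogram"
      by (rule iffD1[OF sol_act_in_domain_iff[OF x] dom[unfolded h]])
    then have n: "n = \<lfloor>u / climb\<rfloor>"
      and par: "(l powi n * p + ?o True + P v, m powi n * q + ?o False + Q v) \<in> parallelogram" by auto
    have "u / climb \<le> R / climb" "- (u / climb) \<le> R / climb"
      using R(1) climb_pos by (simp_all add: divide_le_cancel minus_divide_left del: minus_divide_left[symmetric])
    then have nN: "- N \<le> n" "n \<le> N" unfolding n N_def by linarith+
    then have "\<bar>real_of_int n\<bar> \<le> real_of_int N" by linarith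
    note pow = abs_powi_le[OF this]
    have "\<bar>l powi n\<bar> \<le> l powr real_of_int N" using pow(1) l by simp
    then have "\<bar>l powi n * p\<bar> \<le> l powr real_of_int N * R" "\<bar>m powi n * q\<bar> \<le> l powr real_of_int N * R"
      unfolding abs_mult using pow(2) R by (auto intro!: mult_mono)
    moreover have "\<bar>l powi n * p + ?o True + P v\<bar> \<le> 1" "\<bar>m powi n * q + ?o False + Q v\<bar> \<le> 1"
      using parallelogram_small(3,4)[OF par] by simp_all
    moreover note offset_bound[OF x, of True "u - real_of_int n * climb" "\<sigma> = keeps_sign n"]
      offset_bound[OF x, of False "u - real_of_int n * climb" "\<sigma> = keeps_sign n"]
    ultimately have "\<bar>P v\<bar> \<le> B" "\<bar>Q v\<bar> \<le> B" unfolding B_def by linarith+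
    then show "h \<in> {v. \<bar>P v\<bar> \<le> B \<and> \<bar>Q v\<bar> \<le> B} \<times> {- N..N}" using nN by (simp add: h)
  qed
  then show ?thesis by (rule finite_subset) (intro finite_cartesian_product finite_lattice_ball finite_atLeastAtMost_int)
qed

lemma measurable_offset:
  "(\<lambda>w. offset s (fst w) (fst (snd w)) (snd (snd w)))
     \<in> borel_measurable (base_measure k \<kappa>)" (is "_ \<in> borel_measurable ?B")
proof -
  have height: "(\<lambda>w. fst (snd w)) \<in> borel_measurable ?B"
    by (intro measurable_compose[OF measurable_snd] measurable_fst'') simp
  have floor: "(\<lambda>w. \<lfloor>fst (snd w)\<rfloor>) \<in> ?B \<rightarrow>\<^sub>M count_space UNIV"
    by (rule measurable_compose[OF height measurable_real_floor])
  have "(\<lambda>w. fraction s (shift (- \<lfloor>fst (snd w)\<rfloor>) (fst w))) \<in> borel_measurable ?B"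
  proof (rule measurable_compose_countable'[OF _ floor, of "\<lambda>j w. fraction s (shift (- j) (fst w))"])
    show "(\<lambda>w. fraction s (shift (- j) (fst w))) \<in> borel_measurable ?B" for j
      by (intro measurable_compose[OF measurable_fst] measurable_compose[OF measurable_shift measurable_fraction])
  qed auto
  moreover have "(\<lambda>w. scale k s (fst (snd w) - real_of_int \<lfloor>fst (snd w)\<rfloor>) (snd (snd w))) \<in> borel_measurable ?B"
  proof (rule measurable_compose_countable'[OF _ floor,
        of "\<lambda>j w. scale k s (fst (snd w) - real_of_int j) (snd (snd w))"])
    show "(\<lambda>w. scale k s (fst (snd w) - real_of_int j) (snd (snd w))) \<in> borel_measurable ?B" for j
      using measurable_compose[OF measurable_snd
          measurable_compose[OF distr_height(1)[OF bij_id, where t = "- real_of_int j" and \<kappa> = \<kappa>] measurable_scale[of s \<kappa>]]]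
      by simp
  qed auto
  ultimately show ?thesis unfolding offset_def by (intro borel_measurable_times borel_measurable_diff) simp_all
qed

text \<open>At fixed digits, height and sign, the domain is a translate of the parallelogram.\<close>

lemma sol_domain_measure:
  assumes \<kappa>: "\<kappa> \<ge> 0"
  shows "sol_domain \<in> sets (coupling_measure k \<kappa>)"
    and "emeasure (coupling_measure k \<kappa>) sol_domain
      = ennreal (climb * (2 * \<kappa>)) * emeasure lborel parallelogram"
proof -
  let ?B = "base_measure k \<kappa>"
  let ?M = "coupling_measure k \<kappa>"
  let ?D = "digit_seqs \<times> ({0..<climb} \<times> (UNIV :: bool set))"
  let ?o = "\<lambda>w. (offset True (fst w) (fst (snd w)) (snd (snd w)), offset False (fst w) (fst (snd w)) (snd (snd w)))"
  have U: "{0..<climb} \<in> sets borel" by simp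
  note D = emeasure_base_box[OF digit_seqs_sets U \<kappa>]
  have o: "?o \<in> ?B \<rightarrow>\<^sub>M borel \<Otimes>\<^sub>M borel"
    by (intro measurable_Pair measurable_offset)
  then have "(\<lambda>a. snd a + ?o (fst a)) \<in> borel_measurable (?B \<Otimes>\<^sub>M (lborel :: (real \<times> real) measure))"
    by (intro borel_measurable_add measurable_compose[OF measurable_fst])
      (simp_all add: borel_prod)
  then have X: "(\<lambda>a. snd a + ?o (fst a)) -` parallelogram \<inter> space ?M \<in> sets ?M"
    unfolding coupling_measure_def using parallelogram_borel by (rule measurable_sets)
  have Y: "?D \<times> (UNIV :: (real \<times> real) set) \<in> sets ?M"
    unfolding coupling_measure_def by (rule pair_measureI[OF D(1)]) simp
  have "sol_domain = ((\<lambda>a. snd a + ?o (fst a)) -` parallelogram \<inter> space ?M) \<inter> (?D \<times> UNIV)"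
    by (auto simp: sol_domain_def space_coupling_measure)
  then show sets: "sol_domain \<in> sets ?M" using sets.Int[OF X Y] by (simp only:)
  have slice: "emeasure lborel (Pair w -` sol_domain) = emeasure lborel parallelogram * indicator ?D w"
    if "w \<in> space ?B" for w
  proof (cases "w \<in> ?D")
    case True
    obtain x u \<sigma> where w: "w = (x, (u, \<sigma>))" by (metis surj_pair)
    have "Pair w -` sol_domain = (+) (?o w) -` parallelogram \<inter> space lborel"
      using True by (auto simp: w sol_domain_iff add.commute)
    also have "emeasure lborel \<dots> = emeasure (distr lborel borel ((+) (?o w))) parallelogram"
      using parallelogram_borel by (simp add: emeasure_distr)
    finally show ?thesis using True by (simp add: lborel_distr_plus)
  next
    case False
    then have "Pair w -` sol_domain = {}" by (auto simp: sol_domain_def)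
    then show ?thesis using False by simp
  qed
  have "emeasure ?M sol_domain = (\<integral>\<^sup>+w. emeasure lborel (Pair w -` sol_domain) \<partial>?B)"
    using sets unfolding coupling_measure_def by (rule lborel.emeasure_pair_measure_alt)
  also have "\<dots> = (\<integral>\<^sup>+w. emeasure lborel parallelogram * indicator ?D w \<partial>?B)"
    by (rule nn_integral_cong) (rule slice)
  also have "\<dots> = emeasure lborel parallelogram * emeasure ?B ?D"
    by (rule nn_integral_cmult_indicator[OF D(1)])
  also have "emeasure ?B ?D = ennreal climb * ennreal (2 * \<kappa>)"
    unfolding D(2) using prob_space.emeasure_space_1[OF prob_space_digit_measure] climb_pos
    by (simp add: space_digit_measure)
  finally show "emeasure ?M sol_domain = ennreal (climb * (2 * \<kappa>)) * emeasure lborel parallelogram"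
    using climb_pos \<kappa> by (simp add: ennreal_mult[symmetric] mult.commute)
qed

lemma sol_fundamental_domain:
  assumes "\<kappa> \<ge> 0"
  shows "fundamental_domain (SOL_group A) (coupling_measure k \<kappa>) sol_act sol_domain"
  unfolding fundamental_domain_def
  using sol_domain_measure(1)[OF assms] sol_return_ex1[of _ \<kappa>] by (auto intro: AE_I2)

section \<open>Mutual coboundedness\<close>

text \<open>The centre of the cell is closer to the origin than half the length of a side of the cell.\<close>

lemma walk_sol_domain:
  assumes "((x, (u, \<sigma>)), (p, q)) \<in> sol_domain"
  shows "walk (- \<lfloor>u\<rfloor>) ((x, (u, \<sigma>)), (p, q)) \<in> lamp_domain"
proof -
  let ?u = "u - real_of_int \<lfloor>u\<rfloor>" and ?x = "shift (- \<lfloor>u\<rfloor>) x"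
  have x: "?x \<in> digit_seqs" using sol_domain_bounded(1)[OF assms] by (rule shift_digit_seqs)
  have u: "0 \<le> ?u" "?u < 1" by linarith+
  have "(p + offset True x u \<sigma>, q + offset False x u \<sigma>) \<in> parallelogram"
    using assms by (simp add: sol_domain_iff)
  note par = parallelogram_small(1,2)[OF this]
  have "0 \<le> origin_pos s ((?x, (?u, \<sigma>)), (p, q)) \<and> origin_pos s ((?x, (?u, \<sigma>)), (p, q)) < 1" for s
  proof -
    let ?c = "scale k s ?u \<sigma>" and ?e = "origin_pos s ((?x, (?u, \<sigma>)), (p, q))"
    have "?c * (1 / 2 - ?e) = (if s then p else q) + offset s x u \<sigma>"
      using scale_neq_0[of s ?u \<sigma>] by (simp add: origin_pos_def offset_def algebra_simps)
    then have "\<bar>?c\<bar> * \<bar>1 / 2 - ?e\<bar> < 1 / (2 * real k)"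
      using par by (cases s) (simp_all add: abs_mult[symmetric])
    moreover have "1 / real k * \<bar>1 / 2 - ?e\<bar> \<le> \<bar>?c\<bar> * \<bar>1 / 2 - ?e\<bar>"
      by (rule mult_right_mono[OF scale_bounds(2)[OF u]]) simp
    ultimately have "1 / real k * \<bar>1 / 2 - ?e\<bar> < 1 / (2 * real k)" by linarith
    then have "\<bar>1 / 2 - ?e\<bar> < 1 / 2" using k_pos by (simp add: field_simps)
    then show ?thesis by linarith
  qed
  then show ?thesis using x u by (simp add: lamp_domain_def walk_def)
qed

lemma sol_domain_covered:
  "covered_by_finitely_many_translates (lamplighter_group k) (coupling_measure k \<kappa>) (lamp_act k) lamp_domain sol_domain"
  unfolding covered_by_finitely_many_translates_def
proof (intro exI conjI AE_I2 impI)
  let ?F = "(\<lambda>j. (\<lambda>i::int. 0::int, j)) ` {0..\<lfloor>climb\<rfloor>}"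
  show "finite ?F" by simp
  show "?F \<subseteq> carrier (lamplighter_group k)" using k_pos by (auto simp: carrier_lamplighter)
  fix w assume w: "w \<in> sol_domain"
  obtain x u \<sigma> p q where wx: "w = ((x, (u, \<sigma>)), (p, q))" by (metis surj_pair)
  note b = sol_domain_bounded[OF w[unfolded wx]]
  have "walk (- \<lfloor>u\<rfloor>) w \<in> lamp_domain" using walk_sol_domain w unfolding wx by blast
  moreover have "w = lamp_act k (\<lambda>i. 0, \<lfloor>u\<rfloor>) (walk (- \<lfloor>u\<rfloor>) w)"
    using b(1) by (simp add: wx walk_def lamp_act_walk[OF shift_digit_seqs] shift_shift del: of_int_minus)
  moreover have "\<lfloor>u\<rfloor> \<in> {0..\<lfloor>climb\<rfloor>}" using b(2,3) by (auto intro: floor_mono)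
  ultimately show "w \<in> (\<Union>g\<in>?F. lamp_act k g ` lamp_domain)" by blast
qed

lemma lamp_domain_covered:
  "covered_by_finitely_many_translates (SOL_group A) (coupling_measure k \<kappa>) sol_act sol_domain lamp_domain"
  unfolding covered_by_finitely_many_translates_def
proof (intro exI conjI AE_I2 impI)
  let ?H = "SOL_group A" and ?M = "coupling_measure k \<kappa>"
  interpret H: plain_action ?H ?M sol_act by (rule plain_action_sol)
  let ?R = "{h. \<exists>x u \<sigma> p q. x \<in> digit_seqs \<and> \<bar>u\<bar> \<le> real k \<and> \<bar>p\<bar> \<le> real k \<and> \<bar>q\<bar> \<le> real k \<and>
     sol_act h ((x, (u, \<sigma>)), (p, q)) \<in> sol_domain}"
  show "finite (m_inv ?H ` ?R)" by (intro finite_imageI finite_sol_returns)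
  show "m_inv ?H ` ?R \<subseteq> carrier ?H" by (simp add: carrier_SOL)
  fix w assume wM: "w \<in> space ?M" and w: "w \<in> lamp_domain"
  obtain x u \<sigma> p q where wx: "w = ((x, (u, \<sigma>)), (p, q))" by (metis surj_pair)
  note b = lamp_domain_bounded[OF w[unfolded wx]]
  obtain h where h: "h \<in> carrier ?H" "sol_act h w \<in> sol_domain" using sol_return_ex1[OF wM] by blast
  have "\<bar>u\<bar> \<le> real k" using b k_pos by linarith
  then have "h \<in> ?R" using b h(2) unfolding wx by blast
  then have "m_inv ?H h \<in> m_inv ?H ` ?R" by (rule imageI)
  moreover have "w = sol_act (m_inv ?H h) (sol_act h w)" using H.act_inv(1)[OF h(1) wM] by simp
  then have "w \<in> sol_act (m_inv ?H h) ` sol_domain" by (rule image_eqI[OF _ h(2)])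
  ultimately show "w \<in> (\<Union>g\<in>m_inv ?H ` ?R. sol_act g ` sol_domain)" by (rule UN_I)
qed

end

section \<open>Integrability of the cocycles\<close>

context lamp_sol
begin

lemma coupling_cocycle_eq:
  assumes "g \<in> carrier G" "act g (act' h w) \<in> X"
    and "\<And>g'. g' \<in> carrier G \<Longrightarrow> act g' (act' h w) \<in> X \<Longrightarrow> g' = g"
  shows "coupling_cocycle G act X act' h w = g"
  unfolding coupling_cocycle_def
  by (rule the_equality) (use assms(1,2) in \<open>rule conjI\<close>, use assms(3) in \<open>elim conjE\<close>)

lemma displacement_bounded:
  obtains B where "\<And>x. x \<in> digit_seqs \<Longrightarrow> \<bar>displacement k s f x\<bar> \<le> B"
proof (rule that)
  fix x assume x: "x \<in> digit_seqs"
  have "\<bar>real_of_int (toggle k f x (s, i) - x (s, i)) * weight k s i\<bar> \<le> real k * \<bar>weight k s i\<bar>" for i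
  proof -
    have "\<bar>toggle k f x (s, i) - x (s, i)\<bar> \<le> int k"
      using digit_seqsD[OF x, of "(s, i)"] digit_seqsD[OF toggle_digit_seqs[of f x], of "(s, i)"] by linarith
    then have "\<bar>real_of_int (toggle k f x (s, i) - x (s, i))\<bar> \<le> real k" by linarith
    then show ?thesis unfolding abs_mult by (rule mult_right_mono) simp
  qed
  then show "\<bar>displacement k s f x\<bar> \<le> (\<Sum>i | f i \<noteq> 0. real k * \<bar>weight k s i\<bar>)"
    unfolding displacement_def by (intro order_trans[OF sum_abs] sum_mono)
qed

lemma abs_scale_le: "\<bar>scale k s u \<sigma>\<bar> \<le> real k powr \<bar>u\<bar>"
  using k_pos by (auto simp: scale_def abs_mult intro!: powr_mono)

text \<open>An element of the lamplighter group moves points of the bounded set \<open>sol_domain\<close> by a bounded amount,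
  so only finitely many elements of SOL can bring them back.\<close>

lemma alpha_bounded:
  assumes g: "g \<in> carrier (lamplighter_group k)"
  shows "\<exists>C::nat. AE w in coupling_measure k \<kappa>. w \<in> sol_domain \<longrightarrow>
    word_length (SOL_group A) T (coupling_cocycle (SOL_group A) sol_act sol_domain (lamp_act k) g w) \<le> C"
proof -
  let ?M = "coupling_measure k \<kappa>" and ?H = "SOL_group A"
  interpret G: plain_action "lamplighter_group k" ?M "lamp_act k" by (rule plain_action_lamp)
  obtain f j where gf: "g = (f, j)" by (metis surj_pair)
  obtain B where B: "\<And>s x. x \<in> digit_seqs \<Longrightarrow> \<bar>displacement k s f x\<bar> \<le> B"
  proof -
    obtain B1 B2 where "\<And>x. x \<in> digit_seqs \<Longrightarrow> \<bar>displacement k True f x\<bar> \<le> B1"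
      "\<And>x. x \<in> digit_seqs \<Longrightarrow> \<bar>displacement k False f x\<bar> \<le> B2"
      using displacement_bounded[of True f] displacement_bounded[of False f] by metis
    then have "\<bar>displacement k s f x\<bar> \<le> max B1 B2" if "x \<in> digit_seqs" for s x
      using that by (cases s) (auto simp: le_max_iff_disj)
    then show ?thesis by (rule that)
  qed
  define R where "R = climb + \<bar>real_of_int j\<bar> + (real k + 1) + real k powr (climb + \<bar>real_of_int j\<bar>) * \<bar>B\<bar>"
  define F where "F = {h. \<exists>x u \<sigma> p q. x \<in> digit_seqs \<and> \<bar>u\<bar> \<le> R \<and> \<bar>p\<bar> \<le> R \<and> \<bar>q\<bar> \<le> R \<and>
     sol_act h ((x, (u, \<sigma>)), (p, q)) \<in> sol_domain}"
  have F: "finite F" unfolding F_def by (rule finite_sol_returns)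
  have "coupling_cocycle ?H sol_act sol_domain (lamp_act k) g w \<in> F"
    if wM: "w \<in> space ?M" and w: "w \<in> sol_domain" for w
  proof -
    obtain x u \<sigma> p q where wx: "w = ((x, (u, \<sigma>)), (p, q))" by (metis surj_pair)
    note b = sol_domain_bounded[OF w[unfolded wx]]
    let ?y = "shift j x" and ?u = "u + real_of_int j"
    have y: "?y \<in> digit_seqs" using b(1) by (rule shift_digit_seqs)
    have u: "\<bar>?u\<bar> \<le> climb + \<bar>real_of_int j\<bar>" using b by linarith
    have "\<bar>scale k s ?u \<sigma> * displacement k s f ?y\<bar> \<le> real k powr (climb + \<bar>real_of_int j\<bar>) * \<bar>B\<bar>" for s
    proof -
      have "\<bar>scale k s ?u \<sigma>\<bar> \<le> real k powr (climb + \<bar>real_of_int j\<bar>)"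
        using abs_scale_le[of s ?u \<sigma>] powr_mono[OF u, of "real k"] k_pos by linarith
      moreover have "\<bar>displacement k s f ?y\<bar> \<le> \<bar>B\<bar>" using B[OF y, of s] by linarith
      ultimately show ?thesis unfolding abs_mult by (rule mult_mono) auto
    qed
    note disp = this[of True] this[of False]
    have "0 \<le> real k powr (climb + \<bar>real_of_int j\<bar>) * \<bar>B\<bar>" by simp
    then have R: "\<bar>?u\<bar> \<le> R" "\<bar>p + scale k True ?u \<sigma> * displacement k True f ?y\<bar> \<le> R"
      "\<bar>q + scale k False ?u \<sigma> * displacement k False f ?y\<bar> \<le> R"
      using u b disp climb_pos k_pos unfolding R_def by linarith+
    have act: "lamp_act k g w = ((toggle k f ?y, (?u, \<sigma>)), (p + scale k True ?u \<sigma> * displacement k True f ?y,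
        q + scale k False ?u \<sigma> * displacement k False f ?y))"
      by (simp add: wx gf lamp_act_def)
    obtain h where h: "h \<in> carrier ?H" "sol_act h (lamp_act k g w) \<in> sol_domain"
      "\<And>h'. h' \<in> carrier ?H \<Longrightarrow> sol_act h' (lamp_act k g w) \<in> sol_domain \<Longrightarrow> h' = h"
      using sol_return_ex1[OF G.act_closed[OF g wM]] by blast
    then have "coupling_cocycle ?H sol_act sol_domain (lamp_act k) g w = h" by (intro coupling_cocycle_eq)
    moreover have "h \<in> F"
      unfolding F_def using R h(2) toggle_digit_seqs unfolding act by blast
    ultimately show ?thesis by simp
  qed
  then have "word_length ?H T (coupling_cocycle ?H sol_act sol_domain (lamp_act k) g w) \<le> Max (word_length ?H T ` F)"
    if "w \<in> space ?M" "w \<in> sol_domain" for w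
    using that F by (intro Max_ge) auto
  then show ?thesis by (intro exI AE_I2 impI)
qed

text \<open>The hypothesis of \<open>short_carry_return\<close>: the height is at most \<open>n\<close>, and the carry that brings the cell
  of the point over the origin starts at or below place \<open>n\<close>.\<close>

definition within_range :: "nat \<Rightarrow> coupling_point \<Rightarrow> bool" where
  "within_range n w \<longleftrightarrow> (let j = \<lfloor>fst (snd (fst w))\<rfloor> in
     \<bar>j\<bar> \<le> int n \<and> (\<forall>s. \<bar>\<lfloor>origin_pos s (walk (- j) w)\<rfloor>\<bar> \<le> int k ^ n))"

text \<open>An element of SOL of length \<open>L\<close> changes the height by at most a multiple of \<open>L\<close> and the position in the
  plane by at most an exponential in \<open>L\<close>, and this is at most \<open>k\<^sup>n\<close> cells for some \<open>n\<close> linear in \<open>L\<close>.\<close>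

lemma within_range_sol_act:
  assumes T: "finite_generating_set (SOL_group A) T"
  obtains K :: nat where
    "\<And>h w. w \<in> lamp_domain \<Longrightarrow> within_range (K * (word_length (SOL_group A) T h + 1)) (sol_act h w)"
proof -
  let ?H = "SOL_group A"
  obtain K0 :: real where K0: "K0 > 0" "\<And>v n. \<bar>real_of_int n\<bar> \<le> K0 * word_length ?H T (v, n)"
    "\<And>v n. \<bar>P v\<bar> \<le> exp (K0 * word_length ?H T (v, n))"
    "\<And>v n. \<bar>Q v\<bar> \<le> exp (K0 * word_length ?H T (v, n))"
    using word_length_SOL_ge[OF T] by metis
  \<comment> \<open>The growth rates of \<open>l\<close> to the power \<open>K0 * L\<close> and of \<open>exp (K0 * L)\<close> are both at most \<open>B\<close>.\<close>
  define B where "B = K0 * (1 + ln l)"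
  \<comment> \<open>The point ends at distance at most \<open>(k + 1) * exp (B * L)\<close> from the axes, and the sides of a cell
    have length at least \<open>1 / k\<close>; the summand \<open>2\<close> covers the position in the cell and rounding.\<close>
  define c0 where "c0 = ln (2 + real k * (real k + 1))"
  have lnl: "ln l > 0" and lnk: "ln (real k) > 0" using l k by simp_all
  have c0: "exp c0 = 2 + real k * (real k + 1)" "c0 \<ge> 0"
    using k_pos by (simp_all add: c0_def add_pos_nonneg)
  define K where "K = nat \<lceil>2 + K0 * climb + (c0 + B) / ln (real k)\<rceil>"
  have B0: "B \<ge> 0" using K0(1) lnl by (simp add: B_def)
  have Kge: "real K \<ge> 2 + K0 * climb + (c0 + B) / ln (real k)" unfolding K_def by linarith
  have pos: "0 \<le> K0 * climb" "0 \<le> (c0 + B) / ln (real k)" using K0(1) climb_pos c0 B0 lnk by simp_all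
  have K1: "real K \<ge> 2 + K0 * climb" and "real K \<ge> (c0 + B) / ln (real k)" using Kge pos by linarith+
  then have K2: "ln (real k) * real K \<ge> c0 + B" using lnk by (simp add: pos_divide_le_eq mult.commute)
  show ?thesis
  proof (rule that)
    fix h :: "(int^2) \<times> int" and w assume dom: "w \<in> lamp_domain"
    obtain x u \<sigma> p q where wx: "w = ((x, (u, \<sigma>)), (p, q))" by (metis surj_pair)
    note b = lamp_domain_bounded[OF dom[unfolded wx]]
    obtain v n where h: "h = (v, n)" by (metis surj_pair)
    define L where "L = real (word_length ?H T h)"
    define N where "N = K * (word_length ?H T h + 1)"
    have L: "L \<ge> 0" "real N = real K * (L + 1)" by (simp_all add: L_def N_def algebra_simps)
    let ?u = "u - real_of_int n * climb"
    let ?z = "(l powi n * p + P v, m powi n * q + Q v)"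
    have act: "sol_act h w = ((x, (?u, \<sigma> = keeps_sign n)), ?z)"
      by (simp add: h wx sol_act_def)
    have nL: "\<bar>real_of_int n\<bar> \<le> K0 * L" using K0(2) by (simp add: L_def h)
    have "\<bar>real_of_int n * climb\<bar> \<le> K0 * L * climb"
      unfolding abs_mult using nL climb_pos by (auto intro!: mult_right_mono)
    then have "\<bar>real_of_int n * climb\<bar> \<le> K0 * climb * L" by (simp add: mult_ac)
    moreover have "(2 + K0 * climb) * (L + 1) \<le> real K * (L + 1)"
      using K1 L(1) by (intro mult_right_mono) auto
    then have "2 + 2 * L + K0 * climb * L + K0 * climb \<le> real N" unfolding L(2) by (simp add: algebra_simps)
    ultimately have "\<bar>?u\<bar> + 1 \<le> real N" using b(2,3) pos L(1) by linarith
    then have floor_u: "\<bar>\<lfloor>?u\<rfloor>\<bar> \<le> int N" by linarith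
    have pow: "l powi n \<le> exp (B * L)" "\<bar>m powi n\<bar> \<le> exp (B * L)"
    proof -
      have "l powr (K0 * L) = exp (K0 * L * ln l)" using l by (simp add: powr_def mult.commute)
      also have "\<dots> \<le> exp (B * L)"
        using K0(1) L(1) by (simp add: B_def algebra_simps)
      finally show "l powi n \<le> exp (B * L)" "\<bar>m powi n\<bar> \<le> exp (B * L)"
        using abs_powi_le[OF nL] by linarith+
    qed
    have "exp (K0 * L) \<le> exp (B * L)"
      using K0(1) L(1) lnl by (simp add: B_def mult_right_mono)
    then have PQ: "\<bar>P v\<bar> \<le> exp (B * L)" "\<bar>Q v\<bar> \<le> exp (B * L)"
      using K0(3)[of v n] K0(4)[of v n] unfolding L_def h by linarith+
    have "0 < l powi n" using l by simp
    then have "\<bar>l powi n\<bar> \<le> exp (B * L)" using pow(1) by simp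
    then have "\<bar>l powi n * p\<bar> \<le> exp (B * L) * real k" "\<bar>m powi n * q\<bar> \<le> exp (B * L) * real k"
      unfolding abs_mult using pow(2) b(4,5) by (auto intro!: mult_mono)
    then have z: "\<bar>if s then fst ?z else snd ?z\<bar> \<le> (real k + 1) * exp (B * L)" for s
      using PQ by (cases s) (simp_all add: distrib_right mult.commute[of _ "real k"])
    have "\<bar>\<lfloor>origin_pos s (walk (- \<lfloor>?u\<rfloor>) ((x, (?u, \<sigma> = keeps_sign n)), ?z))\<rfloor>\<bar> \<le> int k ^ N" for s
    proof -
      let ?o = "origin_pos s (walk (- \<lfloor>?u\<rfloor>) ((x, (?u, \<sigma> = keeps_sign n)), ?z))"
      have "0 \<le> ?u + real_of_int (- \<lfloor>?u\<rfloor>)" "?u + real_of_int (- \<lfloor>?u\<rfloor>) < 1" by linarith+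
      from origin_pos_bound[OF shift_digit_seqs[OF b(1)] this, of s "- \<lfloor>?u\<rfloor>" "\<sigma> = keeps_sign n" "fst ?z" "snd ?z"]
      have "\<bar>?o\<bar> \<le> 1 + real k * \<bar>if s then fst ?z else snd ?z\<bar>" by (simp add: walk_def)
      also have "\<dots> \<le> 1 + real k * ((real k + 1) * exp (B * L))"
        using mult_left_mono[OF z[of s], of "real k"] by simp
      finally have "\<bar>?o\<bar> + 1 \<le> 2 + real k * (real k + 1) * exp (B * L)" by (simp add: mult.assoc)
      also have "\<dots> \<le> (2 + real k * (real k + 1)) * exp (B * L)"
        using B0 L(1) by (simp add: distrib_right)
      also have "\<dots> = exp (c0 + B * L)" by (simp add: c0(1) exp_add)
      also have "\<dots> \<le> exp (ln (real k) * real N)"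
      proof -
        have "c0 + B * L \<le> (c0 + B) * (L + 1)" using c0(2) B0 L(1) by (simp add: algebra_simps)
        also have "\<dots> \<le> ln (real k) * real K * (L + 1)" using K2 L(1) by (intro mult_right_mono) auto
        finally show ?thesis by (simp add: L(2) mult.assoc)
      qed
      also have "\<dots> = real k ^ N" using k_pos by (simp add: exp_of_nat2_mult)
      finally have "\<bar>?o\<bar> + 1 \<le> real_of_int (int k ^ N)" by simp
      then show ?thesis by linarith
    qed
    then have "within_range N (sol_act h w)"
      using floor_u unfolding act within_range_def Let_def fst_conv snd_conv by (intro conjI allI)
    then show "within_range (K * (word_length ?H T h + 1)) (sol_act h w)" by (simp only: N_def)
  qed
qed

lemma beta_word_length:
  assumes S: "finite_generating_set (lamplighter_group k) S" and T: "finite_generating_set (SOL_group A) T"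
  obtains C K :: nat where "\<And>h w j. \<lbrakk>w \<in> lamp_domain;
      fst (fst w) \<notin> long_carry (K * (word_length (SOL_group A) T h + 1)) j\<rbrakk> \<Longrightarrow>
    word_length (lamplighter_group k) S
        (coupling_cocycle (lamplighter_group k) (lamp_act k) lamp_domain sol_act h w)
      \<le> C * (3 * (K * (word_length (SOL_group A) T h + 1)) + j + 1)"
proof -
  let ?G = "lamplighter_group k" and ?H = "SOL_group A"
  obtain C :: nat where C: "\<And>f m N. \<lbrakk>(f, m) \<in> carrier ?G; \<forall>i. f i \<noteq> 0 \<longrightarrow> \<bar>i\<bar> \<le> int N; \<bar>m\<bar> \<le> int N\<rbrakk>
      \<Longrightarrow> word_length ?G S (f, m) \<le> C * (N + 1)"
    using word_length_lamplighter_le[OF k S] by metis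
  obtain K :: nat where K: "\<And>h w. w \<in> lamp_domain \<Longrightarrow> within_range (K * (word_length ?H T h + 1)) (sol_act h w)"
    using within_range_sol_act[OF T] by metis
  show ?thesis
  proof (rule that)
    fix h w j assume w: "w \<in> lamp_domain"
    let ?N = "K * (word_length ?H T h + 1)"
    assume short: "fst (fst w) \<notin> long_carry ?N j"
    obtain x u \<sigma> p q where wx: "w = ((x, (u, \<sigma>)), (p, q))" by (metis surj_pair)
    have x: "x \<in> digit_seqs" by (rule lamp_domain_bounded(1)[OF w[unfolded wx]])
    obtain u' \<sigma>' z where act: "sol_act h w = ((x, (u', \<sigma>')), z)"
      by (cases h) (simp add: wx sol_act_def)
    have u': "\<bar>\<lfloor>u'\<rfloor>\<bar> \<le> int ?N"
      and o: "\<bar>\<lfloor>origin_pos s (walk (- \<lfloor>u'\<rfloor>) ((x, (u', \<sigma>')), z))\<rfloor>\<bar> \<le> int k ^ ?N" for s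
      using K[OF w, of h] by (simp_all add: act within_range_def Let_def)
    have "x \<notin> long_carry ?N j" using short by (simp add: wx)
    then obtain f where f: "(f, - \<lfloor>u'\<rfloor>) \<in> carrier ?G" "\<forall>i. f i \<noteq> 0 \<longrightarrow> \<bar>i\<bar> \<le> int (3 * ?N + j)"
      "lamp_act k (f, - \<lfloor>u'\<rfloor>) (sol_act h w) \<in> lamp_domain"
      unfolding act by (rule short_carry_return[OF x u' o])
    have "sol_act h w \<in> space (coupling_measure k 0)"
      using x by (cases z) (simp add: act space_coupling_measure)
    then have "coupling_cocycle ?G (lamp_act k) lamp_domain sol_act h w = (f, - \<lfloor>u'\<rfloor>)"
      using f(1,3) by (intro coupling_cocycle_eq lamp_domain_unique) auto
    moreover have "\<bar>- \<lfloor>u'\<rfloor>\<bar> \<le> int (3 * ?N + j)" using u' by linarith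
    ultimately show "word_length ?G S (coupling_cocycle ?G (lamp_act k) lamp_domain sol_act h w)
        \<le> C * (3 * ?N + j + 1)"
      using C[OF f(1,2)] by simp
  qed
qed

text \<open>By \<open>beta_word_length\<close> the length of the cocycle is at most a multiple of the length of \<open>h\<close> plus a
  multiple of the length of a carry. For small \<open>\<delta>\<close> the exponential of the first part is dominated by
  \<open>exp (\<epsilon> * word_length (SOL_group A) T h)\<close>, and that of the second part has a uniformly bounded
  integral.\<close>

lemma beta_integrable:
  assumes S: "finite_generating_set (lamplighter_group k) S" and T: "finite_generating_set (SOL_group A) T"
    and \<kappa>: "\<kappa> > 0" and \<epsilon>: "\<epsilon> > 0"
  shows "\<exists>\<delta>>0. \<exists>C>0. \<forall>h\<in>carrier (SOL_group A).
    (\<integral>\<^sup>+w\<in>lamp_domain. ennreal (exp (\<delta> * real (word_length (lamplighter_group k) S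
        (coupling_cocycle (lamplighter_group k) (lamp_act k) lamp_domain sol_act h w)))) \<partial>coupling_measure k \<kappa>)
      \<le> ennreal (C * exp (\<epsilon> * real (word_length (SOL_group A) T h)))"
proof -
  let ?G = "lamplighter_group k" and ?H = "SOL_group A"
  let ?c = "coupling_cocycle ?G (lamp_act k) lamp_domain sol_act"
  obtain C K :: nat where CK: "\<And>h w j. \<lbrakk>w \<in> lamp_domain; fst (fst w) \<notin> long_carry (K * (word_length ?H T h + 1)) j\<rbrakk>
      \<Longrightarrow> word_length ?G S (?c h w) \<le> C * (3 * (K * (word_length ?H T h + 1)) + j + 1)"
    using beta_word_length[OF S T] by metis
  \<comment> \<open>The first bound keeps \<open>r\<close> below \<open>2\<close>, the second pays for the part of the estimate that is linear
    in the length of \<open>h\<close>. Adding \<open>1\<close> to the denominators avoids division by \<open>0\<close>.\<close>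
  define \<delta> where "\<delta> = min (ln (3 / 2) / (real C + 1)) (\<epsilon> / (3 * real C * real K + 1))"
  have "ln (3 / 2 :: real) > 0" by simp
  then have \<delta>: "\<delta> > 0" using \<epsilon> by (simp add: \<delta>_def add_nonneg_pos)
  define r where "r = exp (\<delta> * real C)"
  have r: "1 \<le> r" "r < 2"
  proof -
    show "1 \<le> r" using \<delta> by (simp add: r_def)
    have "\<delta> * (real C + 1) \<le> ln (3 / 2) / (real C + 1) * (real C + 1)"
      by (rule mult_right_mono) (simp_all add: \<delta>_def)
    also have "\<dots> = ln (3 / 2)" by simp
    finally have "\<delta> * real C \<le> ln (3 / 2)" using \<delta> by (simp add: distrib_left)
    then have "r \<le> exp (ln (3 / 2))" unfolding r_def by (subst exp_le_cancel_iff)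
    then show "r < 2" by simp
  qed
  have \<delta>\<epsilon>: "\<delta> * (3 * real C * real K) \<le> \<epsilon>"
  proof -
    have "\<delta> * (3 * real C * real K + 1) \<le> \<epsilon> / (3 * real C * real K + 1) * (3 * real C * real K + 1)"
      by (rule mult_right_mono) (simp_all add: \<delta>_def)
    also have "\<dots> = \<epsilon>" by (simp add: add_nonneg_eq_0_iff)
    finally show ?thesis using \<delta> by (simp add: distrib_left)
  qed
  define D where "D = r * (4 * (8 * \<kappa> * real k ^ 2)) / (1 - r / 2)"
  define E0 where "E0 = exp (\<delta> * real C * (3 * real K + 1))"
  have D: "D > 0" using r \<kappa> k_pos by (simp add: D_def)
  have "(\<integral>\<^sup>+w\<in>lamp_domain. ennreal (exp (\<delta> * real (word_length ?G S (?c h w)))) \<partial>coupling_measure k \<kappa>)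
      \<le> ennreal (E0 * D * exp (\<epsilon> * real (word_length ?H T h)))" for h
  proof -
    let ?L = "word_length ?H T h"
    define E where "E = exp (\<delta> * real C * (3 * (real K * (real ?L + 1)) + 1))"
    have "(\<integral>\<^sup>+w\<in>lamp_domain. ennreal (exp (\<delta> * real (word_length ?G S (?c h w)))) \<partial>coupling_measure k \<kappa>)
        \<le> ennreal (E * D)"
      unfolding D_def
    proof (rule integral_carry_length[OF r])
      fix w j assume "w \<in> lamp_domain" "fst (fst w) \<notin> long_carry (K * (?L + 1)) j"
      from CK[OF this] have "real (word_length ?G S (?c h w)) \<le> real (C * (3 * (K * (?L + 1)) + j + 1))"
        by (simp only: of_nat_le_iff)
      then have "\<delta> * real (word_length ?G S (?c h w)) \<le> \<delta> * real (C * (3 * (K * (?L + 1)) + j + 1))"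
        using \<delta> by (intro mult_left_mono) auto
      also have "\<dots> = \<delta> * real C * (3 * (real K * (real ?L + 1)) + 1) + real j * (\<delta> * real C)"
        by (simp add: algebra_simps)
      finally have "exp (\<delta> * real (word_length ?G S (?c h w)))
          \<le> exp (\<delta> * real C * (3 * (real K * (real ?L + 1)) + 1) + real j * (\<delta> * real C))"
        by (subst exp_le_cancel_iff)
      also have "\<dots> = E * r ^ j" by (simp add: E_def r_def exp_add exp_of_nat_mult)
      finally show "ennreal (exp (\<delta> * real (word_length ?G S (?c h w)))) \<le> ennreal (E * r ^ j)"
        by (rule ennreal_leI)
    qed (use \<kappa> in \<open>simp_all add: E_def\<close>)
    also have "E * D \<le> E0 * D * exp (\<epsilon> * real ?L)"
    proof -
      have "\<delta> * (3 * real C * real K) * real ?L \<le> \<epsilon> * real ?L" using \<delta>\<epsilon> by (rule mult_right_mono) simp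
      then have "\<delta> * real C * (3 * (real K * (real ?L + 1)) + 1) \<le> \<delta> * real C * (3 * real K + 1) + \<epsilon> * real ?L"
        by (simp add: algebra_simps)
      then have "E \<le> exp (\<delta> * real C * (3 * real K + 1) + \<epsilon> * real ?L)"
        unfolding E_def by (subst exp_le_cancel_iff)
      then have "E \<le> E0 * exp (\<epsilon> * real ?L)" by (simp add: E0_def exp_add)
      then have "E * D \<le> E0 * exp (\<epsilon> * real ?L) * D" using D by (intro mult_right_mono) auto
      then show ?thesis by (simp add: mult_ac)
    qed
    finally show ?thesis by (simp add: ennreal_leI)
  qed
  moreover have "E0 * D > 0" using D by (simp add: E0_def)
  ultimately show ?thesis using \<delta> by blast
qed

lemma Linf_exp_diamond:
  assumes "\<kappa> > 0"
  shows "Linf_exp_diamond_integrable (lamplighter_group k) (SOL_group A) (coupling_measure k \<kappa>)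
    (lamp_act k) sol_act lamp_domain sol_domain"
  unfolding Linf_exp_diamond_integrable_def
  using ex_finite_generating_set_lamplighter[OF k] ex_finite_generating_set_SOL[OF A]
    alpha_bounded beta_integrable[OF _ _ assms] by simp

text \<open>The mass \<open>\<kappa>\<close> of a sign is the free parameter that normalizes the measure of \<open>sol_domain\<close>.\<close>

lemma ex_normalization:
  obtains \<kappa> where "\<kappa> > 0" "emeasure (coupling_measure k \<kappa>) sol_domain = 1"
proof -
  define a where "a = enn2real (emeasure lborel parallelogram)"
  have ea: "emeasure lborel parallelogram = ennreal a"
    using emeasure_parallelogram(2) by (simp add: a_def top.not_eq_extremum)
  then have a: "a > 0" using emeasure_parallelogram(1) by (simp add: ennreal_eq_0_iff)
  define \<kappa> where "\<kappa> = 1 / (2 * climb * a)"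
  have \<kappa>: "\<kappa> > 0" using a climb_pos by (simp add: \<kappa>_def)
  have "emeasure (coupling_measure k \<kappa>) sol_domain = ennreal (climb * (2 * \<kappa>)) * ennreal a"
    using sol_domain_measure(2) \<kappa> ea by simp
  also have "\<dots> = ennreal (climb * (2 * \<kappa>) * a)" using a \<kappa> climb_pos by (simp add: ennreal_mult)
  also have "climb * (2 * \<kappa>) * a = 1" using a climb_pos by (simp add: \<kappa>_def)
  finally show ?thesis using that \<kappa> by simp
qed

end

section \<open>Encoding by sequences of real numbers\<close>

context digit_base
begin

definition digit_index :: "bool \<times> int \<Rightarrow> nat" where "digit_index = to_nat_on UNIV"
definition index_digit :: "nat \<Rightarrow> bool \<times> int" where "index_digit = from_nat_into UNIV"

lemma infinite_places: "infinite (UNIV :: (bool \<times> int) set)"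
  using infinite_UNIV_int by (simp add: finite_prod)

lemma index_digit_inverse: "index_digit (digit_index j) = j" "digit_index (index_digit n) = n"
  unfolding index_digit_def digit_index_def
  using infinite_places by (simp_all add: to_nat_on_from_nat_into_infinite)

definition encode :: "coupling_point \<Rightarrow> nat \<Rightarrow> real" where
  "encode = (\<lambda>((x, (u, \<sigma>)), (p, q)) n. if n = 0 then p else if n = 1 then q else if n = 2 then u
     else if n = 3 then (if \<sigma> then 1 else 0) else real_of_int (x (index_digit (n - 4))))"

definition decode :: "(nat \<Rightarrow> real) \<Rightarrow> coupling_point" where
  "decode \<phi> = ((\<lambda>j. \<lfloor>\<phi> (digit_index j + 4)\<rfloor>, (\<phi> 2, \<phi> 3 = 1)), (\<phi> 0, \<phi> 1))"

definition code_values :: "nat \<Rightarrow> real set" where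
  "code_values n = (if n < 3 then UNIV else if n = 3 then {0, 1} else real_of_int ` {0..<int k})"

definition codes :: "(nat \<Rightarrow> real) set" where
  "codes = {\<phi>. \<forall>n. \<phi> n \<in> code_values n}"

lemma closed_codes: "closed codes"
proof -
  have "codes = (\<Inter>n. (\<lambda>\<phi>. \<phi> n) -` code_values n)"
    by (auto simp: codes_def)
  moreover have "closed (code_values n)" for n
    by (auto simp: code_values_def intro: finite_imp_closed)
  then have "closed ((\<lambda>\<phi> :: nat \<Rightarrow> real. \<phi> n) -` code_values n)" for n
    by (intro closed_vimage continuous_on_product_coordinates)
  ultimately show ?thesis by (simp add: closed_INT)
qed

lemma measure_iso_encode:
  "measure_iso (coupling_measure k \<kappa>) (restrict_space borel codes) encode decode"
proof
  let ?M = "coupling_measure k \<kappa>" and ?N = "restrict_space borel codes"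
  let ?B = "base_measure k \<kappa>"
  have space_N: "space ?N = codes" by (simp add: space_restrict_space)
  have codes: "encode w \<in> codes" if w: "w \<in> space ?M" for w
  proof -
    obtain x u \<sigma> p q where wx: "w = ((x, (u, \<sigma>)), (p, q))" by (metis surj_pair)
    have "x \<in> digit_seqs" using w by (simp add: wx space_coupling_measure)
    then show ?thesis using digit_seqsD[of x] by (auto simp: wx codes_def code_values_def encode_def)
  qed
  show "decode (encode w) = w" if "w \<in> space ?M" for w
    by (cases w) (auto simp: decode_def encode_def index_digit_inverse split: if_splits)
  show "encode (decode \<phi>) = \<phi>" if "\<phi> \<in> space ?N" for \<phi>
  proof
    fix n
    have mem: "\<phi> n \<in> code_values n"
      using that[unfolded space_N] by (simp add: codes_def)
    consider "n = 0" | "n = 1" | "n = 2" | "n = 3" | "n \<ge> 4" by linarith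
    then show "encode (decode \<phi>) n = \<phi> n"
    proof cases
      case 4
      then show ?thesis using mem by (auto simp: decode_def encode_def code_values_def)
    next
      case 5
      then have "n - 4 + 4 = n" by simp
      then show ?thesis using 5 mem by (auto simp: decode_def encode_def code_values_def index_digit_inverse)
    qed (simp_all add: decode_def encode_def)
  qed
  have coord: "(\<lambda>w. encode w n) \<in> borel_measurable ?M" for n
  proof -
    have p: "(\<lambda>w. fst (snd w)) \<in> borel_measurable ?M" and q: "(\<lambda>w. snd (snd w)) \<in> borel_measurable ?M"
      unfolding coupling_measure_def by (rule measurable_compose[OF measurable_snd], simp add: borel_prod[symmetric])+
    have x: "(\<lambda>w. real_of_int (fst (fst w) j)) \<in> borel_measurable ?M" for j
      unfolding coupling_measure_def
      by (intro measurable_compose[OF measurable_fst] measurable_compose[OF measurable_fst measurable_digit])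
    have "(\<lambda>\<sigma>. if \<sigma> then 1 else 0 :: real) \<in> borel_measurable (sign_measure \<kappa>)"
      by (simp add: sign_measure_def)
    then have \<sigma>: "(\<lambda>w. if snd (snd (fst w)) then 1 else 0 :: real) \<in> borel_measurable ?M"
      unfolding coupling_measure_def
      by (intro measurable_compose[OF measurable_fst] measurable_compose[OF measurable_snd]
          measurable_compose[OF measurable_snd])
    have "(\<lambda>w. encode w n) = (\<lambda>w. if n = 0 then fst (snd w) else if n = 1 then snd (snd w)
        else if n = 2 then fst (snd (fst w)) else if n = 3 then (if snd (snd (fst w)) then 1 else 0)
        else real_of_int (fst (fst w) (index_digit (n - 4))))"
      by (auto simp: encode_def fun_eq_iff)
    then show ?thesis using p q x \<sigma> measurable_height by simp
  qed
  have "encode \<in> ?M \<rightarrow>\<^sub>M PiM UNIV (\<lambda>_. borel)"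
    by (rule measurable_PiM_single') (use coord in auto)
  then have "encode \<in> borel_measurable ?M"
    by (simp cong: measurable_cong_sets add: sets_PiM_equal_borel[symmetric])
  then show "encode \<in> ?M \<rightarrow>\<^sub>M ?N"
    using codes by (intro measurable_restrict_space2) auto
  have coord': "(\<lambda>\<phi>. \<phi> n) \<in> borel_measurable ?N" for n :: nat
    by (intro measurable_restrict_space1 borel_measurable_continuous_onI continuous_on_product_coordinates)
  have digits: "(\<lambda>\<phi>. (\<lambda>j. \<lfloor>\<phi> (digit_index j + 4)\<rfloor>)) \<in> ?N \<rightarrow>\<^sub>M digit_measure k"
    unfolding digit_measure_def
  proof (rule measurable_PiM_single')
    fix j
    let ?f = "\<lambda>\<phi> :: nat \<Rightarrow> real. \<lfloor>\<phi> (digit_index j + 4)\<rfloor>"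
    have fl: "?f \<in> ?N \<rightarrow>\<^sub>M count_space UNIV"
      by (rule measurable_compose[OF coord' measurable_real_floor])
    have "?f \<in> ?N \<rightarrow>\<^sub>M count_space {0..<int k}"
    proof (subst measurable_count_space_eq2)
      have "?f \<phi> \<in> {0..<int k}" if "\<phi> \<in> codes" for \<phi>
      proof -
        have "\<phi> (digit_index j + 4) \<in> real_of_int ` {0..<int k}"
          using that[unfolded codes_def mem_Collect_eq, rule_format, of "digit_index j + 4"]
          by (simp add: code_values_def)
        then show ?thesis by auto
      qed
      then show "?f \<in> space ?N \<rightarrow> {0..<int k} \<and> (\<forall>d\<in>{0..<int k}. ?f -` {d} \<inter> space ?N \<in> sets ?N)"
        using measurable_sets[OF fl] by (auto simp: space_N)
    qed simp
    then show "?f \<in> ?N \<rightarrow>\<^sub>M uniform_count_measure {0..<int k}"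
      by (simp cong: measurable_cong_sets add: sets_uniform_count_measure_count_space)
  next
    have "\<lfloor>\<phi> (digit_index j + 4)\<rfloor> \<in> {0..<int k}" if "\<phi> \<in> codes" for \<phi> j
    proof -
      have "\<phi> (digit_index j + 4) \<in> real_of_int ` {0..<int k}"
        using that[unfolded codes_def mem_Collect_eq, rule_format, of "digit_index j + 4"]
          by (simp add: code_values_def)
      then show ?thesis by auto
    qed
    then show "(\<lambda>\<phi> j. \<lfloor>\<phi> (digit_index j + 4)\<rfloor>) \<in> space ?N \<rightarrow> (\<Pi>\<^sub>E j\<in>UNIV. space (uniform_count_measure {0..<int k}))"
      by (auto simp: space_N space_uniform_count_measure)
  qed
  have "(\<lambda>\<phi>. \<phi> 3 = 1) \<in> ?N \<rightarrow>\<^sub>M count_space UNIV"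
    by (rule measurable_compose[OF coord', of "\<lambda>t. t = 1"]) measurable
  then have sign: "(\<lambda>\<phi>. \<phi> 3 = 1) \<in> ?N \<rightarrow>\<^sub>M sign_measure \<kappa>"
    unfolding sign_measure_def by (simp cong: measurable_cong_sets add: sets_point_measure_count_space)
  have "(\<lambda>\<phi>. (\<phi> 0, \<phi> 1)) \<in> ?N \<rightarrow>\<^sub>M borel \<Otimes>\<^sub>M borel"
    by (intro measurable_Pair coord')
  then have plane: "(\<lambda>\<phi>. (\<phi> 0, \<phi> 1)) \<in> ?N \<rightarrow>\<^sub>M lborel"
    by (simp add: borel_prod)
  have "(\<lambda>\<phi>. \<phi> 2) \<in> ?N \<rightarrow>\<^sub>M lborel" using coord' by simp
  then show "decode \<in> ?N \<rightarrow>\<^sub>M ?M"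
    unfolding decode_def[abs_def] coupling_measure_def
    by (intro measurable_Pair digits sign plane)
qed

end

theorem theorem8p1:
  fixes k :: nat and A :: "int^2^2" and l :: real
  assumes "k \<ge> 2"
    and "A \<in> carrier GL2_int"
    and "l > 1"
    and "\<exists>v::real^2. v \<noteq> 0 \<and> map_matrix real_of_int A *v v = l *s v"
  shows "\<exists>(M :: (nat \<Rightarrow> real) measure) actG actH XG XH.
           me_coupling (lamplighter_group k) (SOL_group A) M actG actH XG XH \<and>
           mutually_cobounded (lamplighter_group k) (SOL_group A) M actG actH XG XH \<and>
           Linf_exp_diamond_integrable (lamplighter_group k) (SOL_group A) M actG actH XG XH"
proof -
  have "1 / (2 * real k) > 0" using assms(1) by simp
  from SOL_eigenforms[OF assms(2,3) this assms(4)]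
  obtain m a b c d where "\<bar>l * m\<bar> = 1"
    "\<And>v. linear_form a b (A *v v) = l * linear_form a b v"
    "\<And>v. linear_form c d (A *v v) = m * linear_form c d v"
    "a * d - b * c \<noteq> 0" "\<bar>a\<bar> + \<bar>b\<bar> < 1 / (2 * real k)" "\<bar>c\<bar> + \<bar>d\<bar> < 1 / (2 * real k)"
    by blast
  then interpret lamp_sol k A l m a b c d
    by unfold_locales (use assms in auto)
  obtain \<kappa> where \<kappa>: "\<kappa> > 0" "emeasure (coupling_measure k \<kappa>) sol_domain = 1"
    using ex_normalization by blast
  then have \<kappa>0: "\<kappa> \<ge> 0" by simp
  let ?M = "coupling_measure k \<kappa>" and ?N = "restrict_space borel codes"
  let ?G = "lamplighter_group k" and ?H = "SOL_group A"
  interpret iso: measure_iso ?M ?N encode decode by (rule measure_iso_encode)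
  note G = plain_action_lamp[of \<kappa>] and H = plain_action_sol[of \<kappa>]
  have sub: "lamp_domain \<subseteq> space ?M" "sol_domain \<subseteq> space ?M"
    using sets.sets_into_space[OF lamp_domain_sets] sets.sets_into_space[OF sol_domain_measure(1)[OF \<kappa>0]] .
  have "standard_borel iso.M'"
    by (rule standard_borel_closed_subset[OF closed_codes]) (simp_all add: space_restrict_space)
  then have "me_coupling ?G ?H iso.M' (iso.act' (lamp_act k)) (iso.act' sol_act)
      (encode ` lamp_domain) (encode ` sol_domain)"
    using G H sigma_finite_coupling_measure lamp_fundamental_domain sol_fundamental_domain[OF \<kappa>0]
      \<kappa>(2) emeasure_lamp_domain[OF \<kappa>0]
    by (intro iso.me_coupling_transport actions_commute)
  moreover have "mutually_cobounded ?G ?H iso.M' (iso.act' (lamp_act k)) (iso.act' sol_act)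
      (encode ` lamp_domain) (encode ` sol_domain)"
    unfolding mutually_cobounded_def
    using iso.covered_transport[OF H sub(2,1) lamp_domain_covered]
      iso.covered_transport[OF G sub sol_domain_covered] by blast
  moreover have "Linf_exp_diamond_integrable ?G ?H iso.M' (iso.act' (lamp_act k)) (iso.act' sol_act)
      (encode ` lamp_domain) (encode ` sol_domain)"
    by (rule iso.Linf_exp_diamond_transport[OF G H sub Linf_exp_diamond[OF \<kappa>(1)]])
  ultimately show ?thesis by blast
qed

end
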